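(* Let $\gamma \in (0,1)$ and let $\mu$ be a non-trivial probability measure on the unit circle $\partial\mathbb{D}$ whose Verblunsky coefficients $\{\alpha_n\}_{n\in\mathbb{Z}_+}$ satisfy $$\sum_{n=0}^\infty n^\gamma |\alpha_n|^2 < \infty .$$ Then there is a set $S \subset \partial\mathbb{D}$ of Hausdorff dimension at most $1-\gamma$ such that for every $z \in \partial\mathbb{D}\setminus S$, $$\sup_{n\ge 0} \|T_n(z)\| < \infty,$$ where $T_n(z)$ are the Szeg\H{o} matrices associated with $\mu$. In particular, the singular part $\mu_{\mathrm{sing}}$ of $\mu$ is supported by a set of Hausdorff dimension at most $1-\gamma$.
   Context: $\mathbb{D}=\{z\in\mathbb{C}:|z|<1\}$, $\partial\mathbb{D}=\{z\in\mathbb{C}:|z|=1\}$, $\mathbb{Z}_+=\{0,1,2,\dots\}$. A probability measure $\mu$ on $\partial\mathbb{D}$ is non-trivial if it is not supported on a finite set. Let $\Phi_n(z)$ be the monic orthogonal polynomials of $\mu$, obtained by applying Gram-Schmidt to $1,z,z^2,\dots$ in $L^2(\partial\mathbb{D},d\mu)$. For a polynomial $P$ of index $n$ (i.e. of degree $n$) its Szeg\H{o} dual is $P^*(z)=z^n\overline{P(1/\overline z)}$. The Verblunsky coefficients of $\mu$ are the unique $\alpha_n\in\mathbb{D}$, $n\in\mathbb{Z}_+$, with $\Phi_{n+1}(z)=z\Phi_n(z)-\overline{\alpha}_n\Phi_n^*(z)$ for all $n\in\mathbb{Z}_+$. Put $\rho_n=(1-|\alpha_n|^2)^{1/2}$,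 and let $\varphi_n(z)=\Phi_n(z)/\|\Phi_n\|_{L^2(\mu)}$ be the orthonormal polynomials; then $\varphi_0=1$ and $$\begin{pmatrix}\varphi_{n+1}(z)\\ \varphi_{n+1}^*(z)\end{pmatrix}=\frac1{\rho_n}\begin{pmatrix} z&-\overline{\alpha}_n\\-\alpha_n z&1\end{pmatrix}\begin{pmatrix}\varphi_n(z)\\ \varphi_n^*(z)\end{pmatrix}.$$ The polynomials of the second kind $\psi_n$ are defined by $\psi_0=1$ and $$\begin{pmatrix}\psi_{n+1}(z)\\ -\psi_{n+1}^*(z)\end{pmatrix}=\frac1{\rho_n}\begin{pmatrix} z&-\overline{\alpha}_n\\-\alpha_n z&1\end{pmatrix}\begin{pmatrix}\psi_n(z)\\ -\psi_n^*(z)\end{pmatrix}.$$ The Szeg\H{o} matrices are $$T_n(z)=\frac12\begin{pmatrix}\varphi_n(z)+\psi_n(z)&\varphi_n(z)-\psi_n(z)\\ \varphi_n^*(z)-\psi_n^*(z)&\varphi_n^*(z)+\psi_n^*(z)\end{pmatrix},$$ and $\|\cdot\|$ is the matrix (operator) norm. $\mu_{\mathrm{sing}}$ is the part of $\mu$ singular with respect to Lebesgue (arc length) measure on $\partial\mathbb{D}$. A measure $\nu$ is supported by a set $A$ if $\nu$ of the complement of $A$ is $0$. *)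

theory Defs
  imports "HOL-Probability.Probability" "HOL-Computational_Algebra.Polynomial"
begin

section \<open>Measures on the unit circle\<close>

abbreviation unit_circle :: "complex set" where
  "unit_circle \<equiv> sphere 0 1"

abbreviation circle_borel :: "complex measure" where
  "circle_borel \<equiv> restrict_space borel unit_circle"

definition arc_length :: "complex measure" where
  "arc_length = distr (restrict_space lborel {0..<2 * pi}) circle_borel cis"

text \<open>Membership in \<open>null_sets\<close> also demands that the complement be measurable;
  \<open>emeasure\<close> alone would return 0 on every non-measurable set.\<close>

definition supported_by :: "'a measure \<Rightarrow> 'a set \<Rightarrow> bool" where
  "supported_by \<nu> A \<longleftrightarrow> space \<nu> - A \<in> null_sets \<nu>"

definition nontrivial :: "'a measure \<Rightarrow> bool" where
  "nontrivial \<mu> \<longleftrightarrow> \<not> (\<exists>F. finite F \<and> supported_by \<mu> F)"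

definition mutually_singular :: "'a measure \<Rightarrow> 'a measure \<Rightarrow> bool" where
  "mutually_singular M N \<longleftrightarrow> (\<exists>A. A \<in> null_sets M \<and> space N - A \<in> null_sets N)"

text \<open>\<open>absolutely_continuous M N\<close> reads: \<open>N\<close> is absolutely continuous with respect to \<open>M\<close>.\<close>

definition is_singular_part :: "'a measure \<Rightarrow> 'a measure \<Rightarrow> 'a measure \<Rightarrow> bool" where
  "is_singular_part M \<mu> \<nu> \<longleftrightarrow>
     sets \<nu> = sets \<mu> \<and> mutually_singular M \<nu> \<and>
     (\<exists>\<nu>ac. sets \<nu>ac = sets \<mu> \<and> absolutely_continuous M \<nu>ac \<and>
        (\<forall>A\<in>sets \<mu>. emeasure \<mu> A = emeasure \<nu>ac A + emeasure \<nu> A))"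

definition singular_part :: "'a measure \<Rightarrow> 'a measure \<Rightarrow> 'a measure" where
  "singular_part M \<mu> = (THE \<nu>. is_singular_part M \<mu> \<nu>)"

section \<open>Hausdorff dimension\<close>

text \<open>The case distinction in \<open>hausdorff_weight\<close> is needed because Isabelle has
  \<open>0 powr 0 = 0\<close>, whereas every nonempty set has weight 1 for \<open>s = 0\<close>.\<close>

definition hausdorff_weight :: "real \<Rightarrow> 'a::metric_space set \<Rightarrow> ennreal" where
  "hausdorff_weight s U =
     (if U = {} then 0 else if s = 0 then 1 else ennreal (diameter U powr s))"

definition hausdorff_premeasure :: "real \<Rightarrow> real \<Rightarrow> 'a::metric_space set \<Rightarrow> ennreal" where
  "hausdorff_premeasure \<delta> s A =
     (INF U \<in> {U :: nat \<Rightarrow> 'a set. A \<subseteq> (\<Union>i. U i) \<and> (\<forall>i. bounded (U i) \<and> diameter (U i) \<le> \<delta>)}.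
        \<Sum>i. hausdorff_weight s (U i))"

definition hausdorff_measure :: "real \<Rightarrow> 'a::metric_space set \<Rightarrow> ennreal" where
  "hausdorff_measure s A = (SUP \<delta>\<in>{0<..}. hausdorff_premeasure \<delta> s A)"

definition hausdorff_dim :: "'a::metric_space set \<Rightarrow> ennreal" where
  "hausdorff_dim A = (INF s\<in>{s. 0 \<le> s \<and> hausdorff_measure s A = 0}. ennreal s)"

section \<open>Orthogonal polynomials on the unit circle\<close>

definition poly_inner :: "complex measure \<Rightarrow> complex poly \<Rightarrow> complex poly \<Rightarrow> complex" where
  "poly_inner \<mu> P Q = (\<integral>z. cnj (poly P z) * poly Q z \<partial>\<mu>)"

definition poly_norm :: "complex measure \<Rightarrow> complex poly \<Rightarrow> real" where
  "poly_norm \<mu> P = sqrt (\<integral>z. (cmod (poly P z))\<^sup>2 \<partial>\<mu>)"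

text \<open>Gram--Schmidt applied to \<open>1, z, z\<^sup>2, \<dots>\<close>, without normalisation.\<close>

fun monic_op :: "complex measure \<Rightarrow> nat \<Rightarrow> complex poly" where
  "monic_op \<mu> n = monom 1 n -
     (\<Sum>k<n. smult (poly_inner \<mu> (monic_op \<mu> k) (monom 1 n) /
                    poly_inner \<mu> (monic_op \<mu> k) (monic_op \<mu> k)) (monic_op \<mu> k))"

declare monic_op.simps [simp del]

text \<open>The index of the dual is the degree of the polynomial; see \<open>poly_szego_dual\<close>.\<close>

definition szego_dual :: "complex poly \<Rightarrow> complex poly" where
  "szego_dual P = reflect_poly (map_poly cnj P)"

lemma poly_szego_dual:
  assumes "z \<noteq> 0"
  shows "poly (szego_dual P) z = z ^ degree P * cnj (poly P (1 / cnj z))"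
proof -
  have "poly (map_poly cnj P) (inverse z) = cnj (poly P (1 / cnj z))"
    using poly_cnj[of P "1 / cnj z"] by (simp add: inverse_eq_divide)
  moreover have "degree (map_poly cnj P) = degree P"
    by (simp add: degree_map_poly)
  ultimately show ?thesis
    using poly_reflect_poly_nz[OF assms, of "map_poly cnj P"] by (simp add: szego_dual_def)
qed

definition is_verblunsky :: "complex measure \<Rightarrow> (nat \<Rightarrow> complex) \<Rightarrow> bool" where
  "is_verblunsky \<mu> \<alpha> \<longleftrightarrow>
     (\<forall>n. cmod (\<alpha> n) < 1 \<and>
        monic_op \<mu> (Suc n) =
          [:0, 1:] * monic_op \<mu> n - smult (cnj (\<alpha> n)) (szego_dual (monic_op \<mu> n)))"

definition verblunsky :: "complex measure \<Rightarrow> nat \<Rightarrow> complex" where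
  "verblunsky \<mu> = (THE \<alpha>. is_verblunsky \<mu> \<alpha>)"

definition orthonormal_op :: "complex measure \<Rightarrow> nat \<Rightarrow> complex poly" where
  "orthonormal_op \<mu> n =
     smult (1 / complex_of_real (poly_norm \<mu> (monic_op \<mu> n))) (monic_op \<mu> n)"

definition rho :: "(nat \<Rightarrow> complex) \<Rightarrow> nat \<Rightarrow> real" where
  "rho \<alpha> n = sqrt (1 - (cmod (\<alpha> n))\<^sup>2)"

text \<open>First row of the matrix recursion for \<open>(\<psi>\<^sub>n, -\<psi>\<^sub>n\<^sup>*)\<close>; the second row follows by
  taking duals, see \<open>szego_dual_second_kind_Suc\<close>.\<close>

primrec second_kind :: "(nat \<Rightarrow> complex) \<Rightarrow> nat \<Rightarrow> complex poly" where
  "second_kind \<alpha> 0 = 1"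
| "second_kind \<alpha> (Suc n) =
     smult (1 / complex_of_real (rho \<alpha> n))
       ([:0, 1:] * second_kind \<alpha> n - smult (cnj (\<alpha> n)) (- szego_dual (second_kind \<alpha> n)))"

lemma coeff_szego_dual:
  "coeff (szego_dual P) k = (if k \<le> degree P then cnj (coeff P (degree P - k)) else 0)"
  by (simp add: szego_dual_def coeff_reflect_poly coeff_map_poly degree_map_poly)

lemma degree_second_kind:
  assumes "\<And>n. cmod (\<alpha> n) < 1"
  shows "degree (second_kind \<alpha> n) = n"
proof (induction n)
  case (Suc n)
  have "(cmod (\<alpha> n))\<^sup>2 < 1"
    using assms[of n] by (simp add: power_less_one_iff abs_square_less_1)
  then have rho: "rho \<alpha> n \<noteq> 0" by (simp add: rho_def)
  have nz: "second_kind \<alpha> n \<noteq> 0"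
    using Suc by (metis degree_0 second_kind.simps(1) one_neq_zero)
  have "degree (smult (cnj (\<alpha> n)) (szego_dual (second_kind \<alpha> n))) < Suc n"
    using Suc degree_reflect_poly_le[of "map_poly cnj (second_kind \<alpha> n)"]
    by (auto simp: szego_dual_def degree_map_poly intro: le_imp_less_Suc)
  moreover have "degree (pCons 0 (second_kind \<alpha> n)) = Suc n"
    using Suc nz by simp
  ultimately show ?case
    using rho by (simp add: degree_add_eq_left)
qed simp

lemma szego_dual_second_kind_Suc:
  assumes "\<And>n. cmod (\<alpha> n) < 1"
  shows "- szego_dual (second_kind \<alpha> (Suc n)) =
    smult (1 / complex_of_real (rho \<alpha> n))
      (smult (- \<alpha> n) ([:0, 1:] * second_kind \<alpha> n) - szego_dual (second_kind \<alpha> n))"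
proof (rule poly_eqI)
  fix k
  define p where "p = second_kind \<alpha> n"
  define q where "q = szego_dual p"
  define r where "r = 1 / complex_of_real (rho \<alpha> n)"
  have p: "degree p = n"
    using degree_second_kind[of \<alpha> n] assms by (simp add: p_def)
  have step: "second_kind \<alpha> (Suc n) = smult r (pCons 0 p + smult (cnj (\<alpha> n)) q)"
    by (simp add: p_def q_def r_def)
  have q: "coeff q j = (if j \<le> n then cnj (coeff p (n - j)) else 0)" for j
    by (simp add: q_def coeff_szego_dual p)
  have r: "cnj r = r" by (simp add: r_def)
  have "degree (second_kind \<alpha> (Suc n)) = Suc n"
    using degree_second_kind[of \<alpha> "Suc n"] assms by blast
  then have d: "coeff (szego_dual (second_kind \<alpha> (Suc n))) k =
      (if k \<le> Suc n then cnj (coeff (smult r (pCons 0 p + smult (cnj (\<alpha> n)) q)) (Suc n - k)) else 0)"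
    unfolding coeff_szego_dual step[symmetric] by simp
  have p0: "coeff p j = 0" if "n < j" for j
    using that p by (simp add: coeff_eq_0)
  have "coeff (szego_dual (second_kind \<alpha> (Suc n))) k = r * (\<alpha> n * coeff (pCons 0 p) k + coeff q k)"
  proof (cases k)
    case 0
    then show ?thesis unfolding d by (simp add: q r)
  next
    case (Suc j)
    consider "j < n" | "j = n" | "n < j" by linarith
    then show ?thesis
    proof cases
      case 1
      then have "n - j = Suc (n - Suc j)" by simp
      then have "coeff (pCons 0 p) (n - j) = coeff p (n - Suc j)"
        by (metis coeff_pCons_Suc)
      then show ?thesis unfolding d using 1 Suc by (simp add: q r)
    qed (unfold d, use Suc in \<open>auto simp: q r p0\<close>)
  qed
  moreover have "[:0, 1:] * p = pCons 0 p" by simp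
  ultimately show "coeff (- szego_dual (second_kind \<alpha> (Suc n))) k =
    coeff (smult (1 / complex_of_real (rho \<alpha> n))
      (smult (- \<alpha> n) ([:0, 1:] * second_kind \<alpha> n) - szego_dual (second_kind \<alpha> n))) k"
    unfolding p_def[symmetric] q_def[symmetric] r_def[symmetric] coeff_minus
    by (simp add: algebra_simps del: second_kind.simps smult_pCons mult_pCons_left)
qed

definition szego_matrix :: "complex measure \<Rightarrow> nat \<Rightarrow> complex \<Rightarrow> complex^2^2" where
  "szego_matrix \<mu> n z =
     (let \<phi> = poly (orthonormal_op \<mu> n) z;
          \<phi>s = poly (szego_dual (orthonormal_op \<mu> n)) z;
          \<psi> = poly (second_kind (verblunsky \<mu>) n) z;
          \<psi>s = poly (szego_dual (second_kind (verblunsky \<mu>) n)) z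
      in vector [vector [(\<phi> + \<psi>) / 2, (\<phi> - \<psi>) / 2],
                 vector [(\<phi>s - \<psi>s) / 2, (\<phi>s + \<psi>s) / 2]])"

end

theory Submission
  imports Defs "HOL-Complex_Analysis.Conformal_Mappings"
    "HOL-Computational_Algebra.Fundamental_Theorem_Algebra"
begin

text \<open>Let \<open>A\<close> be the diagonal entry of the transfer matrix over an interval \<open>J\<close> of indices. It is a
  polynomial without zeros in the closed disc, \<open>|A| \<ge> 1\<close> there, and on the circle \<open>ln |A|\<close> controls
  the norm of the transfer matrix. The positive harmonic function \<open>h = ln |A|\<close> satisfies
  \<open>h 0 = - \<Sum>k\<in>J. ln \<rho>\<^sub>k\<close>, so by the mean value property and Harnack's inequality only a few arcs of
  length \<open>\<delta> = N powr (- 1 - \<epsilon>)\<close> contain points where \<open>h\<close> is large at distance \<open>\<delta>\<close> from the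
  circle; passing from there to the circle costs only a factor \<open>1 + O(N powr - \<epsilon>)\<close>
  because the zeros lie outside. Applying this
  to all dyadic subintervals of \<open>[N, 2N)\<close>, \<open>N = 2\<^sup>j\<close>, gives about \<open>N powr (1 - \<gamma> + 2 * \<epsilon>)\<close>
  bad arcs, and at a point lying in only finitely many bad arcs all transfer matrices are bounded.

  At a point where the transfer matrices are bounded, comparing the Weyl solution at \<open>r z\<^sub>0\<close> with the
  second kind polynomials at \<open>z\<^sub>0\<close> bounds the Caratheodory function radially, hence
  \<open>\<mu>(ball z\<^sub>0 h) = O(h)\<close>; the singular part does not charge the set of such points.\<close>

text \<open>Two requirements fix the scale. Harnack's inequality controls \<open>h\<close> only on
  arcs shorter than a fraction of their distance to the circle, while the return to the circle costs
  a factor for each zero, that is exp (O(N / M)) when there are M arcs. A mesh of 1 / N is just too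
  coarse for the second purpose, hence the extra power of N.

  The obstacle is the supremum over n: treating every initial segment of a block separately would
  multiply the number of bad arcs by N. But h 0 is additive over adjacent index intervals, so each
  dyadic level contributes no more than the whole block, and all levels together cost only j + 1. An
  initial segment is a product of at most j + 1 dyadic pieces, each with logarithm O(N powr (- eps /
  2)) on good arcs, and this remains summable over j after multiplication by j + 1. The exponent of
  the count comes from N powr (1 + eps) arcs, a mean of h of order N powr (- \<gamma>), and a
  threshold N powr (- eps).\<close>

section \<open>Rows of transfer matrices\<close>

text \<open>The transfer matrix \<open>S\<^sub>l\<^sub>-\<^sub>1 \<cdots> S\<^sub>0\<close>, where
  \<open>S\<^sub>k\<close> is the one-step Szego matrix of \<open>\<alpha>\<^sub>k\<close>, has second row \<open>(B, A)\<close>; on the unit circle its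
  first row consists of the duals \<open>z\<^sup>l cnj A\<close> and \<open>z\<^sup>l cnj B\<close>.\<close>

primrec szego_row :: "nat \<Rightarrow> (nat \<Rightarrow> complex) \<Rightarrow> complex poly \<times> complex poly" where
  "szego_row 0 \<alpha> = (0, 1)"
| "szego_row (Suc l) \<alpha> =
    (let (B, A) = szego_row l (\<lambda>n. \<alpha> (Suc n)); c = 1 / complex_of_real (rho \<alpha> 0) in
      (smult c (pCons 0 (B - smult (\<alpha> 0) A)), smult c (A - smult (cnj (\<alpha> 0)) B)))"

definition "rowB l \<alpha> = fst (szego_row l \<alpha>)"
definition "rowA l \<alpha> = snd (szego_row l \<alpha>)"

lemma row_0 [simp]: "rowB 0 \<alpha> = 0" "rowA 0 \<alpha> = 1"
  by (simp_all add: rowA_def rowB_def)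

text \<open>A row is multiplied by Szego matrices from the right, so the recursion adds the factor
  of the first index and shifts the sequence. In this direction the second row never needs the first
  one.\<close>

lemma row_Suc:
  "rowB (Suc l) \<alpha> = smult (1 / complex_of_real (rho \<alpha> 0))
     (pCons 0 (rowB l (\<lambda>n. \<alpha> (Suc n)) - smult (\<alpha> 0) (rowA l (\<lambda>n. \<alpha> (Suc n)))))"
  "rowA (Suc l) \<alpha> = smult (1 / complex_of_real (rho \<alpha> 0))
     (rowA l (\<lambda>n. \<alpha> (Suc n)) - smult (cnj (\<alpha> 0)) (rowB l (\<lambda>n. \<alpha> (Suc n))))"
  by (simp_all add: rowA_def rowB_def Let_def split: prod.split)

lemma degree_row: "degree (rowA l \<alpha>) \<le> l \<and> degree (rowB l \<alpha>) \<le> l"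
proof (induction l arbitrary: \<alpha>)
  case (Suc l)
  have "degree (rowB l (\<lambda>n. \<alpha> (Suc n)) - smult (\<alpha> 0) (rowA l (\<lambda>n. \<alpha> (Suc n)))) \<le> l"
    using Suc by (intro degree_diff_le) (auto intro: order_trans[OF degree_smult_le])
  moreover have "degree (rowA l (\<lambda>n. \<alpha> (Suc n)) - smult (cnj (\<alpha> 0)) (rowB l (\<lambda>n. \<alpha> (Suc n)))) \<le> l"
    using Suc by (intro degree_diff_le) (auto intro: order_trans[OF degree_smult_le])
  ultimately show ?case
    unfolding row_Suc by (auto intro!: order_trans[OF degree_smult_le] order_trans[OF degree_pCons_le])
qed auto

lemma rho_pos:
  assumes "cmod (\<alpha> n) < 1" shows "0 < rho \<alpha> n"
  using assms by (simp add: rho_def power_less_one_iff abs_square_less_1)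

lemma rho_sq:
  assumes "cmod (\<alpha> n) < 1" shows "(rho \<alpha> n)\<^sup>2 = 1 - (cmod (\<alpha> n))\<^sup>2"
  using rho_pos[of \<alpha> n, OF assms] unfolding rho_def by simp

text \<open>The matrix with rows \<open>(1, - cnj w)\<close> and \<open>(- w, 1)\<close>, divided by
  \<open>s\<close>, lies in SU(1,1), the group of the form |a|^2 - |b|^2. Both the rows and the Weyl
  solution evolve by such matrices up to a factor z.\<close>

lemma hyperbolic_rotation_norm:
  fixes a b w :: complex
  assumes "s\<^sup>2 = 1 - (cmod w)\<^sup>2" "s > 0"
  shows "(cmod ((a - cnj w * b) / s))\<^sup>2 - (cmod ((b - w * a) / s))\<^sup>2 = (cmod a)\<^sup>2 - (cmod b)\<^sup>2"
proof -
  have *: "(cmod (a - cnj w * b))\<^sup>2 - (cmod (b - w * a))\<^sup>2 = s\<^sup>2 * ((cmod a)\<^sup>2 - (cmod b)\<^sup>2)"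
    unfolding assms(1) cmod_power2 by (simp add: algebra_simps power2_eq_square)
  show ?thesis
    using assms(2) * by (simp add: norm_divide power_divide flip: diff_divide_distrib)
qed

text \<open>Each step is an SU(1,1) rotation followed by multiplication of the \<open>B\<close>
  entry by z. The rotation preserves the form, the factor z can only increase it in the closed disc,
  and the initial row \<open>(0, 1)\<close> has form 1.\<close>

lemma row_indefinite_form:
  assumes "\<And>n. cmod (\<alpha> n) < 1" "cmod z \<le> 1"
  shows "(cmod (poly (rowA l \<alpha>) z))\<^sup>2 - (cmod (poly (rowB l \<alpha>) z))\<^sup>2 \<ge> 1"
    and "cmod z = 1 \<Longrightarrow> (cmod (poly (rowA l \<alpha>) z))\<^sup>2 - (cmod (poly (rowB l \<alpha>) z))\<^sup>2 = 1"
proof -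
  have "(cmod (poly (rowA l \<alpha>) z))\<^sup>2 - (cmod (poly (rowB l \<alpha>) z))\<^sup>2 \<ge> 1
    \<and> (cmod z = 1 \<longrightarrow> (cmod (poly (rowA l \<alpha>) z))\<^sup>2 - (cmod (poly (rowB l \<alpha>) z))\<^sup>2 = 1)"
    using assms(1)
  proof (induction l arbitrary: \<alpha>)
    case (Suc l)
    define a where "a = poly (rowA l (\<lambda>n. \<alpha> (Suc n))) z"
    define b where "b = poly (rowB l (\<lambda>n. \<alpha> (Suc n))) z"
    have A: "poly (rowA (Suc l) \<alpha>) z = (a - cnj (\<alpha> 0) * b) / rho \<alpha> 0"
      by (simp add: row_Suc a_def b_def)
    have B: "poly (rowB (Suc l) \<alpha>) z = z * ((b - \<alpha> 0 * a) / rho \<alpha> 0)"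
      by (simp add: row_Suc a_def b_def)
    have h: "(cmod ((a - cnj (\<alpha> 0) * b) / rho \<alpha> 0))\<^sup>2 - (cmod ((b - \<alpha> 0 * a) / rho \<alpha> 0))\<^sup>2
        = (cmod a)\<^sup>2 - (cmod b)\<^sup>2"
      using Suc.prems by (intro hyperbolic_rotation_norm rho_sq rho_pos)
    have "(cmod (poly (rowB (Suc l) \<alpha>) z))\<^sup>2 = (cmod z)\<^sup>2 * (cmod ((b - \<alpha> 0 * a) / rho \<alpha> 0))\<^sup>2"
      unfolding B norm_mult power_mult_distrib ..
    moreover have "\<dots> \<le> (cmod ((b - \<alpha> 0 * a) / rho \<alpha> 0))\<^sup>2"
      using assms(2) by (intro mult_left_le_one_le) (auto simp: power_le_one)
    moreover have "(cmod a)\<^sup>2 - (cmod b)\<^sup>2 \<ge> 1 \<and> (cmod z = 1 \<longrightarrow> (cmod a)\<^sup>2 - (cmod b)\<^sup>2 = 1)"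
      unfolding a_def b_def by (rule Suc.IH) (rule Suc.prems)
    ultimately show ?case unfolding A using h by auto
  qed auto
  then show "(cmod (poly (rowA l \<alpha>) z))\<^sup>2 - (cmod (poly (rowB l \<alpha>) z))\<^sup>2 \<ge> 1"
    and "cmod z = 1 \<Longrightarrow> (cmod (poly (rowA l \<alpha>) z))\<^sup>2 - (cmod (poly (rowB l \<alpha>) z))\<^sup>2 = 1"
    by auto
qed

lemma cmod_rowA_ge_1:
  assumes "\<And>n. cmod (\<alpha> n) < 1" "cmod z \<le> 1"
  shows "cmod (poly (rowA l \<alpha>) z) \<ge> 1"
proof -
  have "1\<^sup>2 \<le> (cmod (poly (rowA l \<alpha>) z))\<^sup>2"
    using row_indefinite_form(1)[of \<alpha> z l, OF assms] zero_le_power2[of "cmod (poly (rowB l \<alpha>) z)"]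
    unfolding one_power2 by linarith
  then show ?thesis by (rule power2_le_imp_le) simp
qed

text \<open>The entry \<open>B\<close> carries a factor z, so at 0 the recursion for
  \<open>A\<close> decouples into divisions by \<open>rho\<close>.\<close>

lemma poly_row_at_0:
  "poly (rowB l \<alpha>) 0 = 0" "poly (rowA l \<alpha>) 0 = (\<Prod>k<l. 1 / complex_of_real (rho \<alpha> k))"
proof -
  have "poly (rowB l \<alpha>) 0 = 0 \<and> poly (rowA l \<alpha>) 0 = (\<Prod>k<l. 1 / complex_of_real (rho \<alpha> k))"
  proof (induction l arbitrary: \<alpha>)
    case (Suc l)
    have "rho (\<lambda>n. \<alpha> (Suc n)) k = rho \<alpha> (Suc k)" for k by (simp add: rho_def)
    then show ?case using Suc[of "\<lambda>n. \<alpha> (Suc n)"] by (simp add: row_Suc prod.lessThan_Suc_shift del: prod.lessThan_Suc)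
  qed simp
  then show "poly (rowB l \<alpha>) 0 = 0" "poly (rowA l \<alpha>) 0 = (\<Prod>k<l. 1 / complex_of_real (rho \<alpha> k))"
    by auto
qed

text \<open>On the circle both rows have entries of modulus |A| and |B|, so this is the operator
  norm of the transfer matrix for the l1 norm. That choice makes it submultiplicative without a
  constant.\<close>

definition row_norm :: "nat \<Rightarrow> (nat \<Rightarrow> complex) \<Rightarrow> complex \<Rightarrow> real" where
  "row_norm l \<alpha> z = cmod (poly (rowA l \<alpha>) z) + cmod (poly (rowB l \<alpha>) z)"

text \<open>The row of the later l' steps is multiplied by the full matrix of the first l steps. Its
  upper row is expressed by duals of the lower one, which is where \<open>cmod z = 1\<close>
  enters.\<close>

lemma row_add:
  assumes "\<And>n. cmod (\<alpha> n) < 1" and z: "cmod z = 1"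
  shows "poly (rowB (l + l') \<alpha>) z = z ^ l * cnj (poly (rowA l \<alpha>) z) * poly (rowB l' (\<lambda>n. \<alpha> (l + n))) z
           + poly (rowB l \<alpha>) z * poly (rowA l' (\<lambda>n. \<alpha> (l + n))) z"
    and "poly (rowA (l + l') \<alpha>) z = z ^ l * cnj (poly (rowB l \<alpha>) z) * poly (rowB l' (\<lambda>n. \<alpha> (l + n))) z
           + poly (rowA l \<alpha>) z * poly (rowA l' (\<lambda>n. \<alpha> (l + n))) z"
proof -
  have zz: "z * cnj z = 1" using z by (simp add: complex_norm_square[symmetric])
  have "poly (rowB (l + l') \<alpha>) z = z ^ l * cnj (poly (rowA l \<alpha>) z) * poly (rowB l' (\<lambda>n. \<alpha> (l + n))) z
           + poly (rowB l \<alpha>) z * poly (rowA l' (\<lambda>n. \<alpha> (l + n))) z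
     \<and> poly (rowA (l + l') \<alpha>) z = z ^ l * cnj (poly (rowB l \<alpha>) z) * poly (rowB l' (\<lambda>n. \<alpha> (l + n))) z
           + poly (rowA l \<alpha>) z * poly (rowA l' (\<lambda>n. \<alpha> (l + n))) z"
  proof (induction l arbitrary: \<alpha>)
    case (Suc l)
    define b where "b = poly (rowB l' (\<lambda>n. \<alpha> (Suc l + n))) z"
    define a where "a = poly (rowA l' (\<lambda>n. \<alpha> (Suc l + n))) z"
    define B where "B = poly (rowB l (\<lambda>n. \<alpha> (Suc n))) z"
    define A where "A = poly (rowA l (\<lambda>n. \<alpha> (Suc n))) z"
    define s where "s = complex_of_real (1 / rho \<alpha> 0)"
    have s: "cnj s = s" by (simp add: s_def)
    have IH: "poly (rowB (l + l') (\<lambda>n. \<alpha> (Suc n))) z = z ^ l * cnj A * b + B * a"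
       "poly (rowA (l + l') (\<lambda>n. \<alpha> (Suc n))) z = z ^ l * cnj B * b + A * a"
      using Suc.IH[of "\<lambda>n. \<alpha> (Suc n)"] by (auto simp: a_def b_def A_def B_def)
    have st: "poly (rowB (Suc k) \<alpha>) z = s * (z * (poly (rowB k (\<lambda>n. \<alpha> (Suc n))) z - \<alpha> 0 * poly (rowA k (\<lambda>n. \<alpha> (Suc n))) z))"
      "poly (rowA (Suc k) \<alpha>) z = s * (poly (rowA k (\<lambda>n. \<alpha> (Suc n))) z - cnj (\<alpha> 0) * poly (rowB k (\<lambda>n. \<alpha> (Suc n))) z)" for k
      by (simp_all add: row_Suc s_def)
    have "z ^ Suc l * cnj (s * (z * (B - \<alpha> 0 * A))) * b = (z * cnj z) * z ^ l * s * (cnj B - cnj (\<alpha> 0) * cnj A) * b"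
      by (simp add: s algebra_simps)
    also have "\<dots> = z ^ l * s * (cnj B - cnj (\<alpha> 0) * cnj A) * b" by (simp add: zz)
    finally have 1: "z ^ Suc l * cnj (s * (z * (B - \<alpha> 0 * A))) * b = z ^ l * s * (cnj B - cnj (\<alpha> 0) * cnj A) * b" .
    show ?case
      unfolding add_Suc st a_def[symmetric, unfolded add_Suc] b_def[symmetric, unfolded add_Suc]
        A_def[symmetric] B_def[symmetric] IH 1
      by (simp add: s algebra_simps)
  qed simp
  then show "poly (rowB (l + l') \<alpha>) z = z ^ l * cnj (poly (rowA l \<alpha>) z) * poly (rowB l' (\<lambda>n. \<alpha> (l + n))) z
           + poly (rowB l \<alpha>) z * poly (rowA l' (\<lambda>n. \<alpha> (l + n))) z"
    and "poly (rowA (l + l') \<alpha>) z = z ^ l * cnj (poly (rowB l \<alpha>) z) * poly (rowB l' (\<lambda>n. \<alpha> (l + n))) z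
           + poly (rowA l \<alpha>) z * poly (rowA l' (\<lambda>n. \<alpha> (l + n))) z"
    by auto
qed

lemma row_norm_add:
  assumes "\<And>n. cmod (\<alpha> n) < 1" and z: "cmod z = 1"
  shows "row_norm (l + l') \<alpha> z \<le> row_norm l \<alpha> z * row_norm l' (\<lambda>n. \<alpha> (l + n)) z"
  unfolding row_norm_def row_add[OF assms]
  by (rule order_trans[OF add_mono[OF norm_triangle_ineq norm_triangle_ineq]])
     (simp add: norm_mult norm_power z algebra_simps)

text \<open>The square root arises because only |B|^2 = |A|^2 - 1 <= exp (2 x) - 1 <= 4 x is
  available. The bound \<open>x \<le> 1/2\<close> keeps 2 x in the range where exp y <= 1 + 2
  y.\<close>

lemma row_norm_le_exp:
  assumes a: "\<And>n. cmod (\<alpha> n) < 1" and w: "cmod w = 1"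
    and h: "ln (cmod (poly (rowA l \<alpha>) w)) \<le> x" and x: "x \<le> 1/2"
  shows "row_norm l \<alpha> w \<le> exp (4 * sqrt x)"
proof -
  have A1: "cmod (poly (rowA l \<alpha>) w) \<ge> 1" using cmod_rowA_ge_1[of \<alpha> w] a w by simp
  have x0: "0 \<le> x" using A1 h ln_ge_zero[OF A1] by linarith
  have A: "cmod (poly (rowA l \<alpha>) w) \<le> exp x"
  proof -
    have "exp (ln (cmod (poly (rowA l \<alpha>) w))) \<le> exp x" using h by simp
    moreover have "exp (ln (cmod (poly (rowA l \<alpha>) w))) = cmod (poly (rowA l \<alpha>) w)"
      using A1 by (intro exp_ln) linarith
    ultimately show ?thesis by simp
  qed
  have e: "exp y \<le> 1 + 2 * y" if "0 \<le> y" "y \<le> 1" for y :: real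
    using exp_bound[OF that] that by (smt (verit) mult_left_le power2_eq_square)
  have "(cmod (poly (rowB l \<alpha>) w))\<^sup>2 = (cmod (poly (rowA l \<alpha>) w))\<^sup>2 - 1"
    using row_indefinite_form(2)[of \<alpha> w l] a w by simp
  also have "\<dots> \<le> (exp x)\<^sup>2 - 1" using A by (intro diff_right_mono power_mono) auto
  also have "(exp x)\<^sup>2 = exp (2 * x)" by (simp add: exp_double)
  also have "exp (2 * x) - 1 \<le> 4 * x" using e[of "2 * x"] x x0 by simp
  also have "\<dots> = (2 * sqrt x)\<^sup>2" using x0 by (simp add: power_mult_distrib)
  finally have B: "cmod (poly (rowB l \<alpha>) w) \<le> 2 * sqrt x"
    by (rule power2_le_imp_le) (use x0 in simp)
  have "x = sqrt x * sqrt x" using x0 by simp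
  also have "\<dots> \<le> 1 * sqrt x" using x x0 by (intro mult_right_mono) auto
  finally have "x \<le> sqrt x" by simp
  then have "row_norm l \<alpha> w \<le> 1 + 4 * sqrt x"
    unfolding row_norm_def using A B e[of x] x x0 by simp
  also have "\<dots> \<le> exp (4 * sqrt x)" by (rule exp_ge_add_one_self)
  finally show ?thesis .
qed

section \<open>Logarithms of zero-free polynomials\<close>

text \<open>After squaring, the difference of the two sides is affine in c = Re (\<zeta> cnj w) with
  slope (1 - r)^2 / 2, so the worst case is \<zeta> opposite to w. There the claim reduces to (t -
  1) (1 - r) >= 0 with t = |\<zeta>|.\<close>

lemma norm_diff_radial_ge:
  fixes \<zeta> w :: complex
  assumes "cmod \<zeta> \<ge> 1" "cmod w = 1" "0 \<le> r" "r \<le> 1"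
  shows "(1 + r) / 2 * cmod (\<zeta> - w) \<le> cmod (\<zeta> - of_real r * w)"
proof -
  define t c where "t = cmod \<zeta>" and "c = Re (\<zeta> * cnj w)"
  have c: "\<bar>c\<bar> \<le> t"
    using abs_Re_le_cmod[of "\<zeta> * cnj w"] assms(2) by (simp add: c_def t_def norm_mult)
  have e: "(cmod (\<zeta> - of_real x * w))\<^sup>2 = t\<^sup>2 - 2 * x * c + x\<^sup>2" for x
  proof -
    have "(Re w)\<^sup>2 + (Im w)\<^sup>2 = 1" using assms(2) by (metis cmod_power2 one_power2)
    then have "x\<^sup>2 * ((Re w)\<^sup>2 + (Im w)\<^sup>2) = x\<^sup>2" by simp
    then show ?thesis unfolding cmod_power2 c_def t_def
      by (simp add: algebra_simps power2_eq_square)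
  qed
  define f where "f c = (t\<^sup>2 - 2 * r * c + r\<^sup>2) - ((1 + r) / 2)\<^sup>2 * (t\<^sup>2 - 2 * c + 1)" for c
  have t1: "t \<ge> 1" using assms by (simp add: t_def)
  have fl: "f c = (1 - r)\<^sup>2 / 2 * c + (t\<^sup>2 + r\<^sup>2 - ((1 + r) / 2)\<^sup>2 * (t\<^sup>2 + 1))" for c
    by (simp add: f_def field_simps power2_eq_square)
  have "(1 - r)\<^sup>2 / 2 * (- t) \<le> (1 - r)\<^sup>2 / 2 * c" using c by (intro mult_left_mono) auto
  then have "f (- t) \<le> f c" unfolding fl by simp
  moreover have "f (- t) = (t + r)\<^sup>2 - ((1 + r) / 2 * (t + 1))\<^sup>2"
    by (simp add: f_def field_simps power2_eq_square)
  moreover have "(1 + r) / 2 * (t + 1) \<le> t + r"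
    using mult_nonneg_nonneg[of "t - 1" "1 - r"] t1 assms by (simp add: field_simps)
  then have "((1 + r) / 2 * (t + 1))\<^sup>2 \<le> (t + r)\<^sup>2"
    using t1 assms by (intro power_mono) auto
  ultimately have "0 \<le> f c" by simp
  then have "((1 + r) / 2 * cmod (\<zeta> - w))\<^sup>2 \<le> (cmod (\<zeta> - of_real r * w))\<^sup>2"
    using e[of 1] e[of r] unfolding power_mult_distrib by (simp add: f_def)
  then show ?thesis by (rule power2_le_imp_le) simp
qed

lemma poly_radial_bound:
  fixes p :: "complex poly"
  assumes "p \<noteq> 0" "\<And>z. cmod z < 1 \<Longrightarrow> poly p z \<noteq> 0" "cmod w = 1" "0 \<le> r" "r \<le> 1"
  shows "((1 + r) / 2) ^ degree p * cmod (poly p w) \<le> cmod (poly p (of_real r * w))"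
  using assms(1,2)
proof (induction "degree p" arbitrary: p)
  case 0
  obtain c where c: "p = [:c:]" using 0(1)[symmetric] by (rule degree_eq_zeroE)
  show ?case unfolding c by simp
next
  case (Suc n)
  then have "\<not> constant (poly p)" using constant_degree[of p] by simp
  then obtain \<zeta> where z: "poly p \<zeta> = 0" using Fundamental_Theorem_Algebra.fundamental_theorem_of_algebra[of p] by blast
  then obtain q where q: "p = [:- \<zeta>, 1:] * q" unfolding poly_eq_0_iff_dvd by (rule dvdE)
  have q0: "q \<noteq> 0" using Suc.prems q by auto
  have "degree p = Suc (degree q)" unfolding q using q0 by (subst degree_mult_eq) auto
  moreover have "poly q z \<noteq> 0" if "cmod z < 1" for z using Suc.prems(2)[OF that] q by auto
  ultimately have IH: "((1 + r) / 2) ^ degree q * cmod (poly q w) \<le> cmod (poly q (of_real r * w))"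
    using Suc q0 by auto
  have "cmod \<zeta> \<ge> 1" using Suc.prems(2)[of \<zeta>] z by force
  then have "(1 + r) / 2 * cmod (\<zeta> - w) \<le> cmod (\<zeta> - of_real r * w)"
    using norm_diff_radial_ge assms by blast
  from mult_mono[OF this IH]
  have "(1 + r) / 2 * cmod (\<zeta> - w) * (((1 + r) / 2) ^ degree q * cmod (poly q w))
     \<le> cmod (\<zeta> - of_real r * w) * cmod (poly q (of_real r * w))"
    using assms by simp
  moreover have "cmod (poly p x) = cmod (\<zeta> - x) * cmod (poly q x)" for x
    unfolding q poly_mult norm_mult by (simp add: norm_minus_commute)
  ultimately show ?case
    using \<open>degree p = Suc (degree q)\<close> by (simp add: mult_ac)
qed

text \<open>The Cayley transform carries the right half plane to the disc and g p to 0; the Schwarz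
  lemma then bounds it by 1/2 at half the radius, and 3 is (1 + 1/2) / (1 - 1/2).\<close>

lemma harnack_half:
  assumes g: "g holomorphic_on ball p R" and pos: "\<And>z. z \<in> ball p R \<Longrightarrow> 0 \<le> Re (g z)"
    and q: "cmod (q - p) \<le> R / 2" and R: "R > 0"
  shows "Re (g q) \<le> 3 * Re (g p)"
proof -
  have "Re (g q) \<le> 3 * Re (g p) + e" if e: "e > 0" for e
  proof -
    \<comment> \<open>The shift makes the real part strictly positive, so the denominator of
      \<open>\<phi>\<close> cannot vanish; its size e/2 leaves an excess of exactly e after the
      factor 3.\<close>
    define G where "G z = g z + complex_of_real (e/2)" for z
    define u where "u = Re (G p)"
    have Gpos: "Re (G z) > 0" if "z \<in> ball p R" for z using pos[OF that] e by (simp add: G_def)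
    have pB: "p \<in> ball p R" using R by simp
    have ball: "p + of_real R * z \<in> ball p R" if "cmod z < 1" for z
      using that R by (simp add: dist_norm norm_mult)
    have den: "G (p + of_real R * z) + cnj (G p) \<noteq> 0" if "cmod z < 1" for z
      using Gpos[OF ball[OF that]] Gpos[OF pB] by (auto simp: complex_eq_iff)
    define \<phi> where "\<phi> z = (G (p + of_real R * z) - G p) / (G (p + of_real R * z) + cnj (G p))" for z
    have "G holomorphic_on ball p R" unfolding G_def by (intro holomorphic_intros g)
    then have "(\<lambda>z. G (p + of_real R * z)) holomorphic_on ball 0 1"
      by (rule holomorphic_on_compose_gen[of _ _ G "ball p R", unfolded o_def, rotated])
         (use ball in \<open>auto intro!: holomorphic_intros\<close>)
    then have 1: "\<phi> holomorphic_on ball 0 1"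
      unfolding \<phi>_def by (intro holomorphic_intros) (use den in auto)
    have 2: "cmod (\<phi> z) < 1" if z: "cmod z < 1" for z
    proof -
      define x where "x = G (p + of_real R * z)"
      have x: "Re x > 0" using Gpos[OF ball[OF z]] by (simp add: x_def)
      have "(cmod (x - G p))\<^sup>2 < (cmod (x + cnj (G p)))\<^sup>2"
        using mult_pos_pos[OF x Gpos[OF pB]] unfolding cmod_power2
        by (simp add: power2_eq_square algebra_simps)
      then have "cmod (x - G p) < cmod (x + cnj (G p))" by (rule power2_less_imp_less) simp
      then show ?thesis unfolding \<phi>_def x_def[symmetric] norm_divide
        by (smt (verit) divide_less_eq_1 norm_ge_zero)
    qed
    have 3: "\<phi> 0 = 0" by (simp add: \<phi>_def)
    define z where "z = (q - p) / of_real R"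
    have zq: "p + of_real R * z = q" using R by (simp add: z_def)
    have zh: "cmod z \<le> 1/2" using q R by (simp add: z_def norm_divide field_simps)
    then have z1: "cmod z < 1" by simp
    have s: "cmod (\<phi> z) \<le> 1/2" using Schwarz_Lemma(1)[OF 1 3 2 z1] zh by linarith
    have "cmod (G q - G p) \<le> 1/2 * cmod (G q + cnj (G p))"
      using s den[OF z1] unfolding \<phi>_def zq norm_divide by (simp add: field_simps)
    then have "(cmod (G q - G p))\<^sup>2 \<le> (1/2 * cmod (G q + cnj (G p)))\<^sup>2" by (rule power_mono) simp
    then have k: "4 * ((Re (G q) - u)\<^sup>2 + (Im (G q) - Im (G p))\<^sup>2)
        \<le> (Re (G q) + u)\<^sup>2 + (Im (G q) - Im (G p))\<^sup>2"
      unfolding power_mult_distrib cmod_power2 u_def by (simp add: power2_eq_square)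
    then have "4 * (Re (G q) - u)\<^sup>2 \<le> (Re (G q) + u)\<^sup>2"
      using zero_le_power2[of "Im (G q) - Im (G p)"] unfolding distrib_left by linarith
    then have "(2 * (Re (G q) - u))\<^sup>2 \<le> (Re (G q) + u)\<^sup>2"
      unfolding power_mult_distrib by simp
    moreover have "u > 0" using Gpos[OF pB] by (simp add: u_def)
    moreover have "Re (G q) > 0" using Gpos[of q] ball[OF z1] zq by simp
    ultimately have "2 * (Re (G q) - u) \<le> Re (G q) + u"
      by (meson add_nonneg_nonneg less_imp_le power2_le_imp_le)
    then show ?thesis by (simp add: G_def u_def)
  qed
  then show ?thesis using field_le_epsilon by blast
qed

lemma circle_mean_value:
  assumes "g holomorphic_on ball 0 1" "0 < r" "r < 1"
  shows "((\<lambda>t. Re (g (of_real r * cis (2 * pi * t)))) has_integral Re (g 0)) {0..1}"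
proof -
  have "((\<lambda>u. g u / (u - 0)) has_contour_integral (2 * of_real pi * \<i>) * g 0) (circlepath 0 r)"
    using assms by (intro Cauchy_integral_circlepath_simple holomorphic_on_subset[OF assms(1)])
      (auto simp: dist_norm)
  then have "((\<lambda>t. g (circlepath 0 r t) / circlepath 0 r t * (2 * of_real pi * \<i> * r * exp (2 * of_real pi * \<i> * t)))
      has_integral (2 * of_real pi * \<i>) * g 0) {0..1}"
    unfolding has_contour_integral_def
    by (rule has_integral_eq[rotated]) (simp add: vector_derivative_circlepath01)
  then have "((\<lambda>t. (1 / (2 * of_real pi * \<i>)) * (g (circlepath 0 r t) / circlepath 0 r t * (2 * of_real pi * \<i> * r * exp (2 * of_real pi * \<i> * t))))
      has_integral (1 / (2 * of_real pi * \<i>)) * ((2 * of_real pi * \<i>) * g 0)) {0..1}"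
    by (rule has_integral_mult_right)
  moreover have "(1 / (2 * of_real pi * \<i>)) * (g (circlepath 0 r t) / circlepath 0 r t * (2 * of_real pi * \<i> * r * exp (2 * of_real pi * \<i> * t)))
     = g (of_real r * cis (2 * pi * t))" for t
    using assms by (simp add: circlepath cis_conv_exp mult_ac)
  ultimately have "((\<lambda>t. g (of_real r * cis (2 * pi * t))) has_integral g 0) {0..1}"
    by simp
  from has_integral_linear[OF this bounded_linear_Re] show ?thesis by (simp add: o_def)
qed

lemma norm_cis_diff_le: "cmod (cis a - cis b) \<le> \<bar>a - b\<bar>"
proof -
  have "cis a - cis b = cis b * (cis (a - b) - 1)" by (simp add: algebra_simps cis_mult)
  then have "cmod (cis a - cis b) = cmod (exp (\<i> * complex_of_real (a - b)) - 1)"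
    by (simp add: norm_mult cis_conv_exp)
  also have "\<dots> = 2 * \<bar>sin ((a - b) / 2)\<bar>" by (rule dist_exp_i_1)
  also have "\<dots> \<le> 2 * \<bar>(a - b) / 2\<bar>" by (intro mult_left_mono abs_sin_x_le_abs_x) auto
  finally show ?thesis by simp
qed

lemma integral_equipartition:
  fixes f :: "real \<Rightarrow> real"
  assumes "f integrable_on {0..1}" "M > 0"
  shows "integral {0..1} f = (\<Sum>k<M. integral {real k / M..real (Suc k) / M} f)"
proof -
  have "n \<le> M \<Longrightarrow> integral {0..real n / M} f = (\<Sum>k<n. integral {real k / M..real (Suc k) / M} f)" for n
  proof (induction n)
    case (Suc n)
    have "f integrable_on {0..real (Suc n) / M}"
      using Suc.prems assms by (intro integrable_subinterval_real[OF assms(1)]) (auto simp: field_simps)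
    then have "integral {0..real n / M} f + integral {real n / M..real (Suc n) / M} f = integral {0..real (Suc n) / M} f"
      using assms(2) by (intro Henstock_Kurzweil_Integration.integral_combine) (auto simp: divide_right_mono)
    then show ?case using Suc by simp
  qed simp
  from this[of M] show ?thesis using assms(2) by simp
qed

text \<open>The disc of radius \<open>16 / M\<close> about a point of modulus \<open>r\<close> lies in the unit disc, and an arc of length
  \<open>2 * pi / M\<close> has less than half that radius, so Harnack's inequality compares all values on an arc.\<close>

lemma card_large_log_arcs:
  fixes p :: "complex poly" and M :: nat
  assumes ge1: "\<And>z. cmod z \<le> 1 \<Longrightarrow> 1 \<le> cmod (poly p z)"
    and M: "M > 16" and eta: "\<eta> > 0"
  defines "r \<equiv> 1 - 16 / real M"
  defines "K \<equiv> {k. k < M \<and> (\<exists>t\<in>{real k / M..real (Suc k) / M}.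
              \<eta> < ln (cmod (poly p (of_real r * cis (2 * pi * t)))))}"
  shows "real (card K) * \<eta> \<le> 3 * real M * ln (cmod (poly p 0))"
proof -
  have r: "0 < r" "r < 1" using M by (auto simp: r_def field_simps)
  have ne: "poly p z \<noteq> 0" if "z \<in> ball 0 1" for z using ge1[of z] that by auto
  have "poly p holomorphic_on ball 0 1" by (intro holomorphic_intros)
  then obtain g where g: "g holomorphic_on ball 0 1" and eg: "\<And>z. z \<in> ball 0 1 \<Longrightarrow> poly p z = exp (g z)"
    using contractible_imp_holomorphic_log[OF _ convex_imp_contractible] ne
    by (metis convex_ball)
  have Re: "Re (g z) = ln (cmod (poly p z))" if "z \<in> ball 0 1" for z using eg[OF that] by simp
  have pos: "Re (g z) \<ge> 0" if "z \<in> ball 0 1" for z using Re[OF that] ge1[of z] that by simp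
  define f where "f t = Re (g (of_real r * cis (2 * pi * t)))" for t
  have inb: "of_real r * cis x \<in> ball 0 1" for x using r by (simp add: norm_mult)
  have f: "f t = ln (cmod (poly p (of_real r * cis (2 * pi * t))))" for t
    unfolding f_def using Re[OF inb] .
  have mv: "(f has_integral ln (cmod (poly p 0))) {0..1}"
    using circle_mean_value[OF g r] Re[of 0] by (simp add: f_def[abs_def])
  have fpos: "f t \<ge> 0" for t using pos[OF inb] by (simp add: f_def)
  have harn: "f s \<le> 3 * f t" if "\<bar>s - t\<bar> \<le> 1 / M" for s t
  proof -
    let ?p = "of_real r * cis (2 * pi * t)"
    have sub: "ball ?p (16 / M) \<subseteq> ball 0 1"
    proof
      fix z assume "z \<in> ball ?p (16 / M)"
      then have "cmod z < cmod ?p + 16 / M"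
        using norm_triangle_sub[of z ?p] by (simp add: dist_norm norm_minus_commute)
      moreover have "cmod ?p = r" using r by (simp add: norm_mult)
      moreover have "r + 16 / M = 1" by (simp add: r_def)
      ultimately have "cmod z < 1" by linarith
      then show "z \<in> ball 0 1" by simp
    qed
    have hol: "g holomorphic_on ball ?p (16 / M)" using g sub by (rule holomorphic_on_subset)
    have nn: "0 \<le> Re (g z)" if "z \<in> ball ?p (16 / M)" for z using pos[of z] sub that by blast
    have "cmod (of_real r * cis (2 * pi * s) - ?p) = r * cmod (cis (2 * pi * s) - cis (2 * pi * t))"
      using r by (simp add: norm_mult flip: right_diff_distrib)
    also have "\<dots> \<le> 1 * \<bar>2 * pi * s - 2 * pi * t\<bar>"
      using r by (intro mult_mono norm_cis_diff_le) auto
    also have "\<dots> = 2 * pi * \<bar>s - t\<bar>" by (simp add: abs_mult flip: right_diff_distrib)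
    also have "\<dots> \<le> 8 * (1 / M)" using that pi_less_4 by (intro mult_mono) auto
    finally have "cmod (of_real r * cis (2 * pi * s) - ?p) \<le> 16 / M / 2" by simp
    from harnack_half[OF hol nn this] M show ?thesis by (simp add: f_def)
  qed
  have fi: "f integrable_on {0..1}" using mv by (rule has_integral_integrable)
  have fint: "f integrable_on {real k / M..real (Suc k) / M}" if "k < M" for k
    using M that by (intro integrable_subinterval_real[OF fi]) (auto simp: field_simps)
  \<comment> \<open>A single value above \<open>\<eta>\<close> forces f to be at least a third of it
    on the whole arc, so every arc in \<open>K\<close> takes a fixed share of the mean
    value.\<close>
  have low: "\<eta> / 3 * (1 / M) \<le> integral {real k / M..real (Suc k) / M} f" if k: "k \<in> K" for k
  proof -
    obtain s where s: "s \<in> {real k / M..real (Suc k) / M}" "\<eta> < f s" using k by (auto simp: K_def f)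
    have "\<eta> / 3 \<le> f t" if t: "t \<in> {real k / M..real (Suc k) / M}" for t
    proof -
      have "real (Suc k) / M = real k / M + 1 / M" by (simp add: add_divide_distrib)
      then have "\<bar>s - t\<bar> \<le> 1 / M" using s(1) t by auto
      from harn[OF this] s(2) show ?thesis by simp
    qed
    then have "integral {real k / M..real (Suc k) / M} (\<lambda>_. \<eta> / 3) \<le> integral {real k / M..real (Suc k) / M} f"
      using k fint by (intro integral_le) (auto simp: K_def)
    then show ?thesis using M by (simp add: diff_divide_distrib[symmetric] divide_right_mono mult_ac)
  qed
  have "real (card K) * (\<eta> / 3 * (1 / M)) = (\<Sum>k\<in>K. \<eta> / 3 * (1 / M))" by simp
  also have "\<dots> \<le> (\<Sum>k\<in>K. integral {real k / M..real (Suc k) / M} f)"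
    by (intro sum_mono low)
  also have "\<dots> \<le> (\<Sum>k<M. integral {real k / M..real (Suc k) / M} f)"
    using fpos fint by (intro sum_mono2 integral_nonneg) (auto simp: K_def)
  also have "\<dots> = ln (cmod (poly p 0))"
    using integral_equipartition[OF fi, of M] integral_unique[OF mv] M by simp
  finally show ?thesis using M by (simp add: field_simps)
qed

lemma neg_ln_one_minus_le:
  fixes x :: real
  assumes "0 \<le> x" "x \<le> 1/2"
  shows "- ln (1 - x) \<le> 2 * x"
proof -
  have "x * x \<le> 1/2 * x" using assms by (intro mult_right_mono) auto
  then show ?thesis using ln_one_minus_pos_lower_bound[OF assms] by (simp add: power2_eq_square)
qed

text \<open>The square root in \<open>rho\<close> halves - ln (1 - |\<alpha>|^2), which cancels the
  factor 2 of \<open>neg_ln_one_minus_le\<close>.\<close>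

lemma ln_rowA_at_0:
  assumes "\<And>n. cmod (\<alpha> n) < 1" "\<And>k. k < l \<Longrightarrow> (cmod (\<alpha> k))\<^sup>2 \<le> 1/2"
  shows "ln (cmod (poly (rowA l \<alpha>) 0)) \<le> (\<Sum>k<l. (cmod (\<alpha> k))\<^sup>2)"
proof -
  have rp: "0 < rho \<alpha> k" for k using assms(1) by (rule rho_pos)
  have "ln (cmod (poly (rowA l \<alpha>) 0)) = (\<Sum>k<l. ln (1 / rho \<alpha> k))"
    using rp unfolding poly_row_at_0 prod_norm[symmetric]
    by (subst ln_prod) (auto simp: norm_divide less_imp_le less_imp_neq[symmetric])
  also have "\<dots> \<le> (\<Sum>k<l. (cmod (\<alpha> k))\<^sup>2)"
  proof (rule sum_mono)
    fix k assume k: "k \<in> {..<l}"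
    have "1 - (cmod (\<alpha> k))\<^sup>2 > 0" using assms(2)[of k] k by simp
    then have "ln (1 / rho \<alpha> k) = - ln (1 - (cmod (\<alpha> k))\<^sup>2) / 2"
      by (simp add: rho_def ln_div ln_sqrt)
    then show "ln (1 / rho \<alpha> k) \<le> (cmod (\<alpha> k))\<^sup>2"
      using neg_ln_one_minus_le[of "(cmod (\<alpha> k))\<^sup>2"] assms(2)[of k] k by simp
  qed
  finally show ?thesis .
qed

text \<open>With r = 1 - 16 / M each zero costs a factor (1 + r) / 2 = 1 - 8 / M, whose negative
  logarithm is at most 16 / M, and \<open>A\<close> has at most l zeros.\<close>

lemma ln_rowA_radial:
  assumes a: "\<And>n. cmod (\<alpha> n) < 1" and w: "cmod w = 1" and M: "M > 16"
  shows "ln (cmod (poly (rowA l \<alpha>) w)) \<le> 16 * real l / M + ln (cmod (poly (rowA l \<alpha>) (of_real (1 - 16 / M) * w)))"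
proof -
  let ?p = "rowA l \<alpha>" and ?r = "1 - 16 / M"
  let ?x = "(1 + ?r) / 2"
  have ge: "cmod z \<le> 1 \<Longrightarrow> 1 \<le> cmod (poly ?p z)" for z using cmod_rowA_ge_1[OF a] .
  have x: "?x = 1 - 8 / M" by (simp add: field_simps)
  have xr: "0 < ?x" "?x \<le> 1" unfolding x using M by (auto simp: field_simps)
  have r: "0 \<le> ?r" "?r \<le> 1" using M by (auto simp: field_simps)
  have w1: "1 \<le> cmod (poly ?p w)" using ge w by simp
  have w2: "1 \<le> cmod (poly ?p (of_real ?r * w))" using r w by (intro ge) (simp only: norm_mult norm_of_real, simp)
  have "?p \<noteq> 0" using ge[of 0] by auto
  then have "?x ^ degree ?p * cmod (poly ?p w) \<le> cmod (poly ?p (of_real ?r * w))"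
    using w r by (intro poly_radial_bound) (auto, metis ge less_imp_le norm_zero not_one_le_zero)
  moreover have "?x ^ l \<le> ?x ^ degree ?p" using xr degree_row by (intro power_decreasing) auto
  then have "?x ^ l * cmod (poly ?p w) \<le> ?x ^ degree ?p * cmod (poly ?p w)" by (intro mult_right_mono) auto
  ultimately have "?x ^ l * cmod (poly ?p w) \<le> cmod (poly ?p (of_real ?r * w))" by linarith
  moreover have "0 < ?x ^ l * cmod (poly ?p w)" using xr w1 by (intro mult_pos_pos zero_less_power) auto
  ultimately have "ln (?x ^ l * cmod (poly ?p w)) \<le> ln (cmod (poly ?p (of_real ?r * w)))"
    using w2 by (subst ln_le_cancel_iff) auto
  moreover have "ln (?x ^ l * cmod (poly ?p w)) = real l * ln ?x + ln (cmod (poly ?p w))"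
    using ln_mult_pos[of "?x ^ l" "cmod (poly ?p w)"] ln_realpow[of ?x l] xr(1) w1
    by (smt (verit) zero_less_power)
  moreover have "- ln ?x \<le> 2 * (8 / M)" unfolding x using M by (intro neg_ln_one_minus_le) (auto simp: field_simps)
  then have "real l * (- ln ?x) \<le> real l * (2 * (8 / M))" by (rule mult_left_mono) simp
  ultimately show ?thesis by (simp add: field_simps)
qed

section \<open>Covering bounds for the Hausdorff dimension\<close>

text \<open>As in the Borel-Cantelli lemma: every tail of the families covers \<open>A\<close>, and
  the weights of a tail are as small as desired.\<close>

lemma hausdorff_measure_zero_limsup:
  fixes U :: "nat \<Rightarrow> nat \<Rightarrow> 'a::metric_space set"
  assumes s: "s > 0" and fin: "\<And>j. finite (F j)"
    and bd: "\<And>j k. k \<in> F j \<Longrightarrow> bounded (U j k)"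
    and diam: "\<And>j k. k \<in> F j \<Longrightarrow> diameter (U j k) \<le> d j"
    and lim: "d \<longlonglongrightarrow> 0"
    and summ: "summable (\<lambda>j. real (card (F j)) * d j powr s)"
    and cover: "\<And>j1. A \<subseteq> (\<Union>j\<in>{j1..}. \<Union>k\<in>F j. U j k)"
  shows "hausdorff_measure s A = 0"
proof -
  have "hausdorff_premeasure \<delta> s A = 0" if \<delta>: "\<delta> > 0" for \<delta>
  proof -
    have le: "hausdorff_premeasure \<delta> s A \<le> 0 + ennreal e" if e: "e > 0" for e
    proof -
      from suminf_exist_split[OF e summ] obtain j0
        where j0: "\<And>n. n \<ge> j0 \<Longrightarrow> norm (\<Sum>i. real (card (F (i + n))) * d (i + n) powr s) < e"
        by blast
      have "\<forall>\<^sub>F j in sequentially. d j < \<delta>" using lim \<delta> by (rule order_tendstoD)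
      then obtain j2 where j2: "\<And>j. j \<ge> j2 \<Longrightarrow> d j < \<delta>" unfolding eventually_sequentially by blast
      define j1 where "j1 = max j0 j2"
      \<comment> \<open>Padding with empty sets, whose weight is 0, turns the finite families into a
        single sequence via \<open>prod_decode\<close>.\<close>
      define f where "f = (\<lambda>(j, k). hausdorff_weight s (if k \<in> F (j + j1) then U (j + j1) k else {}))"
      define V where "V n = (case prod_decode n of (j, k) \<Rightarrow> if k \<in> F (j + j1) then U (j + j1) k else {})" for n
      have "A \<subseteq> (\<Union>n. V n)"
      proof
        fix x assume "x \<in> A"
        then obtain j k where "j \<ge> j1" "k \<in> F j" "x \<in> U j k" using cover[of j1] by fastforce
        then have "x \<in> V (prod_encode (j - j1, k))" by (simp add: V_def)
        then show "x \<in> (\<Union>n. V n)" by blast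
      qed
      moreover have "bounded (V n) \<and> diameter (V n) \<le> \<delta>" for n
      proof (cases "prod_decode n")
        case (Pair j k)
        show ?thesis
        proof (cases "k \<in> F (j + j1)")
          case True
          have "diameter (U (j + j1) k) \<le> d (j + j1)" using True by (rule diam)
          also have "\<dots> \<le> \<delta>" using j2[of "j + j1"] by (intro less_imp_le) (simp add: j1_def)
          finally show ?thesis using True Pair bd by (simp add: V_def)
        next
          case False
          then show ?thesis using Pair \<delta> by (simp add: V_def)
        qed
      qed
      ultimately have "hausdorff_premeasure \<delta> s A \<le> (\<Sum>n. hausdorff_weight s (V n))"
        unfolding hausdorff_premeasure_def by (intro INF_lower) auto
      also have "\<dots> = (\<Sum>n. f (prod_decode n))"
        by (intro suminf_cong) (simp add: f_def V_def split: prod.split)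
      also have "\<dots> = (\<Sum>j. \<Sum>k. f (j, k))" by (rule suminf_ennreal_2dimen) simp
      also have "\<dots> \<le> (\<Sum>j. ennreal (real (card (F (j + j1))) * d (j + j1) powr s))"
      proof (rule suminf_le)
        fix j
        have "(\<Sum>k. f (j, k)) = (\<Sum>k\<in>F (j + j1). f (j, k))"
          using fin by (intro suminf_finite) (auto simp: f_def hausdorff_weight_def)
        also have "\<dots> \<le> (\<Sum>k\<in>F (j + j1). ennreal (d (j + j1) powr s))"
        proof (rule sum_mono)
          fix k assume k: "k \<in> F (j + j1)"
          have "diameter (U (j + j1) k) powr s \<le> d (j + j1) powr s"
            using s k diam bd by (intro powr_mono2 diameter_ge_0) auto
          then show "f (j, k) \<le> ennreal (d (j + j1) powr s)"
            using k s by (simp add: f_def hausdorff_weight_def ennreal_leI)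
        qed
        also have "\<dots> = ennreal (real (card (F (j + j1))) * d (j + j1) powr s)"
          by (simp add: ennreal_mult ennreal_of_nat_eq_real_of_nat)
        finally show "(\<Sum>k. f (j, k)) \<le> ennreal (real (card (F (j + j1))) * d (j + j1) powr s)" .
      qed auto
      also have "\<dots> = ennreal (\<Sum>j. real (card (F (j + j1))) * d (j + j1) powr s)"
        using summ by (intro suminf_ennreal2) (auto simp: summable_iff_shift[of "\<lambda>j. real (card (F j)) * d j powr s"])
      also have "\<dots> \<le> ennreal e" using j0[of j1] by (intro ennreal_leI) (simp add: j1_def)
      finally show ?thesis by simp
    qed
    have "hausdorff_premeasure \<delta> s A \<le> 0" by (rule ennreal_le_epsilon) (rule le)
    then show ?thesis by simp
  qed
  then show ?thesis unfolding hausdorff_measure_def by (intro antisym SUP_least) auto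
qed

text \<open>The infimum defining the dimension is already approached by exponents just above x. The
  cap b allows the covering argument to assume s < 1.\<close>

lemma hausdorff_dim_leI:
  assumes "0 \<le> x" "x < b" "\<And>s. x < s \<Longrightarrow> s < b \<Longrightarrow> hausdorff_measure s A = 0"
  shows "hausdorff_dim A \<le> ennreal x"
proof (rule ennreal_le_epsilon)
  fix e :: real assume "e > 0"
  define s where "s = x + min (e/2) ((b - x)/2)"
  have s: "x < s" "s < b" "s \<le> x + e" using assms(2) \<open>e > 0\<close> by (auto simp: s_def min_def field_simps)
  then have "hausdorff_dim A \<le> ennreal s"
    unfolding hausdorff_dim_def using assms by (intro INF_lower) auto
  also have "\<dots> \<le> ennreal x + ennreal e"
    using s assms \<open>e > 0\<close> by (simp flip: ennreal_plus add: ennreal_leI)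
  finally show "hausdorff_dim A \<le> ennreal x + ennreal e" .
qed

section \<open>Dyadic decomposition and submultiplicative bounds\<close>

lemma sum_blocks:
  fixes f :: "nat \<Rightarrow> 'a::comm_monoid_add"
  assumes "a \<le> b"
  shows "(\<Sum>q\<in>{a..<b}. \<Sum>k<n. f (q * n + k)) = sum f {a * n..<b * n}"
  using assms
proof (induction b rule: dec_induct)
  case (step b)
  have "(\<Sum>k<n. f (b * n + k)) = sum f {b * n..<Suc b * n}"
    by (rule sum.reindex_bij_witness[of _ "\<lambda>k. k - b * n" "\<lambda>k. b * n + k"]) auto
  moreover have "sum f {a * n..<b * n} + sum f {b * n..<Suc b * n} = sum f {a * n..<Suc b * n}"
    using step.hyps by (intro sum.atLeastLessThan_concat mult_right_mono) auto
  ultimately show ?case using step by simp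
qed simp

text \<open>Think of \<open>\<nu> m l\<close> as the norm of the transfer matrix over \<open>[m, m + l)\<close>.\<close>

lemma dyadic_submultiplicative_bound:
  fixes \<nu> :: "nat \<Rightarrow> nat \<Rightarrow> real"
  assumes sub: "\<And>m l l'. \<nu> m (l + l') \<le> \<nu> m l * \<nu> (m + l) l'"
    and zero: "\<And>m. \<nu> m 0 = 1" and nonneg: "\<And>m l. 0 \<le> \<nu> m l"
    and K: "1 \<le> K"
    and dy: "\<And>i q. i \<le> j \<Longrightarrow> 2 ^ j \<le> q * 2 ^ i \<Longrightarrow> (q + 1) * 2 ^ i \<le> 2 ^ (j + 1) \<Longrightarrow> \<nu> (q * 2 ^ i) (2 ^ i) \<le> K"
    and l: "l \<le> 2 ^ j"
  shows "\<nu> (2 ^ j) l \<le> K ^ (j + 1)"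
proof -
  \<comment> \<open>Generalised to prefixes of every dyadic interval: a prefix longer than the left
    half is that half followed by a prefix of the right half. Each level thus adds at most one
    factor, and the \<open>+ 1\<close> is for the final piece of length at most one.\<close>
  have "i \<le> j \<Longrightarrow> 2 ^ j \<le> q * 2 ^ i \<Longrightarrow> (q + 1) * 2 ^ i \<le> 2 ^ (j + 1) \<Longrightarrow> l \<le> 2 ^ i \<Longrightarrow> \<nu> (q * 2 ^ i) l \<le> K ^ (i + 1)"
    for i q l
  proof (induction i arbitrary: q l)
    case 0
    then have "l = 0 \<or> l = 1" by auto
    then show ?case using dy[of 0 q] zero K 0 by auto
  next
    case (Suc i)
    have e: "q * 2 ^ Suc i = (2 * q) * 2 ^ i" by simp
    show ?case
    proof (cases "l \<le> 2 ^ i")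
      case True
      have "\<nu> ((2 * q) * 2 ^ i) l \<le> K ^ (i + 1)"
        using Suc.prems True by (intro Suc.IH) (auto simp: algebra_simps)
      also have "\<dots> \<le> K ^ (Suc i + 1)" using K by (intro power_increasing) auto
      finally show ?thesis unfolding e .
    next
      case False
      then obtain l' where l': "l = 2 ^ i + l'" using le_Suc_ex[of "2 ^ i" l] by auto
      have "\<nu> (q * 2 ^ Suc i) l = \<nu> ((2 * q) * 2 ^ i) (2 ^ i + l')" unfolding e l' ..
      also have "\<dots> \<le> \<nu> ((2 * q) * 2 ^ i) (2 ^ i) * \<nu> ((2 * q) * 2 ^ i + 2 ^ i) l'" by (rule sub)
      also have "\<dots> \<le> K * K ^ (i + 1)"
      proof (rule mult_mono)
        show "\<nu> ((2 * q) * 2 ^ i) (2 ^ i) \<le> K" using Suc.prems by (intro dy) (auto simp: algebra_simps)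
        have "\<nu> ((2 * q + 1) * 2 ^ i) l' \<le> K ^ (i + 1)"
          using Suc.prems l' by (intro Suc.IH) (auto simp: algebra_simps)
        then show "\<nu> ((2 * q) * 2 ^ i + 2 ^ i) l' \<le> K ^ (i + 1)" by (simp add: algebra_simps)
      qed (use K nonneg in auto)
      finally show ?thesis by simp
    qed
  qed
  from this[of j 1 l] l show ?thesis by simp
qed

text \<open>Split [0, n) into [0, 2^j0), full blocks [2^i, 2^(i+1)) and a prefix of the block
  containing n. Each piece after the first costs a factor \<open>exp (c i)\<close>, with summable
  exponents.\<close>

lemma submultiplicative_bounded:
  fixes \<nu> :: "nat \<Rightarrow> nat \<Rightarrow> real" and c :: "nat \<Rightarrow> real"
  assumes sub: "\<And>m l l'. \<nu> m (l + l') \<le> \<nu> m l * \<nu> (m + l) l'"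
    and nonneg: "\<And>m l. 0 \<le> \<nu> m l"
    and c: "summable c" "\<And>j. 0 \<le> c j"
    and blk: "\<And>j l. j \<ge> j0 \<Longrightarrow> l \<le> 2 ^ j \<Longrightarrow> \<nu> (2 ^ j) l \<le> exp (c j)"
  shows "\<exists>C. \<forall>n. \<nu> 0 n \<le> C"
proof -
  have full: "j \<ge> j0 \<Longrightarrow> \<nu> 0 (2 ^ j) \<le> \<nu> 0 (2 ^ j0) * exp (\<Sum>i\<in>{j0..<j}. c i)" for j
  proof (induction j rule: dec_induct)
    case (step j)
    have "\<nu> 0 (2 ^ Suc j) \<le> \<nu> 0 (2 ^ j) * \<nu> (0 + 2 ^ j) (2 ^ j)"
      using sub[of 0 "2 ^ j" "2 ^ j"] by (simp add: mult_2)
    also have "\<dots> \<le> (\<nu> 0 (2 ^ j0) * exp (\<Sum>i\<in>{j0..<j}. c i)) * exp (c j)"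
      using step blk[of j "2 ^ j"] nonneg by (intro mult_mono) auto
    also have "\<dots> = \<nu> 0 (2 ^ j0) * exp (\<Sum>i\<in>{j0..<Suc j}. c i)"
      using step by (simp add: exp_add)
    finally show ?case .
  qed simp
  \<comment> \<open>The second summand covers the finitely many n up to \<open>2 ^ j0\<close>, where
    no block bound is assumed.\<close>
  define C where "C = \<nu> 0 (2 ^ j0) * exp (suminf c) + (\<Sum>n\<le>2 ^ j0. \<nu> 0 n)"
  have "\<nu> 0 n \<le> C" for n
  proof (cases "n \<le> 2 ^ j0")
    case True
    then have "\<nu> 0 n \<le> (\<Sum>n\<le>2 ^ j0. \<nu> 0 n)" using nonneg by (intro member_le_sum) auto
    then show ?thesis unfolding C_def using nonneg by (smt (verit) exp_ge_zero mult_nonneg_nonneg)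
  next
    case False
    then have "n > 0" by (intro gr0I) simp
    then obtain j where j: "2 ^ j \<le> n" "n < 2 ^ (j + 1)" using ex_power_ivl1[of 2 n] by auto
    have jj: "j \<ge> j0"
    proof (rule ccontr)
      assume "\<not> j \<ge> j0"
      then have "(2::nat) ^ (j + 1) \<le> 2 ^ j0" by (intro power_increasing) auto
      then show False using j False by simp
    qed
    have "\<nu> 0 n \<le> \<nu> 0 (2 ^ j) * \<nu> (0 + 2 ^ j) (n - 2 ^ j)"
      using sub[of 0 "2 ^ j" "n - 2 ^ j"] j by simp
    also have "\<dots> \<le> (\<nu> 0 (2 ^ j0) * exp (\<Sum>i\<in>{j0..<j}. c i)) * exp (c j)"
      using full[OF jj] blk[OF jj, of "n - 2 ^ j"] nonneg j by (intro mult_mono) auto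
    also have "\<dots> = \<nu> 0 (2 ^ j0) * exp (\<Sum>i\<in>{j0..<Suc j}. c i)"
      using jj by (simp add: exp_add)
    also have "\<dots> \<le> \<nu> 0 (2 ^ j0) * exp (suminf c)"
      using c nonneg by (intro mult_left_mono) (auto simp del: sum.op_ivl_Suc intro!: sum_le_suminf)
    also have "\<dots> \<le> C" using nonneg by (simp add: C_def sum_nonneg)
    finally show ?thesis .
  qed
  then show ?thesis by blast
qed

section \<open>Counting the bad arcs at each scale\<close>

locale decaying_coefficients =
  fixes \<alpha> :: "nat \<Rightarrow> complex" and \<gamma> :: real
  assumes \<alpha>: "\<And>n. cmod (\<alpha> n) < 1" and \<gamma>: "0 < \<gamma>" "\<gamma> < 1"
    and summable_\<alpha>: "summable (\<lambda>n. real n powr \<gamma> * (cmod (\<alpha> n))\<^sup>2)"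
begin

definition C where "C = (\<Sum>n. real n powr \<gamma> * (cmod (\<alpha> n))\<^sup>2)"

lemma C_nonneg: "0 \<le> C"
  unfolding C_def by (intro suminf_nonneg summable_\<alpha>) auto

lemma block_sum_le: "(\<Sum>k\<in>{2 ^ j..<2 ^ (j + 1)}. (cmod (\<alpha> k))\<^sup>2) \<le> C * 2 powr (- \<gamma> * real j)"
proof -
  have "2 powr (\<gamma> * real j) * (\<Sum>k\<in>{2 ^ j..<2 ^ (j + 1)}. (cmod (\<alpha> k))\<^sup>2)
     \<le> (\<Sum>k\<in>{2 ^ j..<2 ^ (j + 1)}. real k powr \<gamma> * (cmod (\<alpha> k))\<^sup>2)"
    unfolding sum_distrib_left
  proof (intro sum_mono mult_right_mono)
    fix k assume "k \<in> {2 ^ j..<2 ^ (j + 1) :: nat}"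
    then have "real (2 ^ j) \<le> real k" by (subst of_nat_le_iff) auto
    then have "(2 powr real j) powr \<gamma> \<le> real k powr \<gamma>"
      using \<gamma> by (intro powr_mono2) (auto simp: powr_realpow)
    then show "2 powr (\<gamma> * real j) \<le> real k powr \<gamma>" by (simp add: powr_powr mult.commute)
  qed simp
  also have "\<dots> \<le> C"
    unfolding C_def by (intro sum_le_suminf summable_\<alpha>) auto
  finally show ?thesis by (simp add: powr_minus field_simps)
qed

lemma eventually_small: "\<exists>k0. \<forall>k\<ge>k0. (cmod (\<alpha> k))\<^sup>2 \<le> 1/2"
proof -
  have "\<forall>\<^sub>F k in sequentially. real k powr \<gamma> * (cmod (\<alpha> k))\<^sup>2 < 1/2"
    using summable_LIMSEQ_zero[OF summable_\<alpha>] by (rule order_tendstoD) simp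
  then have "\<forall>\<^sub>F k in sequentially. (cmod (\<alpha> k))\<^sup>2 \<le> 1/2"
    using eventually_ge_at_top[of 1]
  proof eventually_elim
    case (elim k)
    then have "1 \<le> real k powr \<gamma>" using \<gamma> by (intro ge_one_powr_ge_zero) auto
    then have "1 * (cmod (\<alpha> k))\<^sup>2 \<le> real k powr \<gamma> * (cmod (\<alpha> k))\<^sup>2" by (rule mult_right_mono) simp
    then show ?case using elim by simp
  qed
  then show ?thesis by (simp add: eventually_sequentially)
qed

end

locale decaying_coefficients_dim = decaying_coefficients +
  fixes s :: real
  assumes s: "1 - \<gamma> < s" "s < 1"
begin

text \<open>At scale \<open>2\<^sup>j\<close> the circle is cut into \<open>M j\<close> arcs, parametrised by \<open>t \<mapsto> cis (2 * pi * t)\<close>; \<open>K j i q\<close>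
  collects those on which the transfer matrix over \<open>[q 2\<^sup>i, (q + 1) 2\<^sup>i)\<close> is too large.\<close>

definition eps where "eps = (s - (1 - \<gamma>)) / 4"
definition M where "M j = nat \<lceil>2 powr (real j * (1 + eps))\<rceil>"
text \<open>The threshold equals the ratio of 2^j to 2 powr (j (1 + eps)), so it matches the loss of
  the radial comparison.\<close>

definition \<eta> where "\<eta> j = 2 powr (- eps * real j)"
definition arc_interval where "arc_interval j k = {real k / real (M j)..real (Suc k) / real (M j)}"
definition K where "K j i q = {k. k < M j \<and> (\<exists>t\<in>arc_interval j k.
   \<eta> j < ln (cmod (poly (rowA (2 ^ i) (\<lambda>n. \<alpha> (q * 2 ^ i + n))) (of_real (1 - 16 / real (M j)) * cis (2 * pi * t)))))}"
text \<open>For fixed i the range of q lists exactly the dyadic intervals of length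
  \<open>2 ^ i\<close> inside \<open>[2 ^ j, 2 ^ (j + 1))\<close>.\<close>

definition bad where "bad j = (\<Union>i\<in>{..j}. \<Union>q\<in>{2 ^ (j - i)..<2 ^ (j + 1 - i)}. K j i q)"

lemma eps: "0 < eps" "eps < 1/4"
  using s \<gamma> by (auto simp: eps_def)

lemma M_bounds: "2 powr (real j * (1 + eps)) \<le> real (M j)" "real (M j) \<le> 2 * 2 powr (real j * (1 + eps))"
proof -
  let ?x = "2 powr (real j * (1 + eps)) :: real"
  have "?x \<ge> 1" using eps by (intro ge_one_powr_ge_zero) auto
  moreover have "real (M j) = of_int \<lceil>?x\<rceil>" using \<open>?x \<ge> 1\<close> by (simp add: M_def)
  moreover have "?x \<le> of_int \<lceil>?x\<rceil>" "of_int \<lceil>?x\<rceil> < ?x + 1" by linarith+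
  ultimately show "?x \<le> real (M j)" "real (M j) \<le> 2 * ?x" by linarith+
qed

lemma M_ge: "2 ^ j \<le> M j"
proof -
  have "2 powr (real j) \<le> 2 powr (real j * (1 + eps))"
    using eps by (intro powr_mono) (auto simp: algebra_simps)
  then have "(2::real) ^ j \<le> real (M j)" using M_bounds(1)[of j] powr_realpow[of 2 j] by linarith
  then show ?thesis by (metis of_nat_le_iff of_nat_numeral of_nat_power)
qed

lemma M_gt_16: "M j > 16" if "j \<ge> 5"
proof -
  have "(2::nat) ^ 5 \<le> 2 ^ j" using that by (intro power_increasing) auto
  then show ?thesis using M_ge[of j] by simp
qed

lemma M_pos: "M j > 0"
  using M_ge[of j] by (metis gr0I le_zero_eq power_not_zero zero_neq_numeral)

text \<open>At each level i the intervals indexed by q partition the block, so the mean values of ln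
  |A| add up to at most the sum over the whole block, whatever i is. Summing over the levels yields
  only the factor j + 1.\<close>

lemma card_bad:
  assumes "\<forall>k\<ge>2 ^ j. (cmod (\<alpha> k))\<^sup>2 \<le> 1/2" "j \<ge> 5"
  shows "real (card (bad j)) \<le> 3 * C * (real j + 1) * M j * 2 powr ((eps - \<gamma>) * real j)"
proof -
  have one: "real (card (K j i q)) \<le> 3 * M j / \<eta> j * (\<Sum>k<2 ^ i. (cmod (\<alpha> (q * 2 ^ i + k)))\<^sup>2)"
    if "i \<le> j" "q \<in> {2 ^ (j - i)..<2 ^ (j + 1 - i)}" for i q
  proof -
    define \<beta> where "\<beta> = (\<lambda>n. \<alpha> (q * 2 ^ i + n))"
    have b: "cmod (\<beta> n) < 1" for n using \<alpha> by (simp add: \<beta>_def)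
    have "(2::nat) ^ j = 2 ^ (j - i) * 2 ^ i" using that by (simp flip: power_add)
    also have "\<dots> \<le> q * 2 ^ i" using that by (intro mult_right_mono) auto
    finally have "(cmod (\<beta> k))\<^sup>2 \<le> 1/2" for k using assms(1) by (simp add: \<beta>_def)
    then have "ln (cmod (poly (rowA (2 ^ i) \<beta>) 0)) \<le> (\<Sum>k<2 ^ i. (cmod (\<beta> k))\<^sup>2)"
      by (intro ln_rowA_at_0 b)
    moreover have "real (card (K j i q)) * \<eta> j \<le> 3 * real (M j) * ln (cmod (poly (rowA (2 ^ i) \<beta>) 0))"
      unfolding K_def arc_interval_def \<beta>_def[symmetric]
      by (rule card_large_log_arcs) (use b cmod_rowA_ge_1 M_gt_16[OF assms(2)] in \<open>auto simp: \<eta>_def\<close>)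
    ultimately have "real (card (K j i q)) * \<eta> j \<le> 3 * real (M j) * (\<Sum>k<2 ^ i. (cmod (\<beta> k))\<^sup>2)"
      by (smt (verit) mult_left_mono of_nat_0_le_iff mult_nonneg_nonneg)
    then show ?thesis unfolding \<beta>_def by (simp add: \<eta>_def field_simps)
  qed
  have "card (bad j) \<le> (\<Sum>i\<le>j. \<Sum>q\<in>{2 ^ (j - i)..<2 ^ (j + 1 - i)}. card (K j i q))"
    unfolding bad_def by (intro order_trans[OF card_UN_le] sum_mono order_trans[OF card_UN_le]) auto
  then have "real (card (bad j)) \<le> (\<Sum>i\<le>j. \<Sum>q\<in>{2 ^ (j - i)..<2 ^ (j + 1 - i)}. real (card (K j i q)))"
    by (simp flip: of_nat_sum)
  also have "\<dots> \<le> (\<Sum>i\<le>j. 3 * M j / \<eta> j * (C * 2 powr (- \<gamma> * real j)))"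
  proof (rule sum_mono)
    fix i assume i: "i \<in> {..j}"
    have pw: "(2::nat) ^ (j - i) * 2 ^ i = 2 ^ j" "(2::nat) ^ (j + 1 - i) * 2 ^ i = 2 ^ (j + 1)"
      using i by (simp_all flip: power_add)
    have "(\<Sum>q\<in>{2 ^ (j - i)..<2 ^ (j + 1 - i)}. real (card (K j i q)))
       \<le> (\<Sum>q\<in>{2 ^ (j - i)..<2 ^ (j + 1 - i)}. 3 * M j / \<eta> j * (\<Sum>k<2 ^ i. (cmod (\<alpha> (q * 2 ^ i + k)))\<^sup>2))"
      using one i by (intro sum_mono) auto
    also have "\<dots> = 3 * M j / \<eta> j * (\<Sum>q\<in>{2 ^ (j - i)..<2 ^ (j + 1 - i)}. \<Sum>k<2 ^ i. (cmod (\<alpha> (q * 2 ^ i + k)))\<^sup>2)"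
      by (rule sum_distrib_left[symmetric])
    also have "(\<Sum>q\<in>{2 ^ (j - i)..<2 ^ (j + 1 - i)}. \<Sum>k<2 ^ i. (cmod (\<alpha> (q * 2 ^ i + k)))\<^sup>2)
       = (\<Sum>k\<in>{2 ^ j..<2 ^ (j + 1)}. (cmod (\<alpha> k))\<^sup>2)"
      using i by (subst sum_blocks[of _ _ "\<lambda>k. (cmod (\<alpha> k))\<^sup>2"]) (auto simp only: pw intro!: power_increasing)
    also have "3 * M j / \<eta> j * \<dots> \<le> 3 * M j / \<eta> j * (C * 2 powr (- \<gamma> * real j))"
      by (intro mult_left_mono block_sum_le) (auto simp: \<eta>_def)
    finally show "(\<Sum>q\<in>{2 ^ (j - i)..<2 ^ (j + 1 - i)}. real (card (K j i q))) \<le> \<dots>" .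
  qed
  also have "\<dots> = 3 * C * (real j + 1) * M j * (2 powr (- \<gamma> * real j) / \<eta> j)" by simp
  also have "2 powr (- \<gamma> * real j) / \<eta> j = 2 powr ((eps - \<gamma>) * real j)"
    by (simp add: \<eta>_def algebra_simps flip: powr_diff)
  finally show ?thesis .
qed

text \<open>The 17 is 16 + 1: a multiple 16 of \<open>\<eta> j\<close> from the radial comparison
  and one \<open>\<eta> j\<close> from being outside \<open>bad j\<close>.\<close>

lemma row_norm_good:
  assumes t: "t \<in> arc_interval j k" "k < M j" "k \<notin> bad j" and j: "j \<ge> 5" "17 * \<eta> j \<le> 1/2"
    and i: "i \<le> j" "2 ^ j \<le> q * 2 ^ i" "(q + 1) * 2 ^ i \<le> 2 ^ (j + 1)"
  shows "row_norm (2 ^ i) (\<lambda>n. \<alpha> (q * 2 ^ i + n)) (cis (2 * pi * t)) \<le> exp (4 * sqrt (17 * \<eta> j))"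
proof -
  define \<beta> where "\<beta> = (\<lambda>n. \<alpha> (q * 2 ^ i + n))"
  have b: "cmod (\<beta> n) < 1" for n using \<alpha> by (simp add: \<beta>_def)
  have pw: "(2::nat) ^ j = 2 ^ (j - i) * 2 ^ i" "(2::nat) ^ (j + 1) = 2 ^ (j + 1 - i) * 2 ^ i"
    using i by (simp_all flip: power_add)
  have "2 ^ (j - i) \<le> q" "q + 1 \<le> 2 ^ (j + 1 - i)"
    using i(2,3) unfolding pw by (simp_all only: mult_le_cancel2) auto
  then have "q \<in> {2 ^ (j - i)..<2 ^ (j + 1 - i)}" by auto
  then have "k \<notin> K j i q" using t i by (auto simp: bad_def)
  then have h: "ln (cmod (poly (rowA (2 ^ i) \<beta>) (of_real (1 - 16 / real (M j)) * cis (2 * pi * t)))) \<le> \<eta> j"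
    using t by (auto simp: K_def \<beta>_def not_less)
  have "ln (cmod (poly (rowA (2 ^ i) \<beta>) (cis (2 * pi * t)))) \<le> 16 * real (2 ^ i) / M j + \<eta> j"
    using ln_rowA_radial[of \<beta> "cis (2 * pi * t)" "M j" "2 ^ i"] h b M_gt_16[OF j(1)] by simp
  \<comment> \<open>Here the exponent 1 + eps in \<open>M\<close> is spent: 2^j is
    \<open>\<eta> j\<close> times 2 powr (j (1 + eps)).\<close>
  moreover have "real (2 ^ i) / M j \<le> \<eta> j"
  proof -
    have "real (2 ^ i) = 2 powr real i" by (simp add: powr_realpow)
    also have "\<dots> \<le> 2 powr real j" using i by (intro powr_mono) auto
    also have "\<dots> = \<eta> j * 2 powr (real j * (1 + eps))"
      by (simp add: \<eta>_def algebra_simps flip: powr_add)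
    also have "\<dots> \<le> \<eta> j * M j" using M_bounds by (intro mult_left_mono) (auto simp: \<eta>_def)
    finally show ?thesis using M_pos[of j] by (simp add: field_simps)
  qed
  ultimately have "ln (cmod (poly (rowA (2 ^ i) \<beta>) (cis (2 * pi * t)))) \<le> 17 * \<eta> j" by simp
  then show ?thesis using j b unfolding \<beta>_def[symmetric] by (intro row_norm_le_exp) auto
qed

lemma good_bounded:
  assumes t: "0 \<le> t" "t < 1"
    and good: "\<And>j k. j \<ge> j1 \<Longrightarrow> t \<in> arc_interval j k \<Longrightarrow> k < M j \<Longrightarrow> k \<notin> bad j"
  shows "\<exists>B. \<forall>n. row_norm n \<alpha> (cis (2 * pi * t)) \<le> B"
proof -
  let ?z = "cis (2 * pi * t)"
  define \<nu> where "\<nu> m l = row_norm l (\<lambda>n. \<alpha> (m + n)) ?z" for m l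
  \<comment> \<open>Logarithm of the bound for a block prefix: up to j + 1 dyadic pieces, each
    bounded by \<open>row_norm_good\<close>.\<close>
  define c where "c j = (real j + 1) * (4 * sqrt (17 * \<eta> j))" for j
  have sub: "\<nu> m (l + l') \<le> \<nu> m l * \<nu> (m + l) l'" for m l l'
    unfolding \<nu>_def using row_norm_add[of "\<lambda>n. \<alpha> (m + n)" ?z l l'] \<alpha> by (simp add: add.assoc)
  have zero: "\<nu> m 0 = 1" for m by (simp add: \<nu>_def row_norm_def)
  have nonneg: "0 \<le> \<nu> m l" for m l by (simp add: \<nu>_def row_norm_def)
  \<comment> \<open>Chosen so that \<open>x ^ j\<close> is the square root of
    \<open>\<eta> j\<close>; then c is a multiple of a differentiated geometric series.\<close>
  define x :: real where "x = 2 powr (- eps / 2)"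
  have x: "0 < x" "x < 1" using eps powr_less_mono[of "- eps / 2" 0 2] by (auto simp: x_def)
  have sq: "sqrt (17 * \<eta> j) = sqrt 17 * x ^ j" for j
  proof -
    have "\<eta> j = (x ^ j)\<^sup>2"
      using x by (simp add: x_def \<eta>_def powr_powr powr_power mult_ac flip: power_mult)
    then show ?thesis using x by (simp add: real_sqrt_mult)
  qed
  have cs: "summable c"
  proof -
    have "summable (\<lambda>j. real (Suc j) * x ^ j)"
      using geometric_deriv_sums[of x] x by (simp add: sums_iff)
    then have "summable (\<lambda>j. 4 * sqrt 17 * (real (Suc j) * x ^ j))" by (rule summable_mult)
    moreover have "c = (\<lambda>j. 4 * sqrt 17 * (real (Suc j) * x ^ j))"
      unfolding c_def[abs_def] sq by (rule ext) simp
    ultimately show ?thesis by simp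
  qed
  have c0: "0 \<le> c j" for j by (simp add: c_def \<eta>_def)
  have "\<eta> \<longlonglongrightarrow> 0"
  proof -
    have "(\<lambda>j. (x\<^sup>2) ^ j) \<longlonglongrightarrow> 0" using x by (intro LIMSEQ_realpow_zero) (auto simp: power_less_one_iff)
    moreover have "\<eta> = (\<lambda>j. (x\<^sup>2) ^ j)"
      using x by (intro ext) (simp add: x_def \<eta>_def powr_powr powr_power mult_ac flip: power_mult)
    ultimately show ?thesis by simp
  qed
  then have "\<forall>\<^sub>F j in sequentially. \<eta> j < 1 / 34" by (rule order_tendstoD) simp
  then obtain j2 where j2: "\<And>j. j \<ge> j2 \<Longrightarrow> \<eta> j < 1 / 34" unfolding eventually_sequentially by blast
  define j0 where "j0 = max j1 (max 5 j2)"
  have blk: "\<nu> (2 ^ j) l \<le> exp (c j)" if j: "j \<ge> j0" and l: "l \<le> 2 ^ j" for j l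
  proof -
    define k where "k = nat \<lfloor>t * M j\<rfloor>"
    have k0: "real k = of_int \<lfloor>t * M j\<rfloor>" using t by (simp add: k_def)
    have k: "real k \<le> t * M j" "t * M j < real k + 1" unfolding k0 by linarith+
    have "t * M j < M j" using t M_pos[of j] by simp
    then have kM: "k < M j" using k by linarith
    have ta: "t \<in> arc_interval j k" using k M_pos[of j] by (auto simp: arc_interval_def field_simps)
    have kb: "k \<notin> bad j" using good[OF _ ta kM] j by (simp add: j0_def)
    have eta: "17 * \<eta> j \<le> 1/2" using j2[of j] j by (simp add: j0_def)
    have j5: "j \<ge> 5" using j by (simp add: j0_def)
    have "\<nu> (2 ^ j) l \<le> exp (4 * sqrt (17 * \<eta> j)) ^ (j + 1)"
    proof (rule dyadic_submultiplicative_bound[OF sub zero nonneg _ _ l])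
      show "1 \<le> exp (4 * sqrt (17 * \<eta> j))" by (simp add: \<eta>_def)
      show "\<nu> (q * 2 ^ i) (2 ^ i) \<le> exp (4 * sqrt (17 * \<eta> j))"
        if "i \<le> j" "2 ^ j \<le> q * 2 ^ i" "(q + 1) * 2 ^ i \<le> 2 ^ (j + 1)" for i q
        unfolding \<nu>_def by (rule row_norm_good[OF ta kM kb j5 eta that])
    qed
    also have "\<dots> = exp (c j)" unfolding c_def exp_of_nat_mult[symmetric] by (simp add: add.commute)
    finally show ?thesis .
  qed
  obtain B where "\<forall>n. \<nu> 0 n \<le> B" using submultiplicative_bounded[OF sub nonneg cs c0 blk] by blast
  then show ?thesis unfolding \<nu>_def by auto
qed

lemma hausdorff_measure_unbounded:
  "hausdorff_measure s {z \<in> unit_circle. \<not> (\<exists>B. \<forall>n. row_norm n \<alpha> z \<le> B)} = 0" (is "hausdorff_measure s ?S = 0")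
proof -
  obtain k0 where k0: "\<forall>k\<ge>k0. (cmod (\<alpha> k))\<^sup>2 \<le> 1/2" using eventually_small by blast
  define J where "J = max k0 5"
  have J: "\<forall>k\<ge>2 ^ (j + J). (cmod (\<alpha> k))\<^sup>2 \<le> 1/2" for j
  proof (intro allI impI)
    fix k :: nat assume "2 ^ (j + J) \<le> k"
    moreover have "j + J < 2 ^ (j + J)" by (rule less_exp)
    moreover have "k0 \<le> j + J" by (simp add: J_def)
    ultimately have "k \<ge> k0" by linarith
    then show "(cmod (\<alpha> k))\<^sup>2 \<le> 1/2" using k0 by blast
  qed
  define U where "U j k = (\<lambda>t. cis (2 * pi * t)) ` arc_interval (j + J) k" for j k
  \<comment> \<open>An arc has length 2 pi / M, and 8 exceeds 2 pi.\<close>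
  define d where "d j = 8 / real (M (j + J))" for j
  have dist: "dist (cis (2 * pi * a)) (cis (2 * pi * b)) \<le> d j" if "a \<in> arc_interval (j + J) k" "b \<in> arc_interval (j + J) k" for a b j k
  proof -
    have "real (Suc k) / M (j + J) = real k / M (j + J) + 1 / M (j + J)" by (simp add: add_divide_distrib)
    then have "\<bar>a - b\<bar> \<le> 1 / M (j + J)" using that by (auto simp: arc_interval_def)
    then have "2 * pi * \<bar>a - b\<bar> \<le> 8 * (1 / M (j + J))" using pi_less_4 by (intro mult_mono) auto
    moreover have "2 * pi * \<bar>a - b\<bar> = \<bar>2 * pi * a - 2 * pi * b\<bar>" by (simp add: abs_mult flip: right_diff_distrib)
    ultimately show ?thesis using norm_cis_diff_le[of "2 * pi * a" "2 * pi * b"] by (simp add: dist_norm d_def)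
  qed
  define y :: real where "y = 2 powr (- 2 * eps)"
  have y: "0 < y" "y < 1" using eps powr_less_mono[of "- 2 * eps" 0 2] by (auto simp: y_def)
  show ?thesis
  proof (rule hausdorff_measure_zero_limsup[where U = U and F = "\<lambda>j. bad (j + J)" and d = d])
    show "s > 0" using s \<gamma> by simp
    show "finite (bad (j + J))" for j by (auto simp: bad_def K_def)
    show "bounded (U j k)" for j k
      unfolding U_def by (rule bounded_subset[of "cball 0 1"]) auto
    show "diameter (U j k) \<le> d j" for j k
    proof (rule diameter_le)
      show "U j k \<noteq> {} \<or> 0 \<le> d j" by (simp add: d_def)
    qed (use dist[of _ j k] in \<open>auto simp: U_def dist_norm\<close>)
    have d_le: "d j \<le> 8 * (1/2) ^ j" for j
    proof -
      have "2 ^ j \<le> (2::nat) ^ (j + J)" by (intro power_increasing) auto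
      then have "2 ^ j \<le> M (j + J)" using M_ge[of "j + J"] by linarith
      then have "(2::real) ^ j \<le> real (M (j + J))" by (metis of_nat_le_iff of_nat_numeral of_nat_power)
      then have "8 / real (M (j + J)) \<le> 8 / 2 ^ j" using M_pos[of "j + J"] by (intro divide_left_mono) auto
      then show ?thesis by (simp add: d_def power_one_over)
    qed
    have "(\<lambda>j. 8 * (1/2) ^ j) \<longlonglongrightarrow> (0::real)"
      by (rule tendsto_mult_right_zero) (rule LIMSEQ_realpow_zero; simp)
    then show "d \<longlonglongrightarrow> 0"
      by (rule Lim_null_comparison[rotated]) (use d_le in \<open>auto simp: d_def intro!: always_eventually\<close>)
    show "summable (\<lambda>j. real (card (bad (j + J))) * d j powr s)"
    proof (rule summable_comparison_test'[OF summable_ignore_initial_segment[of _ J]])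
      have "summable (\<lambda>j. real (Suc j) * y ^ j)"
        using geometric_deriv_sums[of y] y by (simp add: sums_iff)
      then show "summable (\<lambda>j. 48 * C * (real (Suc j) * y ^ j))" by (rule summable_mult)
      show "norm (real (card (bad (j + J))) * d j powr s) \<le> 48 * C * (real (Suc (j + J)) * y ^ (j + J))"
        if "j \<ge> 0" for j
      proof -
        define i where "i = j + J"
        define X where "X = 2 powr (real i * (1 + eps))"
        have X1: "X \<ge> 1" using eps unfolding X_def by (intro ge_one_powr_ge_zero) auto
        have s01: "0 < s" "s < 1" using s \<gamma> by auto
        have m: "0 < real (M i)" "real (M i) \<le> 2 * X" using M_pos[of i] M_bounds[of i] by (auto simp: X_def)
        have "real (M i) * d j powr s = 8 powr s * real (M i) powr (1 - s)"
          using m by (simp add: d_def powr_divide powr_diff flip: i_def)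
        also have "\<dots> \<le> 8 * (2 * X powr (1 - s))"
        proof (rule mult_mono)
          show "8 powr s \<le> (8::real)" using powr_mono[of s 1 8] s01 by simp
          have "real (M i) powr (1 - s) \<le> (2 * X) powr (1 - s)"
            using m s01 by (intro powr_mono2) auto
          also have "\<dots> = 2 powr (1 - s) * X powr (1 - s)" using X1 by (simp add: powr_mult)
          also have "\<dots> \<le> 2 * X powr (1 - s)"
            using powr_mono[of "1 - s" 1 2] s01 by (intro mult_right_mono) auto
          finally show "real (M i) powr (1 - s) \<le> 2 * X powr (1 - s)" .
        qed auto
        finally have Md: "real (M i) * d j powr s \<le> 16 * X powr (1 - s)" by simp
        \<comment> \<open>By the choice of eps, 1 - \<gamma> - s = - 4 eps. Threshold and mesh
          refinement together spend at most 2 eps of this, and what remains gives the geometric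
          factor \<open>y ^ i\<close>.\<close>
        have "(eps - \<gamma>) * real i + real i * (1 + eps) * (1 - s) = real i * (- 2 * eps - eps * s)"
          by (simp add: eps_def field_simps)
        also have "\<dots> \<le> real i * (- 2 * eps)" using eps s01 by (intro mult_left_mono) auto
        finally have "2 powr ((eps - \<gamma>) * real i + real i * (1 + eps) * (1 - s)) \<le> (2::real) powr (real i * (- 2 * eps))"
          by (intro powr_mono) auto
        moreover have "\<dots> = y ^ i" by (simp add: y_def powr_power mult.commute)
        moreover have "2 powr ((eps - \<gamma>) * real i + real i * (1 + eps) * (1 - s)) = 2 powr ((eps - \<gamma>) * real i) * X powr (1 - s)"
          by (simp add: X_def powr_add powr_powr)
        ultimately have yi: "2 powr ((eps - \<gamma>) * real i) * X powr (1 - s) \<le> y ^ i" by simp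
        have "real (card (bad i)) * d j powr s \<le> (3 * C * (real i + 1) * M i * 2 powr ((eps - \<gamma>) * real i)) * d j powr s"
          using J[of j] by (intro mult_right_mono card_bad) (auto simp: i_def J_def)
        also have "\<dots> = 3 * C * (real i + 1) * 2 powr ((eps - \<gamma>) * real i) * (real (M i) * d j powr s)" by simp
        also have "\<dots> \<le> 3 * C * (real i + 1) * 2 powr ((eps - \<gamma>) * real i) * (16 * X powr (1 - s))"
          using C_nonneg by (intro mult_left_mono Md) auto
        also have "\<dots> = 48 * C * (real i + 1) * (2 powr ((eps - \<gamma>) * real i) * X powr (1 - s))" by simp
        also have "\<dots> \<le> 48 * C * (real i + 1) * y ^ i" using C_nonneg by (intro mult_left_mono yi) auto
        finally show ?thesis using C_nonneg unfolding i_def by (simp add: add.commute)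
      qed
    qed
    show "?S \<subseteq> (\<Union>j\<in>{j1..}. \<Union>k\<in>bad (j + J). U j k)" for j1
    proof (rule subsetI, rule ccontr)
      fix z assume z: "z \<in> ?S" and n: "z \<notin> (\<Union>j\<in>{j1..}. \<Union>k\<in>bad (j + J). U j k)"
      from z obtain \<theta> where th: "0 \<le> \<theta>" "\<theta> < 2 * pi" "z = cis \<theta>"
        using complex_unimodular_polar[of z] by (auto simp: complex_eq_iff)
      define t where "t = \<theta> / (2 * pi)"
      have t: "0 \<le> t" "t < 1" "z = cis (2 * pi * t)" using th by (auto simp: t_def)
      have "\<exists>B. \<forall>n. row_norm n \<alpha> (cis (2 * pi * t)) \<le> B"
      proof (rule good_bounded[OF t(1,2), of "j1 + J"])
        fix j k assume j: "j1 + J \<le> j" and "t \<in> arc_interval j k"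
        then have "z \<in> U (j - J) k" by (auto simp: U_def t)
        moreover have "j - J \<ge> j1" "j - J + J = j" using j by auto
        ultimately show "k \<notin> bad j" using n by force
      qed
      then show False using z t by auto
    qed
  qed
qed

end

theorem (in decaying_coefficients) hausdorff_dim_unbounded:
  "hausdorff_dim {z \<in> unit_circle. \<not> (\<exists>B. \<forall>n. row_norm n \<alpha> z \<le> B)} \<le> ennreal (1 - \<gamma>)"
proof (rule hausdorff_dim_leI[of "1 - \<gamma>" 1])
  show "hausdorff_measure s {z \<in> unit_circle. \<not> (\<exists>B. \<forall>n. row_norm n \<alpha> z \<le> B)} = 0"
    if "1 - \<gamma> < s" "s < 1" for s
  proof -
    have "decaying_coefficients_dim \<alpha> \<gamma> s"
      by (intro decaying_coefficients_dim.intro decaying_coefficients_axioms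
          decaying_coefficients_dim_axioms.intro that)
    then show ?thesis by (rule decaying_coefficients_dim.hausdorff_measure_unbounded)
  qed
  show "0 \<le> 1 - \<gamma>" "1 - \<gamma> < 1" using \<gamma> by simp_all
qed

section \<open>Szego recursion\<close>

lemma poly_szego_dual_circle:
  assumes "cmod z = 1"
  shows "poly (szego_dual P) z = z ^ degree P * cnj (poly P z)"
proof -
  have "z * cnj z = 1" using assms by (simp add: complex_norm_square[symmetric])
  moreover from this have nz: "z \<noteq> 0" by auto
  ultimately have "1 / cnj z = z" by (subst nonzero_divide_eq_eq) auto
  then show ?thesis by (simp add: poly_szego_dual[OF nz])
qed

lemma cmod_szego_dual_circle: "cmod z = 1 \<Longrightarrow> cmod (poly (szego_dual P) z) = cmod (poly P z)"
  by (simp add: poly_szego_dual_circle norm_mult norm_power)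

lemma szego_dual_smult: "szego_dual (smult c P) = smult (cnj c) (szego_dual P)"
  by (cases "c = 0") (auto intro!: poly_eqI simp: coeff_szego_dual)

lemma infinite_unit_circle: "infinite unit_circle"
proof
  assume "finite unit_circle"
  then have "connected unit_circle \<Longrightarrow> unit_circle = {} \<or> (\<exists>x. unit_circle = {x})"
    using connected_finite_iff_sing by blast
  moreover have "connected unit_circle" by (rule connected_sphere) simp
  moreover have "1 \<in> unit_circle" "- 1 \<in> unit_circle" by auto
  ultimately show False by (metis empty_iff one_neq_neg_one singletonD)
qed

lemma poly_eqI_circle:
  fixes P Q :: "complex poly"
  assumes "\<And>z. cmod z = 1 \<Longrightarrow> poly P z = poly Q z"
  shows "P = Q"
proof (rule ccontr)
  assume "P \<noteq> Q"
  then have "finite {z. poly (P - Q) z = 0}" by (intro poly_roots_finite) simp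
  moreover have "unit_circle \<subseteq> {z. poly (P - Q) z = 0}" using assms by auto
  ultimately show False using infinite_unit_circle finite_subset by blast
qed

text \<open>On the circle the dual is z^n times the conjugate, which reduces the claim to algebra
  with |z| = 1. Both degrees must be supplied because they are the indices of the duals.\<close>

lemma szego_dual_recursion:
  assumes d: "degree p = n" "degree p' = Suc n"
    and p': "p' = smult (1 / complex_of_real r) (pCons 0 p - smult (cnj a) (szego_dual p))"
  shows "szego_dual p' = smult (1 / complex_of_real r) (szego_dual p - smult a (pCons 0 p))"
proof (rule poly_eqI_circle)
  fix z :: complex assume z: "cmod z = 1"
  have zz: "z * cnj z = 1" using z by (simp add: complex_norm_square[symmetric])
  have zn: "z ^ n * cnj (z ^ n) = 1" using z by (simp add: complex_norm_square[symmetric] norm_power flip: complex_cnj_power)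
  define w where "w = poly p z"
  define u where "u = z ^ n"
  have u: "u * cnj u = 1" using zn by (simp add: u_def)
  have "poly (szego_dual p') z = z * u * cnj ((z * w - cnj a * (u * cnj w)) / r)"
    using z d by (simp add: poly_szego_dual_circle p'[THEN arg_cong[of _ _ "\<lambda>P. poly P z"]] u_def w_def)
  also have "\<dots> = ((z * cnj z) * u * cnj w - a * z * w * (u * cnj u)) / r"
    by (simp add: field_simps)
  also have "\<dots> = (u * cnj w - a * z * w) / r" unfolding zz u by simp
  also have "\<dots> = poly (smult (1 / complex_of_real r) (szego_dual p - smult a (pCons 0 p))) z"
    using z d by (simp add: poly_szego_dual_circle u_def w_def)
  finally show "poly (szego_dual p') z = \<dots>" .
qed

section \<open>Orthogonal polynomials of a measure on the circle\<close>

locale circle_measure = prob_space \<mu> for \<mu> :: "complex measure" +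
  assumes sets_mu: "sets \<mu> = sets circle_borel" and nontrivial_mu: "nontrivial \<mu>"
begin

lemma space_mu [simp]: "space \<mu> = unit_circle"
  using sets_eq_imp_space_eq[OF sets_mu] by (simp add: space_restrict_space)

lemma integrable_continuous:
  fixes f :: "complex \<Rightarrow> 'b::{banach,second_countable_topology}"
  assumes "continuous_on unit_circle f"
  shows "integrable \<mu> f"
proof -
  have "bounded (f ` unit_circle)"
    using assms by (intro compact_imp_bounded compact_continuous_image) auto
  then obtain B where B: "\<And>z. z \<in> unit_circle \<Longrightarrow> norm (f z) \<le> B"
    unfolding bounded_iff by blast
  have "f \<in> borel_measurable circle_borel" by (rule borel_measurable_continuous_on_restrict[OF assms])
  then have "f \<in> borel_measurable \<mu>" using measurable_cong_sets[OF sets_mu refl] by blast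
  then show ?thesis using B by (intro integrable_const_bound[of _ B]) auto
qed

abbreviation inner_mu where "inner_mu \<equiv> poly_inner \<mu>"
abbreviation \<Phi> where "\<Phi> \<equiv> monic_op \<mu>"

lemma integrable_poly_inner: "integrable \<mu> (\<lambda>z. cnj (poly P z) * poly Q z)"
  by (intro integrable_continuous continuous_intros)

lemma inner_right:
  "inner_mu P (Q + R) = inner_mu P Q + inner_mu P R"
  "inner_mu P (Q - R) = inner_mu P Q - inner_mu P R"
  "inner_mu P (smult c Q) = c * inner_mu P Q"
  "inner_mu P 0 = 0"
  by (simp_all add: poly_inner_def distrib_left right_diff_distrib integrable_poly_inner mult.left_commute)

lemma inner_sum_right: "inner_mu P (\<Sum>k\<in>A. f k) = (\<Sum>k\<in>A. inner_mu P (f k))"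
  by (induction A rule: infinite_finite_induct) (auto simp: inner_right)

lemma inner_commute: "inner_mu Q P = cnj (inner_mu P Q)"
proof -
  have "(\<lambda>z. cnj (poly Q z) * poly P z) = (\<lambda>z. cnj (cnj (poly P z) * poly Q z))"
    by (simp add: mult.commute)
  then show ?thesis unfolding poly_inner_def by (simp only: Bochner_Integration.integral_cnj)
qed

lemma inner_left:
  "inner_mu (Q + R) P = inner_mu Q P + inner_mu R P"
  "inner_mu (Q - R) P = inner_mu Q P - inner_mu R P"
  "inner_mu (smult c Q) P = cnj c * inner_mu Q P"
  "inner_mu 0 P = 0"
  by (simp_all add: inner_commute[of _ P] inner_right)

lemma inner_sum_left: "inner_mu (\<Sum>k\<in>A. f k) P = (\<Sum>k\<in>A. inner_mu (f k) P)"
  by (simp add: inner_commute[of _ P] inner_sum_right)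

lemma inner_cong_circle:
  assumes "\<And>z. cmod z = 1 \<Longrightarrow> cnj (poly P z) * poly Q z = cnj (poly P' z) * poly Q' z"
  shows "inner_mu P Q = inner_mu P' Q'"
  unfolding poly_inner_def by (rule Bochner_Integration.integral_cong) (auto simp: assms)

lemma inner_pCons: "inner_mu (pCons 0 P) (pCons 0 Q) = inner_mu P Q"
proof (rule inner_cong_circle)
  fix z :: complex assume "cmod z = 1"
  then have "cnj z * z = 1" by (simp add: mult.commute complex_norm_square[symmetric])
  then have "(cnj z * z) * (cnj (poly P z) * poly Q z) = cnj (poly P z) * poly Q z" by simp
  then show "cnj (poly (pCons 0 P) z) * poly (pCons 0 Q) z = cnj (poly P z) * poly Q z"
    by (simp add: mult_ac)
qed

lemma inner_self: "inner_mu P P = complex_of_real ((poly_norm \<mu> P)\<^sup>2)"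
proof -
  have "0 \<le> (\<integral>z. (cmod (poly P z))\<^sup>2 \<partial>\<mu>)" by simp
  then have "(poly_norm \<mu> P)\<^sup>2 = (\<integral>z. (cmod (poly P z))\<^sup>2 \<partial>\<mu>)" by (simp add: poly_norm_def)
  moreover have "inner_mu P P = (\<integral>z. complex_of_real ((cmod (poly P z))\<^sup>2) \<partial>\<mu>)"
    unfolding poly_inner_def complex_norm_square by (simp add: mult.commute)
  ultimately show ?thesis by (simp only: integral_complex_of_real)
qed

text \<open>Non-triviality enters here: a vanishing norm would concentrate \<open>\<mu>\<close> on
  the finitely many zeros of \<open>P\<close>.\<close>

lemma poly_norm_pos:
  assumes "P \<noteq> 0"
  shows "0 < poly_norm \<mu> P"
proof -
  have "(\<integral>z. (cmod (poly P z))\<^sup>2 \<partial>\<mu>) \<noteq> 0"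
  proof
    assume "(\<integral>z. (cmod (poly P z))\<^sup>2 \<partial>\<mu>) = 0"
    moreover have int: "integrable \<mu> (\<lambda>z. (cmod (poly P z))\<^sup>2)"
      by (intro integrable_continuous continuous_intros)
    ultimately have "AE z in \<mu>. (cmod (poly P z))\<^sup>2 = 0"
      by (subst (asm) integral_nonneg_eq_0_iff_AE) auto
    then have ae: "AE z in \<mu>. poly P z = 0" by simp
    define F where "F = {z. poly P z = 0}"
    have F: "finite F" unfolding F_def using assms by (rule poly_roots_finite)
    have "F \<in> sets borel" using F by (intro borel_closed finite_imp_closed)
    then have "unit_circle - F \<in> sets \<mu>"
      unfolding sets_mu by (subst sets_restrict_space_iff) auto
    then have "unit_circle - F \<in> null_sets \<mu>"
      using ae by (subst AE_iff_null_sets) (auto simp: F_def)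
    then have "supported_by \<mu> F" by (simp add: supported_by_def)
    then show False using nontrivial_mu F by (auto simp: nontrivial_def)
  qed
  moreover have "0 \<le> (\<integral>z. (cmod (poly P z))\<^sup>2 \<partial>\<mu>)" by simp
  ultimately have "0 < (\<integral>z. (cmod (poly P z))\<^sup>2 \<partial>\<mu>)" by linarith
  then show ?thesis by (simp add: poly_norm_def)
qed

lemma inner_self_eq_0_iff: "inner_mu P P = 0 \<longleftrightarrow> P = 0"
  using poly_norm_pos[of P] by (cases "P = 0") (auto simp: inner_self poly_norm_def)

lemma monic_op_coeff: "coeff (\<Phi> n) n = 1" "n < k \<Longrightarrow> coeff (\<Phi> n) k = 0"
proof -
  have "coeff (\<Phi> n) n = 1 \<and> (\<forall>k>n. coeff (\<Phi> n) k = 0)"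
  proof (induction n rule: less_induct)
    case (less n)
    then show ?case by (subst (1 2) monic_op.simps) (simp add: coeff_sum)
  qed
  then show "coeff (\<Phi> n) n = 1" "n < k \<Longrightarrow> coeff (\<Phi> n) k = 0" by auto
qed

lemma degree_monic_op: "degree (\<Phi> n) = n"
  by (intro antisym degree_le le_degree) (auto simp: monic_op_coeff)

lemma monic_op_nonzero: "\<Phi> n \<noteq> 0"
  using monic_op_coeff(1)[of n] by auto

lemma monic_op_0: "\<Phi> 0 = 1"
  by (subst monic_op.simps) simp

lemma monic_op_orthogonal: "k < n \<Longrightarrow> inner_mu (\<Phi> k) (\<Phi> n) = 0"
proof (induction n arbitrary: k rule: less_induct)
  case (less n)
  have o: "inner_mu (\<Phi> k) (\<Phi> j) = 0" if "j < n" "j \<noteq> k" for j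
  proof (cases "j < k")
    case True
    then show ?thesis using less.IH[of k j] less.prems by (subst inner_commute) simp
  next
    case False
    then show ?thesis using less.IH[of j k] that by simp
  qed
  let ?c = "\<lambda>j. poly_inner \<mu> (\<Phi> j) (monom 1 n) / poly_inner \<mu> (\<Phi> j) (\<Phi> j)"
  have "inner_mu (\<Phi> k) (\<Phi> n) = inner_mu (\<Phi> k) (monom 1 n) - (\<Sum>j<n. ?c j * inner_mu (\<Phi> k) (\<Phi> j))"
    by (subst (2) monic_op.simps) (simp add: inner_right inner_sum_right)
  also have "(\<Sum>j<n. ?c j * inner_mu (\<Phi> k) (\<Phi> j)) = (\<Sum>j<n. if j = k then inner_mu (\<Phi> k) (monom 1 n) else 0)"
    by (rule sum.cong) (auto simp: o inner_self_eq_0_iff monic_op_nonzero)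
  also have "\<dots> = inner_mu (\<Phi> k) (monom 1 n)" using less.prems by simp
  finally show ?case by simp
qed

lemma monic_op_orthogonal_lower:
  assumes "\<And>k. k \<ge> n \<Longrightarrow> coeff P k = 0"
  shows "inner_mu P (\<Phi> n) = 0"
proof -
  have "m \<le> n \<Longrightarrow> (\<And>k. k \<ge> m \<Longrightarrow> coeff P k = 0) \<Longrightarrow> inner_mu P (\<Phi> n) = 0" for m P
  proof (induction m arbitrary: P)
    case 0
    then have "P = 0" by (intro poly_eqI) auto
    then show ?case by (simp add: inner_left)
  next
    case (Suc m)
    define Q where "Q = P - smult (coeff P m) (\<Phi> m)"
    have "coeff Q k = 0" if "k \<ge> m" for k
      using that Suc.prems(2)[of k] monic_op_coeff[of m] by (cases "k = m") (auto simp: Q_def)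
    then have "inner_mu Q (\<Phi> n) = 0" using Suc.prems by (intro Suc.IH) auto
    moreover have "inner_mu (\<Phi> m) (\<Phi> n) = 0" using Suc.prems by (intro monic_op_orthogonal) auto
    ultimately show ?case by (simp add: Q_def inner_left)
  qed
  from this[of n P] assms show ?thesis by auto
qed

text \<open>Pairing z^(k+1) with the dual of \<open>\<Phi> n\<close> is the same as pairing
  \<open>\<Phi> n\<close> with z^(n-k-1), a power below n. Hence the dual is orthogonal to z, ...,
  z^n.\<close>

lemma dual_orthogonal:
  assumes "\<And>k. k \<ge> n \<Longrightarrow> coeff E k = 0"
  shows "inner_mu (pCons 0 E) (szego_dual (\<Phi> n)) = 0"
proof -
  have mon: "inner_mu (monom 1 (Suc k)) (szego_dual (\<Phi> n)) = 0" if "k < n" for k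
  proof -
    have "inner_mu (monom 1 (Suc k)) (szego_dual (\<Phi> n)) = inner_mu (\<Phi> n) (monom 1 (n - Suc k))"
    proof (rule inner_cong_circle)
      fix z :: complex assume z: "cmod z = 1"
      have "z ^ n = z ^ (Suc k) * z ^ (n - Suc k)" using that by (simp flip: power_add power_Suc)
      moreover have "cnj (z ^ Suc k) * z ^ Suc k = 1"
        using z by (simp add: mult.commute complex_norm_square[symmetric] norm_power norm_mult flip: complex_cnj_power complex_cnj_mult)
      ultimately have "cnj (z ^ Suc k) * z ^ n = z ^ (n - Suc k)"
        by (metis mult.assoc mult_1)
      then show "cnj (poly (monom 1 (Suc k)) z) * poly (szego_dual (\<Phi> n)) z = cnj (poly (\<Phi> n) z) * poly (monom 1 (n - Suc k)) z"
        unfolding poly_szego_dual_circle[OF z] degree_monic_op poly_monom by (simp del: power_Suc)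
    qed
    also have "\<dots> = 0"
      using that by (subst inner_commute) (simp add: monic_op_orthogonal_lower)
    finally show ?thesis .
  qed
  have "pCons 0 E = (\<Sum>k<n. smult (coeff E k) (monom 1 (Suc k)))"
  proof (rule poly_eqI)
    fix j
    show "coeff (pCons 0 E) j = coeff (\<Sum>k<n. smult (coeff E k) (monom 1 (Suc k))) j"
      using assms by (cases j) (auto simp: coeff_sum if_distrib[of "\<lambda>x. _ * x"] cong: if_cong)
  qed
  then show ?thesis using mon by (simp add: inner_sum_left inner_left)
qed

lemma szego_dual_norm: "inner_mu (szego_dual P) (szego_dual P) = inner_mu P P"
  by (rule inner_cong_circle) (simp add: cmod_szego_dual_circle mult.commute[of "cnj _"] flip: complex_norm_square)

text \<open>The defect D of the recursion has degree at most n, since the leading terms cancel, and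
  vanishes at 0. It is therefore orthogonal to each of its own three summands, so D = 0. The norm
  identity is Pythagoras for the resulting orthogonal splitting of z \<Phi> n, and positivity of the
  norms gives |a| < 1.\<close>

lemma szego_recursion_exists:
  "\<exists>a. cmod a < 1 \<and> \<Phi> (Suc n) = pCons 0 (\<Phi> n) - smult (cnj a) (szego_dual (\<Phi> n))
     \<and> (poly_norm \<mu> (\<Phi> (Suc n)))\<^sup>2 = (1 - (cmod a)\<^sup>2) * (poly_norm \<mu> (\<Phi> n))\<^sup>2"
proof -
  \<comment> \<open>Forced by evaluating the recursion at 0, where the dual of a monic polynomial is
    1.\<close>
  define a where "a = - cnj (poly (\<Phi> (Suc n)) 0)"
  define D where "D = \<Phi> (Suc n) - pCons 0 (\<Phi> n) + smult (cnj a) (szego_dual (\<Phi> n))"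
  have dual: "coeff (szego_dual (\<Phi> n)) 0 = 1" "k > n \<Longrightarrow> coeff (szego_dual (\<Phi> n)) k = 0" for k
    by (simp_all add: coeff_szego_dual degree_monic_op monic_op_coeff)
  have "coeff D 0 = 0" by (simp add: D_def dual a_def poly_0_coeff_0)
  then obtain E where E: "D = pCons 0 E" by (metis coeff_pCons_0 pCons_cases)
  have Ek: "coeff E k = 0" if "k \<ge> n" for k
  proof -
    have "coeff E k = coeff D (Suc k)" by (simp add: E)
    also have "\<dots> = 0" using that by (cases "k = n") (auto simp: D_def dual monic_op_coeff)
    finally show ?thesis .
  qed
  have "inner_mu D (\<Phi> (Suc n)) = 0"
    unfolding E by (rule monic_op_orthogonal_lower) (auto simp: coeff_pCons Ek split: nat.split)
  moreover have "inner_mu D (pCons 0 (\<Phi> n)) = 0"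
    unfolding E inner_pCons by (rule monic_op_orthogonal_lower) (rule Ek)
  moreover have "inner_mu D (szego_dual (\<Phi> n)) = 0"
    unfolding E by (rule dual_orthogonal) (rule Ek)
  ultimately have "inner_mu D D = 0" by (subst (2) D_def) (simp add: inner_right)
  then have "D = 0" by (simp add: inner_self_eq_0_iff)
  then have rec: "\<Phi> (Suc n) = pCons 0 (\<Phi> n) - smult (cnj a) (szego_dual (\<Phi> n))"
    by (simp add: D_def algebra_simps eq_diff_eq)
  have o: "inner_mu (szego_dual (\<Phi> n)) (\<Phi> (Suc n)) = 0"
    by (rule monic_op_orthogonal_lower) (simp add: dual)
  then have o': "inner_mu (\<Phi> (Suc n)) (szego_dual (\<Phi> n)) = 0" by (subst inner_commute) simp
  have "inner_mu (\<Phi> n) (\<Phi> n) = inner_mu (pCons 0 (\<Phi> n)) (pCons 0 (\<Phi> n))" by (rule inner_pCons[symmetric])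
  also have "pCons 0 (\<Phi> n) = \<Phi> (Suc n) + smult (cnj a) (szego_dual (\<Phi> n))" by (simp add: rec)
  also have "inner_mu \<dots> \<dots> = inner_mu (\<Phi> (Suc n)) (\<Phi> (Suc n)) + (a * cnj a) * inner_mu (\<Phi> n) (\<Phi> n)"
    by (simp add: inner_left inner_right o o' szego_dual_norm)
  finally have "complex_of_real ((poly_norm \<mu> (\<Phi> n))\<^sup>2)
     = complex_of_real ((poly_norm \<mu> (\<Phi> (Suc n)))\<^sup>2 + (cmod a)\<^sup>2 * (poly_norm \<mu> (\<Phi> n))\<^sup>2)"
    unfolding inner_self complex_norm_square[symmetric] by simp
  then have nn: "(poly_norm \<mu> (\<Phi> n))\<^sup>2 = (poly_norm \<mu> (\<Phi> (Suc n)))\<^sup>2 + (cmod a)\<^sup>2 * (poly_norm \<mu> (\<Phi> n))\<^sup>2"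
    unfolding of_real_eq_iff .
  have p: "0 < (poly_norm \<mu> (\<Phi> m))\<^sup>2" for m using poly_norm_pos[OF monic_op_nonzero[of m]] by simp
  have "(1 - (cmod a)\<^sup>2) * (poly_norm \<mu> (\<Phi> n))\<^sup>2 > 0" using nn p[of "Suc n"] unfolding left_diff_distrib by linarith
  then have "(cmod a)\<^sup>2 < 1" using p[of n] by (simp add: zero_less_mult_iff)
  then have "cmod a < 1" by (simp add: abs_square_less_1)
  then show ?thesis using rec nn by (intro exI[of _ a]) (auto simp: algebra_simps)
qed

lemma is_verblunsky: "is_verblunsky \<mu> (verblunsky \<mu>)"
proof -
  have ex: "\<exists>\<alpha>. is_verblunsky \<mu> \<alpha>"
    using szego_recursion_exists unfolding is_verblunsky_def by (simp add: choice_iff[symmetric]) metis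
  have uniq: "\<alpha> = \<beta>" if "is_verblunsky \<mu> \<alpha>" "is_verblunsky \<mu> \<beta>" for \<alpha> \<beta>
  proof
    fix n
    have "poly (szego_dual (\<Phi> n)) 0 = 1"
      by (simp add: poly_0_coeff_0 coeff_szego_dual degree_monic_op monic_op_coeff)
    moreover have "poly (\<Phi> (Suc n)) 0 = - cnj (x n) * poly (szego_dual (\<Phi> n)) 0" if "is_verblunsky \<mu> x" for x
      using that unfolding is_verblunsky_def by simp
    ultimately show "\<alpha> n = \<beta> n" using that by simp (metis complex_cnj_cancel_iff neg_equal_iff_equal)
  qed
  show ?thesis unfolding verblunsky_def using ex uniq by (metis theI)
qed

definition \<alpha> where "\<alpha> = verblunsky \<mu>"

lemma \<alpha>_less_1: "cmod (\<alpha> n) < 1"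
  using is_verblunsky by (simp add: is_verblunsky_def \<alpha>_def)

lemma monic_op_Suc: "\<Phi> (Suc n) = pCons 0 (\<Phi> n) - smult (cnj (\<alpha> n)) (szego_dual (\<Phi> n))"
  using is_verblunsky by (simp add: is_verblunsky_def \<alpha>_def)

lemma poly_norm_monic_op_Suc: "poly_norm \<mu> (\<Phi> (Suc n)) = rho \<alpha> n * poly_norm \<mu> (\<Phi> n)"
proof -
  obtain a where a: "\<Phi> (Suc n) = pCons 0 (\<Phi> n) - smult (cnj a) (szego_dual (\<Phi> n))"
     "(poly_norm \<mu> (\<Phi> (Suc n)))\<^sup>2 = (1 - (cmod a)\<^sup>2) * (poly_norm \<mu> (\<Phi> n))\<^sup>2"
    using szego_recursion_exists[of n] by blast
  have "poly (szego_dual (\<Phi> n)) 0 = 1"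
    by (simp add: poly_0_coeff_0 coeff_szego_dual degree_monic_op monic_op_coeff)
  then have "cnj a = cnj (\<alpha> n)"
    using arg_cong[OF a(1), of "\<lambda>P. poly P 0"] arg_cong[OF monic_op_Suc[of n], of "\<lambda>P. poly P 0"] by simp
  then have "a = \<alpha> n" by simp
  then have "(poly_norm \<mu> (\<Phi> (Suc n)))\<^sup>2 = (rho \<alpha> n * poly_norm \<mu> (\<Phi> n))\<^sup>2"
    using a(2) by (simp add: power_mult_distrib rho_sq \<alpha>_less_1)
  moreover have "0 \<le> rho \<alpha> n" using rho_pos[of \<alpha> n] \<alpha>_less_1 by (simp add: less_imp_le)
  ultimately show ?thesis
    using poly_norm_pos[OF monic_op_nonzero[of n]] poly_norm_pos[OF monic_op_nonzero[of "Suc n"]]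
    by (simp add: power2_eq_iff_nonneg)
qed

abbreviation \<phi> where "\<phi> \<equiv> orthonormal_op \<mu>"
abbreviation \<psi> where "\<psi> \<equiv> second_kind \<alpha>"

lemma degree_orthonormal: "degree (\<phi> n) = n"
  using poly_norm_pos[OF monic_op_nonzero[of n]] by (simp add: orthonormal_op_def degree_monic_op)

lemma orthonormal_0: "\<phi> 0 = 1"
  using prob_space by (simp add: orthonormal_op_def monic_op_0 poly_norm_def)

lemma orthonormal_Suc:
  "\<phi> (Suc n) = smult (1 / complex_of_real (rho \<alpha> n)) (pCons 0 (\<phi> n) - smult (cnj (\<alpha> n)) (szego_dual (\<phi> n)))"
  unfolding orthonormal_op_def poly_norm_monic_op_Suc szego_dual_smult
  unfolding monic_op_Suc by (simp add: smult_diff_right mult_ac)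

lemma dual_orthonormal_Suc:
  "szego_dual (\<phi> (Suc n)) = smult (1 / complex_of_real (rho \<alpha> n)) (szego_dual (\<phi> n) - smult (\<alpha> n) (pCons 0 (\<phi> n)))"
  by (rule szego_dual_recursion[OF degree_orthonormal degree_orthonormal orthonormal_Suc])

text \<open>In this form the second kind polynomials obey the same recursion with - \<alpha> in
  place of \<alpha>, so \<open>szego_dual_recursion\<close> applies to them too.\<close>

lemma second_kind_Suc:
  "\<psi> (Suc n) = smult (1 / complex_of_real (rho \<alpha> n)) (pCons 0 (\<psi> n) - smult (cnj (- \<alpha> n)) (szego_dual (\<psi> n)))"
  by simp

lemma dual_second_kind_Suc:
  "szego_dual (\<psi> (Suc n)) = smult (1 / complex_of_real (rho \<alpha> n)) (szego_dual (\<psi> n) - smult (- \<alpha> n) (pCons 0 (\<psi> n)))"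
  by (rule szego_dual_recursion[OF degree_second_kind degree_second_kind second_kind_Suc]) (rule \<alpha>_less_1)+

end

section \<open>Szego matrices expressed by rows\<close>

lemma (in circle_measure) degree_second_kind_verblunsky: "degree (\<psi> n) = n"
  by (rule degree_second_kind) (rule \<alpha>_less_1)

text \<open>The transfer matrix maps the vector (1, 1) to \<open>\<phi>\<close> and its dual, and
  (1, -1) to \<open>\<psi>\<close> and minus its dual; the lower components are B + A and B - A. The
  induction uses \<open>row_add\<close> with l' = 1 because a new step comes last, whereas
  \<open>szego_row\<close> grows at the first index.\<close>

lemma (in circle_measure) dual_eq_row:
  assumes z: "cmod z = 1"
  shows "poly (szego_dual (\<phi> n)) z = poly (rowA n \<alpha>) z + poly (rowB n \<alpha>) z"
    and "poly (szego_dual (\<psi> n)) z = poly (rowA n \<alpha>) z - poly (rowB n \<alpha>) z"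
proof -
  have zz: "z ^ n * cnj (z ^ n) = 1" for n
    using z by (simp add: complex_norm_square[symmetric] norm_power flip: complex_cnj_power)
  have rev: "poly P z = z ^ n * cnj (poly (szego_dual P) z)" if "degree P = n" for P n
    using zz[of n] by (simp add: poly_szego_dual_circle[OF z] that mult.assoc[symmetric])
  have row1: "poly (rowA 1 \<beta>) z = 1 / rho \<beta> 0" "poly (rowB 1 \<beta>) z = - \<beta> 0 * z / rho \<beta> 0" for \<beta>
    using row_Suc[of 0 \<beta>] by simp_all
  have rs: "rho (\<lambda>k. \<alpha> (n + k)) 0 = rho \<alpha> n" for n by (simp add: rho_def)
  have "poly (szego_dual (\<phi> n)) z = poly (rowA n \<alpha>) z + poly (rowB n \<alpha>) z
      \<and> poly (szego_dual (\<psi> n)) z = poly (rowA n \<alpha>) z - poly (rowB n \<alpha>) z"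
  proof (induction n)
    case 0
    then show ?case by (simp add: orthonormal_0 szego_dual_def)
  next
    case (Suc n)
    define A B where "A = poly (rowA n \<alpha>) z" and "B = poly (rowB n \<alpha>) z"
    have d: "poly (szego_dual (\<phi> n)) z = A + B" "poly (szego_dual (\<psi> n)) z = A - B"
      using Suc by (simp_all add: A_def B_def)
    have p: "poly (\<phi> n) z = z ^ n * cnj (A + B)" "poly (\<psi> n) z = z ^ n * cnj (A - B)"
      using rev[OF degree_orthonormal, of n] rev[OF degree_second_kind_verblunsky, of n] by (simp_all only: d)
    have 1: "poly (szego_dual (\<phi> (Suc n))) z = (A + B - \<alpha> n * (z * (z ^ n * cnj (A + B)))) / rho \<alpha> n"
      unfolding dual_orthonormal_Suc by (simp add: d p)
    have 2: "poly (szego_dual (\<psi> (Suc n))) z = (A - B + \<alpha> n * (z * (z ^ n * cnj (A - B)))) / rho \<alpha> n"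
      unfolding dual_second_kind_Suc by (simp add: d p)
    have 3: "poly (rowB (Suc n) \<alpha>) z = (B - z ^ n * cnj A * (\<alpha> n * z)) / rho \<alpha> n"
      "poly (rowA (Suc n) \<alpha>) z = (A - z ^ n * cnj B * (\<alpha> n * z)) / rho \<alpha> n"
      using row_add[of \<alpha> z n 1, OF \<alpha>_less_1 z] unfolding row1 rs A_def[symmetric] B_def[symmetric]
      by (simp_all add: diff_divide_distrib)
    show ?case
      unfolding 1 2 3 add_divide_distrib[symmetric] diff_divide_distrib[symmetric] by (simp add: algebra_simps)
  qed
  then show "poly (szego_dual (\<phi> n)) z = poly (rowA n \<alpha>) z + poly (rowB n \<alpha>) z"
    and "poly (szego_dual (\<psi> n)) z = poly (rowA n \<alpha>) z - poly (rowB n \<alpha>) z" by auto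
qed

lemma (in circle_measure) cmod_le_row_norm:
  assumes z: "cmod z = 1"
  shows "cmod (poly (szego_dual (\<phi> n)) z) \<le> row_norm n \<alpha> z" "cmod (poly (szego_dual (\<psi> n)) z) \<le> row_norm n \<alpha> z"
    "cmod (poly (\<phi> n) z) \<le> row_norm n \<alpha> z" "cmod (poly (\<psi> n) z) \<le> row_norm n \<alpha> z"
proof -
  show 1: "cmod (poly (szego_dual (\<phi> n)) z) \<le> row_norm n \<alpha> z" "cmod (poly (szego_dual (\<psi> n)) z) \<le> row_norm n \<alpha> z"
    unfolding dual_eq_row[OF z] row_norm_def by (rule norm_triangle_ineq, rule norm_triangle_ineq4)
  show "cmod (poly (\<phi> n) z) \<le> row_norm n \<alpha> z" "cmod (poly (\<psi> n) z) \<le> row_norm n \<alpha> z"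
    using 1 by (simp_all only: cmod_szego_dual_circle[OF z])
qed

lemma (in circle_measure) onorm_szego_matrix_le:
  assumes z: "cmod z = 1"
  shows "onorm (\<lambda>v. szego_matrix \<mu> n z *v v) \<le> 4 * row_norm n \<alpha> z"
proof (rule onorm_bound)
  let ?M = "szego_matrix \<mu> n z" and ?R = "row_norm n \<alpha> z"
  show "0 \<le> 4 * ?R" by (simp add: row_norm_def)
  have half: "cmod ((x + y) / 2) \<le> ?R" "cmod ((x - y) / 2) \<le> ?R" if "cmod x \<le> ?R" "cmod y \<le> ?R" for x y
    using that norm_triangle_ineq[of x y] norm_triangle_ineq4[of x y] by (auto simp: norm_divide)
  have M: "cmod (?M $ i $ j) \<le> ?R" for i j
  proof -
    have "i = 1 \<or> i = 2" "j = 1 \<or> j = 2" by (rule exhaust_2)+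
    then show ?thesis
      unfolding szego_matrix_def \<alpha>_def[symmetric] Let_def
      by (elim disjE) (simp_all only: vector_2, (rule half cmod_le_row_norm z)+)
  qed
  fix v :: "complex ^ 2"
  have "norm (?M *v v) \<le> (\<Sum>i\<in>UNIV. cmod ((?M *v v) $ i))"
    unfolding norm_vec_def by (rule L2_set_le_sum) simp
  also have "\<dots> \<le> (\<Sum>i::2\<in>UNIV. \<Sum>j::2\<in>UNIV. ?R * norm v)"
  proof (rule sum_mono)
    fix i :: 2
    have "cmod ((?M *v v) $ i) \<le> (\<Sum>j\<in>UNIV. cmod (?M $ i $ j * v $ j))"
      unfolding matrix_vector_mult_def by (simp del: norm_mult add: norm_sum)
    also have "\<dots> \<le> (\<Sum>j::2\<in>UNIV. ?R * norm v)"
      unfolding norm_mult using M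
      by (intro sum_mono mult_mono Finite_Cartesian_Product.norm_nth_le) (auto simp: row_norm_def)
    finally show "cmod ((?M *v v) $ i) \<le> (\<Sum>j::2\<in>UNIV. ?R * norm v)" .
  qed
  also have "\<dots> = 4 * ?R * norm v" by simp
  finally show "norm (?M *v v) \<le> 4 * ?R * norm v" .
qed

section \<open>Weyl solution and growth of the measure\<close>

locale weyl_solution = circle_measure +
  fixes z :: complex
  assumes z_in_disc: "cmod z < 1"
begin

text \<open>\<open>F\<close> is the Caratheodory function of \<open>\<mu>\<close>. The extra \<open>2\<close> in \<open>a 0\<close> makes \<open>(a, b)\<close> a solution of the
  Szego recursion also at the first step.\<close>

definition G where "G e = 2 * z / (e - z)"
definition F where "F = 1 + (\<integral>e. G e \<partial>\<mu>)"
definition a where "a n = (\<integral>e. G e * poly (\<phi> n) e \<partial>\<mu>) + (if n = 0 then 2 else 0)"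
definition b where "b n = (\<integral>e. G e * poly (szego_dual (\<phi> n)) e \<partial>\<mu>)"

lemma cont_G: "continuous_on unit_circle G"
  unfolding G_def using z_in_disc by (intro continuous_intros) auto

lemma integrable_G: "integrable \<mu> (\<lambda>e. G e * poly P e)"
  by (intro integrable_continuous continuous_intros cont_G)

lemma integrable_poly: "integrable \<mu> (poly P :: complex \<Rightarrow> complex)"
  by (intro integrable_continuous continuous_intros)

lemma weyl_0: "a 0 = F + 1" "b 0 = F - 1"
  by (simp_all add: a_def b_def F_def orthonormal_0 szego_dual_def)

lemma integral_orthonormal: "(\<integral>e. poly (\<phi> n) e \<partial>\<mu>) = (if n = 0 then 1 else 0)"
proof (cases n)
  case 0
  then show ?thesis using prob_space by (simp add: orthonormal_0)
next
  case (Suc m)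
  have "inner_mu 1 (\<Phi> n) = 0" using Suc by (intro monic_op_orthogonal_lower) auto
  then have "inner_mu 1 (\<phi> n) = 0" by (simp add: orthonormal_op_def inner_right)
  then show ?thesis using Suc by (simp add: poly_inner_def)
qed

text \<open>Since e G(e) = z G(e) + 2 z, the shift produces 2 z times the integral of
  \<open>\<phi> n\<close>, which is nonzero only for n = 0 and is absorbed by the 2 in
  \<open>a 0\<close>.\<close>

lemma integral_G_shift: "(\<integral>e. G e * poly (pCons 0 (\<phi> n)) e \<partial>\<mu>) = z * a n"
proof -
  have "(\<integral>e. G e * poly (pCons 0 (\<phi> n)) e \<partial>\<mu>) = (\<integral>e. z * (G e * poly (\<phi> n) e) + 2 * z * poly (\<phi> n) e \<partial>\<mu>)"
  proof (rule Bochner_Integration.integral_cong[OF refl])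
    fix e assume "e \<in> space \<mu>"
    then have "e \<noteq> z" using z_in_disc by auto
    then have "G e * e = z * G e + 2 * z" by (simp add: G_def field_simps)
    then have "G e * e * poly (\<phi> n) e = (z * G e + 2 * z) * poly (\<phi> n) e" by simp
    then show "G e * poly (pCons 0 (\<phi> n)) e = z * (G e * poly (\<phi> n) e) + 2 * z * poly (\<phi> n) e"
      by (simp add: algebra_simps)
  qed
  also have "\<dots> = z * (\<integral>e. G e * poly (\<phi> n) e \<partial>\<mu>) + 2 * z * (\<integral>e. poly (\<phi> n) e \<partial>\<mu>)"
    by (subst Bochner_Integration.integral_add) (auto intro!: integrable_G integrable_poly)
  finally show ?thesis by (simp add: a_def integral_orthonormal algebra_simps)
qed

lemma weyl_Suc:
  "a (Suc n) = (z * a n - cnj (\<alpha> n) * b n) / rho \<alpha> n"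
  "b (Suc n) = (b n - \<alpha> n * (z * a n)) / rho \<alpha> n"
proof -
  have lin: "(\<integral>e. G e * poly (smult c (P - smult d Q)) e \<partial>\<mu>)
    = c * ((\<integral>e. G e * poly P e \<partial>\<mu>) - d * (\<integral>e. G e * poly Q e \<partial>\<mu>))" for c d P Q
  proof -
    have "(\<integral>e. G e * poly (smult c (P - smult d Q)) e \<partial>\<mu>) = (\<integral>e. c * (G e * poly P e - d * (G e * poly Q e)) \<partial>\<mu>)"
      by (intro Bochner_Integration.integral_cong) (auto simp: algebra_simps)
    also have "\<dots> = c * ((\<integral>e. G e * poly P e \<partial>\<mu>) - d * (\<integral>e. G e * poly Q e \<partial>\<mu>))"
      by (simp add: integrable_G)
    finally show ?thesis .
  qed
  show "a (Suc n) = (z * a n - cnj (\<alpha> n) * b n) / rho \<alpha> n"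
    unfolding a_def[of "Suc n"] orthonormal_Suc lin integral_G_shift b_def[symmetric] by simp
  show "b (Suc n) = (b n - \<alpha> n * (z * a n)) / rho \<alpha> n"
    unfolding b_def[of "Suc n"] dual_orthonormal_Suc lin integral_G_shift b_def[symmetric] by simp
qed

text \<open>In powers of x = z cnj e, G is the series 2 x / (1 - x). Its first n terms are
  conjugates of multiples of e, ..., e^n, to which the dual is orthogonal; only the tail x^n G
  survives, and it makes \<open>b n\<close> decay.\<close>

lemma integral_dual_geometric:
  "(\<integral>e. G e * poly (szego_dual (\<phi> n)) e \<partial>\<mu>) = (\<integral>e. (z * cnj e) ^ n * G e * poly (szego_dual (\<phi> n)) e \<partial>\<mu>)"
proof -
  define E where "E = (\<Sum>k<n. monom (2 * cnj z ^ Suc k) k)"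
  have E: "coeff E k = 0" if "k \<ge> n" for k using that by (simp add: E_def coeff_sum)
  have "inner_mu (pCons 0 E) (szego_dual (\<Phi> n)) = 0" by (rule dual_orthogonal) (rule E)
  then have "inner_mu (pCons 0 E) (szego_dual (\<phi> n)) = 0"
    by (simp add: orthonormal_op_def szego_dual_smult inner_right)
  then have 0: "(\<integral>e. cnj (poly (pCons 0 E) e) * poly (szego_dual (\<phi> n)) e \<partial>\<mu>) = 0"
    by (simp add: poly_inner_def)
  have "(\<integral>e. G e * poly (szego_dual (\<phi> n)) e \<partial>\<mu>)
    = (\<integral>e. cnj (poly (pCons 0 E) e) * poly (szego_dual (\<phi> n)) e + (z * cnj e) ^ n * G e * poly (szego_dual (\<phi> n)) e \<partial>\<mu>)"
  proof (rule Bochner_Integration.integral_cong[OF refl])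
    fix e assume "e \<in> space \<mu>"
    then have e: "cmod e = 1" by simp
    then have ee: "e * cnj e = 1" by (simp add: complex_norm_square[symmetric])
    have e0: "e \<noteq> 0" "e \<noteq> z" using e z_in_disc by auto
    define x where "x = z * cnj e"
    have "cmod x < 1" using z_in_disc e by (simp add: x_def norm_mult)
    then have x1: "x \<noteq> 1" by auto
    have "(e - z) * cnj e = 1 - x" using ee by (simp add: x_def algebra_simps)
    then have Gx: "G e = 2 * x / (1 - x)"
      using e0 e by (simp add: G_def x_def frac_eq_eq) (metis e0(1) complex_cnj_zero_iff mult.assoc mult.commute mult_divide_mult_cancel_right)
    have "cnj (poly (pCons 0 E) e) = cnj e * (\<Sum>k<n. 2 * z ^ Suc k * cnj e ^ k)"
      by (simp add: E_def poly_sum poly_monom)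
    also have "\<dots> = 2 * x * (\<Sum>k<n. x ^ k)"
      by (simp add: x_def sum_distrib_left power_mult_distrib mult_ac)
    finally have "cnj (poly (pCons 0 E) e) * (1 - x) = 2 * x * (1 - x ^ n)"
      by (simp add: one_diff_power_eq mult_ac)
    then have "cnj (poly (pCons 0 E) e) = 2 * x * (1 - x ^ n) / (1 - x)" using x1 by (simp add: eq_divide_eq)
    then have "G e = cnj (poly (pCons 0 E) e) + x ^ n * G e"
      unfolding Gx by (simp add: add_divide_distrib[symmetric] algebra_simps)
    then show "G e * poly (szego_dual (\<phi> n)) e = cnj (poly (pCons 0 E) e) * poly (szego_dual (\<phi> n)) e + (z * cnj e) ^ n * G e * poly (szego_dual (\<phi> n)) e"
      unfolding x_def by (metis distrib_right)
  qed
  also have "\<dots> = (\<integral>e. cnj (poly (pCons 0 E) e) * poly (szego_dual (\<phi> n)) e \<partial>\<mu>) + (\<integral>e. (z * cnj e) ^ n * G e * poly (szego_dual (\<phi> n)) e \<partial>\<mu>)"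
    by (intro Bochner_Integration.integral_add integrable_poly_inner integrable_continuous continuous_intros cont_G)
  finally show ?thesis unfolding 0 by simp
qed

lemma cmod_b_le: "cmod (b n) \<le> cmod z ^ n * (2 / (1 - cmod z))"
proof -
  have n1: "(\<integral>e. (cmod (poly (\<phi> n) e))\<^sup>2 \<partial>\<mu>) = 1"
  proof -
    have p: "poly_norm \<mu> (\<Phi> n) > 0" by (intro poly_norm_pos monic_op_nonzero)
    have "inner_mu (\<phi> n) (\<phi> n) = 1"
      using p inner_self[of "\<Phi> n"]
      by (simp add: orthonormal_op_def inner_left inner_right power2_eq_square)
    then have "(poly_norm \<mu> (\<phi> n))\<^sup>2 = 1" unfolding inner_self by (metis of_real_eq_1_iff)
    then show ?thesis by (simp add: poly_norm_def)
  qed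
  have i1: "integrable \<mu> (\<lambda>e. cmod (poly (szego_dual (\<phi> n)) e))" and i2: "integrable \<mu> (\<lambda>e. (1 + (cmod (poly (\<phi> n) e))\<^sup>2) / 2)"
    and i3: "integrable \<mu> (\<lambda>e. (cmod (poly (\<phi> n) e))\<^sup>2)"
    by (intro integrable_continuous continuous_intros; simp)+
  have "(\<integral>e. cmod (poly (szego_dual (\<phi> n)) e) \<partial>\<mu>) \<le> (\<integral>e. (1 + (cmod (poly (\<phi> n) e))\<^sup>2) / 2 \<partial>\<mu>)"
  proof (rule integral_mono[OF i1 i2])
    fix e assume "e \<in> space \<mu>"
    then have "cmod (poly (szego_dual (\<phi> n)) e) = cmod (poly (\<phi> n) e)" by (simp add: cmod_szego_dual_circle)
    then show "cmod (poly (szego_dual (\<phi> n)) e) \<le> (1 + (cmod (poly (\<phi> n) e))\<^sup>2) / 2"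
      using sum_squares_bound[of 1 "cmod (poly (\<phi> n) e)"] by simp
  qed
  also have "\<dots> = 1" using i3 n1 prob_space by simp
  finally have L1: "(\<integral>e. cmod (poly (szego_dual (\<phi> n)) e) \<partial>\<mu>) \<le> 1" .
  let ?c = "cmod z ^ n * (2 / (1 - cmod z))"
  have "cmod (b n) = cmod (\<integral>e. (z * cnj e) ^ n * G e * poly (szego_dual (\<phi> n)) e \<partial>\<mu>)"
    unfolding b_def by (subst integral_dual_geometric) (rule refl)
  also have "\<dots> \<le> (\<integral>e. cmod ((z * cnj e) ^ n * G e * poly (szego_dual (\<phi> n)) e) \<partial>\<mu>)"
    by (rule integral_norm_bound)
  also have "\<dots> \<le> (\<integral>e. ?c * cmod (poly (szego_dual (\<phi> n)) e) \<partial>\<mu>)"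
  proof (rule integral_mono)
    show "integrable \<mu> (\<lambda>e. cmod ((z * cnj e) ^ n * G e * poly (szego_dual (\<phi> n)) e))"
      by (intro integrable_continuous continuous_intros cont_G)
    show "integrable \<mu> (\<lambda>e. ?c * cmod (poly (szego_dual (\<phi> n)) e))" using i1 by simp
    fix e assume "e \<in> space \<mu>"
    then have e: "cmod e = 1" by simp
    have "1 - cmod z \<le> cmod (e - z)" using norm_triangle_ineq2[of e z] e by simp
    then have "cmod (G e) \<le> 2 / (1 - cmod z)"
      unfolding G_def norm_divide using z_in_disc by (intro frac_le) (auto simp: norm_mult)
    then show "cmod ((z * cnj e) ^ n * G e * poly (szego_dual (\<phi> n)) e) \<le> ?c * cmod (poly (szego_dual (\<phi> n)) e)"
      by (simp only: norm_mult norm_power complex_mod_cnj e mult_1_right)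
         (intro mult_right_mono mult_left_mono; simp)
  qed
  also have "\<dots> = ?c * (\<integral>e. cmod (poly (szego_dual (\<phi> n)) e) \<partial>\<mu>)" by simp
  also have "\<dots> \<le> ?c * 1" using z_in_disc by (intro mult_left_mono L1) auto
  finally show ?thesis by simp
qed

text \<open>The step is an SU(1,1) rotation of the pair \<open>(z * a n, b n)\<close>; the last term
  makes up for replacing z a by a.\<close>

lemma weyl_form_Suc:
  "(cmod (b (Suc n)))\<^sup>2 - (cmod (a (Suc n)))\<^sup>2 = (cmod (b n))\<^sup>2 - (cmod (a n))\<^sup>2 + (1 - (cmod z)\<^sup>2) * (cmod (a n))\<^sup>2"
  using hyperbolic_rotation_norm[OF rho_sq rho_pos, of \<alpha> n "z * a n" "b n"] \<alpha>_less_1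
  unfolding weyl_Suc by (simp add: norm_mult power_mult_distrib algebra_simps)

lemma weyl_form_sum:
  "(cmod (b n))\<^sup>2 - (cmod (a n))\<^sup>2 = (cmod (b 0))\<^sup>2 - (cmod (a 0))\<^sup>2 + (1 - (cmod z)\<^sup>2) * (\<Sum>k<n. (cmod (a k))\<^sup>2)"
  by (induction n) (simp_all add: weyl_form_Suc algebra_simps)

text \<open>The form |b|^2 - |a|^2 increases with the index and is at most |b|^2, which tends to 0;
  hence it is never positive.\<close>

lemma cmod_b_le_a: "cmod (b n) \<le> cmod (a n)"
proof -
  let ?q = "\<lambda>n. (cmod (b n))\<^sup>2 - (cmod (a n))\<^sup>2"
  have z2: "(cmod z)\<^sup>2 \<le> 1" using z_in_disc by (simp add: power_le_one)
  have "incseq ?q" by (rule incseq_SucI) (use z2 in \<open>simp add: weyl_form_Suc\<close>)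
  then have up: "?q n \<le> (cmod z ^ m * (2 / (1 - cmod z)))\<^sup>2" if "m \<ge> n" for m
  proof -
    have "?q n \<le> ?q m" using \<open>incseq ?q\<close> that by (rule incseqD)
    also have "\<dots> \<le> (cmod (b m))\<^sup>2" by simp
    also have "\<dots> \<le> (cmod z ^ m * (2 / (1 - cmod z)))\<^sup>2" by (intro power_mono cmod_b_le) simp
    finally show ?thesis .
  qed
  have "(\<lambda>m. (cmod z ^ m * (2 / (1 - cmod z)))\<^sup>2) \<longlonglongrightarrow> (0 * (2 / (1 - cmod z)))\<^sup>2"
    using z_in_disc by (intro tendsto_intros LIMSEQ_realpow_zero) auto
  then have "?q n \<le> (0 * (2 / (1 - cmod z)))\<^sup>2"
    by (rule LIMSEQ_le_const) (use up in blast)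
  then have "(cmod (b n))\<^sup>2 \<le> (cmod (a n))\<^sup>2" by simp
  then show ?thesis by (rule power2_le_imp_le) simp
qed

text \<open>The increments of the form telescope to at most its initial deficit |F + 1|^2 - |F -
  1|^2 = 4 Re F.\<close>

lemma sum_a_le: "(1 - (cmod z)\<^sup>2) * (\<Sum>k<n. (cmod (a k))\<^sup>2) \<le> 4 * Re F"
proof -
  have "(cmod (b n))\<^sup>2 \<le> (cmod (a n))\<^sup>2" by (intro power_mono cmod_b_le_a) simp
  then have "(1 - (cmod z)\<^sup>2) * (\<Sum>k<n. (cmod (a k))\<^sup>2) \<le> (cmod (a 0))\<^sup>2 - (cmod (b 0))\<^sup>2"
    using weyl_form_sum[of n] by linarith
  also have "\<dots> = 4 * Re F" unfolding weyl_0 cmod_power2 by (simp add: power2_eq_square algebra_simps)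
  finally show ?thesis .
qed

lemma sum_cmod_a_le: "(1 - cmod z) * (\<Sum>k<n. cmod (a k))\<^sup>2 \<le> 4 * real n * cmod F"
proof -
  have z2: "1 - cmod z \<le> 1 - (cmod z)\<^sup>2"
    using z_in_disc by (simp add: power2_eq_square mult_left_le)
  have "(1 - cmod z) * (\<Sum>k<n. cmod (a k))\<^sup>2 \<le> (1 - cmod z) * ((\<Sum>k<n. (cmod (a k))\<^sup>2) * real n)"
    using z_in_disc sum_squared_le_sum_of_squares[of "\<lambda>k. cmod (a k)" "{..<n}"] by (intro mult_left_mono) auto
  also have "\<dots> \<le> (1 - (cmod z)\<^sup>2) * ((\<Sum>k<n. (cmod (a k))\<^sup>2) * real n)"
    using z2 by (intro mult_right_mono mult_nonneg_nonneg sum_nonneg) auto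
  also have "\<dots> = real n * ((1 - (cmod z)\<^sup>2) * (\<Sum>k<n. (cmod (a k))\<^sup>2))" by simp
  also have "\<dots> \<le> real n * (4 * cmod F)"
    using sum_a_le[of n] complex_Re_le_cmod[of F] by (intro mult_left_mono) auto
  finally show ?thesis by simp
qed

text \<open>\<open>1 + G e\<close> is the Herglotz kernel (e + z) / (e - z), and its real part is
  the Poisson kernel.\<close>

lemma Re_F: "Re F = (\<integral>e. (1 - (cmod z)\<^sup>2) / (cmod (e - z))\<^sup>2 \<partial>\<mu>)"
proof -
  have "F = (\<integral>e. 1 + G e \<partial>\<mu>)"
    unfolding F_def using prob_space by (subst Bochner_Integration.integral_add)
      (auto intro!: integrable_continuous cont_G)
  then have "Re F = (\<integral>e. Re (1 + G e) \<partial>\<mu>)"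
    by (simp only: Bochner_Integration.integral_Re[OF integrable_continuous[OF continuous_on_add[OF continuous_on_const cont_G]]])
  also have "\<dots> = (\<integral>e. (1 - (cmod z)\<^sup>2) / (cmod (e - z))\<^sup>2 \<partial>\<mu>)"
  proof (rule Bochner_Integration.integral_cong[OF refl])
    fix e assume "e \<in> space \<mu>"
    then have e: "cmod e = 1" by simp
    then have ez: "e - z \<noteq> 0" using z_in_disc by auto
    have "1 + G e = (e + z) / (e - z)" using ez by (simp add: G_def field_simps)
    also have "\<dots> = (e + z) * cnj (e - z) / complex_of_real ((cmod (e - z))\<^sup>2)"
      by (subst complex_div_cnj) simp
    finally have "Re (1 + G e) = Re ((e + z) * cnj (e - z)) / (cmod (e - z))\<^sup>2"
      by (simp only: Re_divide_of_real)
    also have "Re ((e + z) * cnj (e - z)) = (cmod e)\<^sup>2 - (cmod z)\<^sup>2"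
      unfolding cmod_power2 by (simp add: power2_eq_square algebra_simps)
    finally show "Re (1 + G e) = (1 - (cmod z)\<^sup>2) / (cmod (e - z))\<^sup>2" by (simp add: e)
  qed
  finally show ?thesis .
qed

end

text \<open>The second kind solution carries the opposite sign of \<beta>, so its rotation is the
  inverse adjoint of the Weyl one. The rotations cancel in the pairing, and only the ratio r of the
  two spectral parameters remains.\<close>

lemma wronskian_step:
  fixes a b p q w :: complex
  assumes s: "s\<^sup>2 = 1 - (cmod \<beta>)\<^sup>2" "s > 0" and w: "cmod w = 1"
  shows "cnj ((w * p + cnj \<beta> * q) / s) * ((r * w * a - cnj \<beta> * b) / s) + cnj ((q + \<beta> * (w * p)) / s) * ((b - \<beta> * (r * w * a)) / s)
    = r * cnj p * a + cnj q * b"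
proof -
  have ww: "cnj w * w = 1" using w by (simp add: mult.commute complex_norm_square[symmetric])
  have bb: "cnj \<beta> * \<beta> = complex_of_real ((cmod \<beta>)\<^sup>2)" by (simp add: mult.commute complex_norm_square[symmetric])
  have s2: "complex_of_real s * complex_of_real s = 1 - cnj \<beta> * \<beta>"
    unfolding bb using s(1) by (simp add: power2_eq_square flip: of_real_mult)
  have "cnj (w * p + cnj \<beta> * q) * (r * w * a - cnj \<beta> * b) + cnj (q + \<beta> * (w * p)) * (b - \<beta> * (r * w * a))
     = (cnj w * w) * r * cnj p * a * (1 - cnj \<beta> * \<beta>) + (1 - cnj \<beta> * \<beta>) * cnj q * b"
    by (simp add: algebra_simps)
  also have "\<dots> = (complex_of_real s * complex_of_real s) * (r * cnj p * a + cnj q * b)"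
    unfolding ww s2 by (simp add: algebra_simps)
  finally have e: "cnj (w * p + cnj \<beta> * q) * (r * w * a - cnj \<beta> * b) + cnj (q + \<beta> * (w * p)) * (b - \<beta> * (r * w * a))
     = (complex_of_real s * complex_of_real s) * (r * cnj p * a + cnj q * b)" .
  have gen: "cnj (x / complex_of_real s) * (y / complex_of_real s) + cnj (u / complex_of_real s) * (v / complex_of_real s)
    = (cnj x * y + cnj u * v) / (complex_of_real s * complex_of_real s)" for x y u v
    by (simp add: add_divide_distrib)
  show ?thesis unfolding gen e using s(2) by simp
qed

context circle_measure
begin

text \<open>No pointwise bound on \<open>a k\<close> is available, so the identity for 2 F is
  averaged over about 1 / (1 - r) indices. This bounds n |F| by a multiple of C S, while
  Cauchy-Schwarz bounds S^2 by a multiple of n^2 |F|. The result is quadratic in |F| on the left and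
  linear on the right, so one |F| cancels and the bound is free of r.\<close>

lemma cmod_caratheodory_le:
  assumes z0: "cmod z0 = 1" and C: "\<And>n. row_norm n \<alpha> z0 \<le> C" and r: "0 < r" "r < 1"
  shows "cmod (weyl_solution.F \<mu> (of_real r * z0)) \<le> 16 * C\<^sup>2"
proof -
  define z where "z = of_real r * z0"
  have cz: "cmod z = r" using z0 r by (simp add: z_def norm_mult)
  interpret weyl_solution \<mu> z
    by (intro weyl_solution.intro circle_measure_axioms weyl_solution_axioms.intro) (use cz r in simp)
  \<comment> \<open>This pairing would be constant if both solutions belonged to the same spectral parameter.\<close>
  define W where "W k = cnj (poly (\<psi> k) z0) * a k + cnj (poly (szego_dual (\<psi> k)) z0) * b k" for k
  have C0: "0 \<le> C" using C[of 0] by (auto simp: row_norm_def)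
  have ps: "cmod (poly (\<psi> k) z0) \<le> C" "cmod (poly (szego_dual (\<psi> k)) z0) \<le> C" for k
    using cmod_le_row_norm[OF z0, of k] C[of k] by linarith+
  have "W (Suc k) = W k - (1 - r) * cnj (poly (\<psi> k) z0) * a k" for k
  proof -
    have "W (Suc k) = r * cnj (poly (\<psi> k) z0) * a k + cnj (poly (szego_dual (\<psi> k)) z0) * b k"
    proof -
      have 1: "poly (\<psi> (Suc k)) z0 = (z0 * poly (\<psi> k) z0 + cnj (\<alpha> k) * poly (szego_dual (\<psi> k)) z0) / rho \<alpha> k"
        unfolding second_kind_Suc by simp
      have 2: "poly (szego_dual (\<psi> (Suc k))) z0 = (poly (szego_dual (\<psi> k)) z0 + \<alpha> k * (z0 * poly (\<psi> k) z0)) / rho \<alpha> k"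
        unfolding dual_second_kind_Suc by simp
      show ?thesis
        using wronskian_step[OF rho_sq[of \<alpha> k, OF \<alpha>_less_1] rho_pos[of \<alpha> k, OF \<alpha>_less_1] z0,
            of "poly (\<psi> k) z0" "poly (szego_dual (\<psi> k)) z0" r "a k" "b k"]
        unfolding W_def weyl_Suc 1 2 z_def[symmetric] .
    qed
    then show ?thesis by (simp add: W_def algebra_simps)
  qed
  then have "W k = W 0 - (\<Sum>j<k. (1 - r) * cnj (poly (\<psi> j) z0) * a j)" for k
    by (induction k) simp_all
  moreover have "W 0 = 2 * F" by (simp add: W_def weyl_0 szego_dual_def)
  ultimately have F: "2 * F = W k + (\<Sum>j<k. (1 - r) * cnj (poly (\<psi> j) z0) * a j)" for k by simp
  \<comment> \<open>Then n (1 - r) lies between 1 and 2: the lower bound serves the estimate of S^2,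
    the upper one keeps the drift of W comparable to W itself.\<close>
  define n where "n = nat \<lceil>1 / (1 - r)\<rceil>"
  have "real n = of_int \<lceil>1 / (1 - r)\<rceil>" using r by (simp add: n_def)
  then have n: "1 / (1 - r) \<le> real n" "real n \<le> 1 / (1 - r) + 1" by linarith+
  have n1: "1 \<le> real n * (1 - r)" using n(1) r by (simp add: field_simps)
  have "real n * (1 - r) \<le> (1 / (1 - r) + 1) * (1 - r)" using n(2) r by (intro mult_right_mono) auto
  also have "\<dots> \<le> 2" using r by (simp add: field_simps)
  finally have n2: "real n * (1 - r) \<le> 2" .
  define S where "S = (\<Sum>j<n. cmod (a j))"
  have S0: "0 \<le> S" by (simp add: S_def sum_nonneg)
  have each: "2 * cmod F \<le> 2 * C * cmod (a k) + (1 - r) * C * S" if "k < n" for k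
  proof -
    have "2 * cmod F = cmod (2 * F)" by (simp add: norm_mult)
    also have "\<dots> \<le> cmod (W k) + cmod (\<Sum>j<k. (1 - r) * cnj (poly (\<psi> j) z0) * a j)"
      unfolding F[of k] by (rule norm_triangle_ineq)
    also have "cmod (W k) \<le> C * cmod (a k) + C * cmod (b k)"
      unfolding W_def using ps by (intro norm_triangle_le add_mono) (auto simp: norm_mult mult_right_mono)
    also have "\<dots> \<le> C * cmod (a k) + C * cmod (a k)" using C0 cmod_b_le_a by (intro add_left_mono mult_left_mono)
    also have "cmod (\<Sum>j<k. (1 - r) * cnj (poly (\<psi> j) z0) * a j) \<le> (\<Sum>j<k. (1 - r) * C * cmod (a j))"
    proof (rule sum_norm_le)
      fix j
      have "cmod (complex_of_real (1 - r)) = 1 - r" using r by (simp only: norm_of_real)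
      then show "cmod ((1 - r) * cnj (poly (\<psi> j) z0) * a j) \<le> (1 - r) * C * cmod (a j)"
        unfolding norm_mult complex_mod_cnj using ps[of j] r by (simp only:) (intro mult_right_mono mult_left_mono; simp)
    qed
    also have "\<dots> = (1 - r) * C * (\<Sum>j<k. cmod (a j))" by (simp add: sum_distrib_left)
    also have "\<dots> \<le> (1 - r) * C * S"
      unfolding S_def using that C0 r by (intro mult_left_mono sum_mono2) auto
    finally show ?thesis by simp
  qed
  have "real n * (2 * cmod F) = (\<Sum>k<n. 2 * cmod F)" by simp
  also have "\<dots> \<le> (\<Sum>k<n. 2 * C * cmod (a k) + (1 - r) * C * S)" using each by (intro sum_mono) auto
  also have "\<dots> = 2 * C * S + (real n * (1 - r)) * (C * S)"
    by (simp add: sum.distrib S_def flip: sum_distrib_left)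
  also have "\<dots> \<le> 2 * C * S + 2 * (C * S)" using n2 C0 S0 by (intro add_left_mono mult_right_mono) auto
  finally have "real n * (2 * cmod F) \<le> 4 * C * S" by simp
  then have "(real n * (2 * cmod F))\<^sup>2 \<le> (4 * C * S)\<^sup>2" by (intro power_mono) auto
  then have main: "4 * (real n)\<^sup>2 * (cmod F)\<^sup>2 \<le> 16 * C\<^sup>2 * S\<^sup>2" by (simp add: power_mult_distrib)
  have "S\<^sup>2 \<le> (real n * (1 - r)) * S\<^sup>2" using n1 mult_right_mono[OF n1, of "S\<^sup>2"] by simp
  also have "\<dots> = real n * ((1 - r) * S\<^sup>2)" by simp
  also have "\<dots> \<le> real n * (4 * real n * cmod F)"
    using sum_cmod_a_le[of n] unfolding S_def cz by (intro mult_left_mono) auto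
  finally have "16 * C\<^sup>2 * S\<^sup>2 \<le> 16 * C\<^sup>2 * (real n * (4 * real n * cmod F))" by (intro mult_left_mono) auto
  with main have "4 * (real n)\<^sup>2 * (cmod F * cmod F) \<le> 4 * (real n)\<^sup>2 * ((16 * C\<^sup>2) * cmod F)"
    by (simp add: power2_eq_square mult_ac)
  moreover have "0 < 4 * (real n)\<^sup>2" using n1 by (cases "n = 0") auto
  ultimately have "cmod F * cmod F \<le> (16 * C\<^sup>2) * cmod F" by (rule mult_left_le_imp_le)
  then have "cmod F \<le> 16 * C\<^sup>2"
    by (cases "cmod F = 0") (auto simp: mult_le_cancel_right)
  then show ?thesis unfolding z_def .
qed

text \<open>At z = (1 - h) z0 the Poisson kernel is at least h / (2 h)^2 = 1 / (4 h) on the ball,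
  which turns 16 into 64.\<close>

lemma measure_ball_le:
  assumes z0: "cmod z0 = 1" and C: "\<And>n. row_norm n \<alpha> z0 \<le> C" and h: "0 < h" "h < 1"
  shows "measure \<mu> (ball z0 h \<inter> unit_circle) \<le> 64 * C\<^sup>2 * h"
proof -
  define r where "r = 1 - h"
  define z where "z = of_real r * z0"
  have r: "0 < r" "r < 1" using h by (auto simp: r_def)
  have cz: "cmod z = r" using z0 r by (simp add: z_def norm_mult)
  interpret weyl_solution \<mu> z
    by (intro weyl_solution.intro circle_measure_axioms weyl_solution_axioms.intro) (use cz r in simp)
  let ?B = "ball z0 h \<inter> unit_circle"
  have B: "?B \<in> sets \<mu>" unfolding sets_mu by (subst sets_restrict_space_iff) auto
  let ?P = "\<lambda>e. (1 - (cmod z)\<^sup>2) / (cmod (e - z))\<^sup>2"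
  have z2: "h \<le> 1 - (cmod z)\<^sup>2" using h unfolding cz r_def by (simp add: power2_eq_square algebra_simps)
  have "measure \<mu> ?B * (1 / (4 * h)) = (\<integral>e. indicator ?B e * (1 / (4 * h)) \<partial>\<mu>)"
    using B by simp
  also have "\<dots> \<le> (\<integral>e. ?P e \<partial>\<mu>)"
  proof (rule integral_mono)
    show "integrable \<mu> (\<lambda>e. indicator ?B e * (1 / (4 * h)))"
      using B by (intro integrable_mult_left integrable_real_indicator) (auto simp: emeasure_eq_measure)
    show "integrable \<mu> ?P"
      by (intro integrable_continuous continuous_intros) (use z_in_disc in auto)
    fix e assume "e \<in> space \<mu>"
    then have e: "cmod e = 1" by simp
    show "indicator ?B e * (1 / (4 * h)) \<le> ?P e"
    proof (cases "e \<in> ?B")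
      case True
      have "cmod (e - z) \<le> cmod (e - z0) + cmod (z0 - z)" using norm_triangle_ineq[of "e - z0" "z0 - z"] by simp
      moreover have "z0 - z = of_real h * z0" by (simp add: z_def r_def algebra_simps)
      then have "cmod (z0 - z) = h" using h z0 by (simp add: norm_mult)
      moreover have "cmod (e - z0) < h" using True by (simp add: dist_norm norm_minus_commute)
      ultimately have "cmod (e - z) \<le> 2 * h" by linarith
      then have "(cmod (e - z))\<^sup>2 \<le> (2 * h)\<^sup>2" by (intro power_mono) auto
      moreover have "0 < (cmod (e - z))\<^sup>2" using e z_in_disc by auto
      ultimately have "h / (2 * h)\<^sup>2 \<le> ?P e" using z2 h by (intro frac_le) auto
      moreover have "h / (2 * h)\<^sup>2 = 1 / (4 * h)" using h by (simp add: power2_eq_square)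
      ultimately show ?thesis using True by simp
    next
      case False
      then show ?thesis using z2 h by simp
    qed
  qed
  also have "\<dots> = Re F" by (rule Re_F[symmetric])
  also have "\<dots> \<le> cmod F" by (rule complex_Re_le_cmod)
  also have "\<dots> \<le> 16 * C\<^sup>2" using cmod_caratheodory_le[OF z0 C r] unfolding z_def .
  finally show ?thesis using h by (simp add: field_simps)
qed

end

section \<open>Singular part\<close>

text \<open>Allowing every larger null set N' makes two decompositions comparable: both can be read
  off on the union of their null sets.\<close>

lemma is_singular_part_eq_restriction:
  assumes "is_singular_part M \<mu> \<nu>" "sets \<mu> = sets M"
  shows "\<exists>N\<in>null_sets M. \<forall>N'\<in>null_sets M. N \<subseteq> N' \<longrightarrow> (\<forall>A\<in>sets \<mu>. emeasure \<nu> A = emeasure \<mu> (A \<inter> N'))"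
proof -
  from assms(1) obtain N \<nu>' where s: "sets \<nu> = sets \<mu>" "sets \<nu>' = sets \<mu>"
    and N: "N \<in> null_sets M" "space \<nu> - N \<in> null_sets \<nu>" and ac: "absolutely_continuous M \<nu>'"
    and sum: "\<And>A. A \<in> sets \<mu> \<Longrightarrow> emeasure \<mu> A = emeasure \<nu>' A + emeasure \<nu> A"
    unfolding is_singular_part_def mutually_singular_def by blast
  have "emeasure \<nu> A = emeasure \<mu> (A \<inter> N')" if N': "N' \<in> null_sets M" "N \<subseteq> N'" and A: "A \<in> sets \<mu>" for N' A
  proof -
    have AN: "A \<inter> N' \<in> sets \<mu>" "A - N' \<in> sets \<mu>" using A N'(1) assms(2) by auto
    have "A \<inter> N' \<in> null_sets M"
      using N'(1) A assms(2) by (intro null_set_Int1) auto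
    then have "A \<inter> N' \<in> null_sets \<nu>'" using ac by (auto simp: absolutely_continuous_def)
    then have "emeasure \<nu>' (A \<inter> N') = 0" by (rule null_setsD1)
    then have "emeasure \<mu> (A \<inter> N') = emeasure \<nu> (A \<inter> N')" using sum[OF AN(1)] by simp
    moreover have "A - N' \<in> null_sets \<nu>"
    proof (rule null_sets_subset[OF N(2)])
      show "A - N' \<in> sets \<nu>" using AN s by simp
      show "A - N' \<subseteq> space \<nu> - N" using A N'(2) s sets.sets_into_space[of A \<nu>] by blast
    qed
    then have "emeasure \<nu> (A \<inter> N') = emeasure \<nu> A"
      using A N'(1) s assms(2) emeasure_Diff_null_set[of "A - N'" \<nu> A] by (simp add: Diff_Diff_Int)
    ultimately show ?thesis by simp
  qed
  then show ?thesis using N(1) by blast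
qed

lemma is_singular_part_unique:
  assumes "sets \<mu> = sets M" "is_singular_part M \<mu> \<nu>" "is_singular_part M \<mu> \<nu>'"
  shows "\<nu> = \<nu>'"
proof (rule measure_eqI)
  show s: "sets \<nu> = sets \<nu>'" using assms(2,3) by (simp add: is_singular_part_def)
  obtain N where N: "N \<in> null_sets M"
    "\<forall>N'\<in>null_sets M. N \<subseteq> N' \<longrightarrow> (\<forall>A\<in>sets \<mu>. emeasure \<nu> A = emeasure \<mu> (A \<inter> N'))"
    using is_singular_part_eq_restriction[OF assms(2,1)] by blast
  obtain N2 where N2: "N2 \<in> null_sets M"
    "\<forall>N'\<in>null_sets M. N2 \<subseteq> N' \<longrightarrow> (\<forall>A\<in>sets \<mu>. emeasure \<nu>' A = emeasure \<mu> (A \<inter> N'))"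
    using is_singular_part_eq_restriction[OF assms(3,1)] by blast
  have "N \<union> N2 \<in> null_sets M" using N N2 by blast
  moreover fix A assume "A \<in> sets \<nu>"
  then have "A \<in> sets \<mu>" using assms(2) by (simp add: is_singular_part_def)
  ultimately show "emeasure \<nu> A = emeasure \<nu>' A" using N(2) N2(2) by simp
qed

lemma is_singular_part_exists:
  assumes "finite_measure \<mu>" and s: "sets \<mu> = sets M"
  shows "\<exists>\<nu>. is_singular_part M \<mu> \<nu>"
proof -
  interpret finite_measure \<mu> by fact
  \<comment> \<open>The singular part is the restriction of \<open>\<mu>\<close> to an \<open>M\<close>-null set of maximal \<open>\<mu>\<close>-measure.\<close>
  define S where "S = Sup (measure \<mu> ` null_sets M)"
  have bdd: "bdd_above (measure \<mu> ` null_sets M)" by (rule bdd_aboveI2[of _ _ "measure \<mu> (space \<mu>)"]) (rule bounded_measure)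
  have upper: "measure \<mu> A \<le> S" if "A \<in> null_sets M" for A
    unfolding S_def using that bdd by (intro cSup_upper) auto
  have "\<exists>A\<in>null_sets M. S - 1 / real (Suc n) < measure \<mu> A" for n
    using less_cSup_iff[of "measure \<mu> ` null_sets M" "S - 1 / real (Suc n)"] bdd
    unfolding S_def[symmetric] by (auto intro!: exI[of _ "{}"])
  then obtain A where A: "\<And>n. A n \<in> null_sets M" "\<And>n. S - 1 / real (Suc n) < measure \<mu> (A n)" by metis
  define N where "N = (\<Union>n. A n)"
  have N: "N \<in> null_sets M" unfolding N_def using A(1) by auto
  then have Ns: "N \<in> sets \<mu>" using s by auto
  have "S \<le> measure \<mu> N"
  proof (rule field_le_epsilon)
    fix e :: real assume "e > 0"
    then obtain n where n: "1 / real (Suc n) < e" using nat_approx_posE by metis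
    have "measure \<mu> (A n) \<le> measure \<mu> N" using Ns by (intro finite_measure_mono) (auto simp: N_def)
    then show "S \<le> measure \<mu> N + e" using A(2)[of n] n by linarith
  qed
  have max: "emeasure \<mu> (B - N) = 0" if B: "B \<in> null_sets M" for B
  proof -
    have Bs: "B \<in> sets \<mu>" using B s by auto
    have "measure \<mu> (N \<union> (B - N)) = measure \<mu> N + measure \<mu> (B - N)"
      using Ns Bs by (intro finite_measure_Union) auto
    moreover have "N \<union> (B - N) = N \<union> B" by auto
    moreover have "measure \<mu> (N \<union> B) \<le> S" using N B by (intro upper) auto
    ultimately have "measure \<mu> (B - N) \<le> 0" using \<open>S \<le> measure \<mu> N\<close> by simp
    then show ?thesis by (simp add: emeasure_eq_measure measure_le_0_iff)
  qed
  define \<nu> where "\<nu> = density \<mu> (indicator N)"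
  define \<nu>' where "\<nu>' = density \<mu> (indicator (space \<mu> - N))"
  have e: "emeasure \<nu> B = emeasure \<mu> (B \<inter> N)" "emeasure \<nu>' B = emeasure \<mu> (B - N)" if "B \<in> sets \<mu>" for B
  proof -
    show "emeasure \<nu> B = emeasure \<mu> (B \<inter> N)"
      unfolding \<nu>_def using that Ns by (simp add: emeasure_restricted Int_commute)
    have "(space \<mu> - N) \<inter> B = B - N" using sets.sets_into_space[OF that] by auto
    then show "emeasure \<nu>' B = emeasure \<mu> (B - N)"
      unfolding \<nu>'_def using that Ns by (simp add: emeasure_restricted)
  qed
  have sp: "space \<nu> = space \<mu>" by (simp add: \<nu>_def)
  have "is_singular_part M \<mu> \<nu>"
    unfolding is_singular_part_def mutually_singular_def
  proof (intro conjI exI[of _ N] exI[of _ \<nu>'] ballI)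
    show "sets \<nu> = sets \<mu>" "sets \<nu>' = sets \<mu>" by (simp_all add: \<nu>_def \<nu>'_def)
    show "N \<in> null_sets M" by fact
    show "space \<nu> - N \<in> null_sets \<nu>"
    proof -
      have "(space \<mu> - N) \<inter> N = {}" by auto
      then show ?thesis using Ns e(1)[of "space \<mu> - N"] by (simp add: null_sets_def sp) (simp add: \<nu>_def)
    qed
    show "absolutely_continuous M \<nu>'"
      unfolding absolutely_continuous_def
    proof
      fix B assume B: "B \<in> null_sets M"
      then have "B \<in> sets \<mu>" using s by auto
      then show "B \<in> null_sets \<nu>'" using max[OF B] e(2)[of B] by (simp add: null_sets_def) (simp add: \<nu>'_def)
    qed
    fix B assume B: "B \<in> sets \<mu>"
    show "emeasure \<mu> B = emeasure \<nu>' B + emeasure \<nu> B"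
    proof -
      have "(B - N) \<union> (B \<inter> N) = B" "(B - N) \<inter> (B \<inter> N) = {}" by auto
      then show ?thesis using Ns B plus_emeasure[of "B - N" \<mu> "B \<inter> N"] by (simp add: e)
    qed
  qed
  then show ?thesis by blast
qed

lemma is_singular_part_singular_part:
  assumes "finite_measure \<mu>" "sets \<mu> = sets M"
  shows "is_singular_part M \<mu> (singular_part M \<mu>)"
  unfolding singular_part_def
  using is_singular_part_exists[OF assms] is_singular_part_unique[OF assms(2)] by (metis theI)

lemma sets_singular_part:
  assumes "finite_measure \<mu>" "sets \<mu> = sets M"
  shows "sets (singular_part M \<mu>) = sets \<mu>"
  using is_singular_part_singular_part[OF assms] by (simp add: is_singular_part_def)

lemma null_sets_singular_part:
  assumes "finite_measure \<mu>" "sets \<mu> = sets M" "A \<in> sets \<mu>"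
    and "\<And>N. N \<in> null_sets M \<Longrightarrow> emeasure \<mu> (A \<inter> N) = 0"
  shows "A \<in> null_sets (singular_part M \<mu>)"
proof -
  have "is_singular_part M \<mu> (singular_part M \<mu>)" using assms(1,2) by (rule is_singular_part_singular_part)
  moreover from is_singular_part_eq_restriction[OF this assms(2)] obtain N where
    "N \<in> null_sets M" "emeasure (singular_part M \<mu>) A = emeasure \<mu> (A \<inter> N)" using assms(3) by blast
  ultimately show ?thesis using assms(3,4) by (auto simp: null_sets_def is_singular_part_def)
qed

section \<open>Linear growth of the measure excludes singular mass\<close>

lemma sets_arc_length: "sets arc_length = sets circle_borel"
  by (simp add: arc_length_def)

lemma null_sets_arc_length:
  assumes "N \<in> null_sets arc_length"
  shows "{t \<in> {0..<2 * pi}. cis t \<in> N} \<in> null_sets lborel"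
proof -
  let ?L = "restrict_space lborel {0..<2 * pi}"
  have m: "cis \<in> measurable ?L circle_borel"
    by (intro measurable_restrict_space1 measurable_restrict_space2) (auto simp: cis_conv_exp[abs_def] intro!: borel_measurable_continuous_onI continuous_intros)
  have N: "N \<in> sets circle_borel" using assms sets_arc_length by auto
  have "emeasure ?L (cis -` N \<inter> space ?L) = 0"
    using assms emeasure_distr[OF m N] unfolding arc_length_def null_sets_def by auto
  moreover have "cis -` N \<inter> space ?L = {t \<in> {0..<2 * pi}. cis t \<in> N}" by (auto simp: space_restrict_space)
  moreover have "cis -` N \<inter> space ?L \<in> sets ?L" using m N by (rule measurable_sets)
  ultimately show ?thesis
    by (auto simp: null_sets_def emeasure_restrict_space sets_restrict_space_iff)
qed

text \<open>Countable subadditivity for a family indexed by a countable set, here of intervals. It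
  is Tonelli's theorem for the sum of the indicators.\<close>

lemma emeasure_UN_le_nn_integral:
  assumes [measurable]: "\<And>i. i \<in> I \<Longrightarrow> X i \<in> sets M" and I: "countable I"
  shows "emeasure M (\<Union>i\<in>I. X i) \<le> (\<integral>\<^sup>+i. emeasure M (X i) \<partial>count_space I)"
proof -
  have U: "(\<Union>i\<in>I. X i) \<in> sets M" using I by (rule sets.countable_UN') (use assms(1) in blast)
  then have "emeasure M (\<Union>i\<in>I. X i) = (\<integral>\<^sup>+x. indicator (\<Union>i\<in>I. X i) x \<partial>M)" by simp
  also have "\<dots> \<le> (\<integral>\<^sup>+x. \<integral>\<^sup>+i. indicator (X i) x \<partial>count_space I \<partial>M)"
  proof (rule nn_integral_mono)
    fix x
    show "indicator (\<Union>i\<in>I. X i) x \<le> (\<integral>\<^sup>+i. indicator (X i) x \<partial>count_space I :: ennreal)"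
    proof (cases "x \<in> (\<Union>i\<in>I. X i)")
      case True
      then obtain i where i: "i \<in> I" "x \<in> X i" by blast
      then show ?thesis using nn_integral_ge_point[OF i(1), of "\<lambda>i. indicator (X i) x"] True by simp
    qed simp
  qed
  also have "\<dots> = (\<integral>\<^sup>+i. \<integral>\<^sup>+x. indicator (X i) x \<partial>M \<partial>count_space I)"
    using I by (rule nn_integral_count_space_nn_integral) simp
  also have "\<dots> = (\<integral>\<^sup>+i. emeasure M (X i) \<partial>count_space I)"
    by (intro nn_integral_cong) simp
  finally show ?thesis .
qed

text \<open>Parameter intervals of total length e covering the null set yield balls centred in
  \<open>E\<close> whose \<open>\<mu>\<close>-measures sum to at most 2 C e.\<close>

lemma (in circle_measure) emeasure_null_of_linear_growth:
  assumes E: "E \<in> sets \<mu>" "{t \<in> {0..<2 * pi}. cis t \<in> E} \<in> null_sets lborel" (is "?T \<in> _")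
    and C: "\<And>z h. z \<in> E \<Longrightarrow> 0 < h \<Longrightarrow> h < 1 \<Longrightarrow> measure \<mu> (ball z h \<inter> unit_circle) \<le> C * h"
    and C0: "0 \<le> C"
  shows "emeasure \<mu> E = 0"
proof -
  have "emeasure \<mu> E \<le> ennreal (2 * C * e)" if e: "0 < e" "e < 1/2" for e
  proof -
    have T: "?T \<in> null_sets lebesgue" using E(2) null_sets_completionI by blast
    then have Tl: "?T \<in> lmeasurable" by (intro fmeasurableI_null_sets)
    have Tb: "?T \<subseteq> cbox 0 (2 * pi)" by auto
    have bx: "box 0 (2 * pi) \<noteq> {}" by (simp add: not_le)
    have "\<exists>D. countable D \<and> (\<forall>K\<in>D. \<exists>c d. K = cbox c d) \<and> pairwise (\<lambda>A B. interior A \<inter> interior B = {}) D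
        \<and> (\<forall>K\<in>D. interior K \<noteq> {}) \<and> ?T \<subseteq> \<Union>D \<and> \<Union>D \<in> lmeasurable
        \<and> measure lebesgue (\<Union>D) \<le> measure lebesgue ?T + e"
    proof (rule measurable_outer_intervals_bounded[OF Tl Tb e(1)], goal_cases)
      case (1 D)
      have "\<forall>K\<in>D. \<exists>c d. K = cbox c d" using 1(2) by blast
      moreover have "\<forall>K\<in>D. interior K \<noteq> {}" using 1(5)[OF _ bx] by blast
      ultimately show ?case by (intro exI[of _ D] conjI 1(1,3,6,7,8))
    qed
    then obtain D where DD: "countable D \<and> (\<forall>K\<in>D. \<exists>c d. K = cbox c d) \<and> pairwise (\<lambda>A B. interior A \<inter> interior B = {}) D
        \<and> (\<forall>K\<in>D. interior K \<noteq> {}) \<and> ?T \<subseteq> \<Union>D \<and> \<Union>D \<in> lmeasurable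
        \<and> measure lebesgue (\<Union>D) \<le> measure lebesgue ?T + e" ..
    note Da = DD[THEN conjunct2] and Db = DD[THEN conjunct2, THEN conjunct2, THEN conjunct2]
    note D = DD[THEN conjunct1] Da[THEN conjunct1, THEN bspec] Da[THEN conjunct2, THEN conjunct1]
      Db[THEN conjunct1, THEN bspec] Db[THEN conjunct2, THEN conjunct1]
      Db[THEN conjunct2, THEN conjunct2, THEN conjunct1] Db[THEN conjunct2, THEN conjunct2, THEN conjunct2]
    have me: "emeasure lebesgue (\<Union>D) \<le> ennreal e"
      using D(6,7) T by (simp add: emeasure_eq_measure2 ennreal_leI measure_eq_0_null_sets)
    \<comment> \<open>Lengths are taken on interiors because those are pairwise disjoint, while the
      closed intervals may share end points.\<close>
    define len where "len K = measure lebesgue (interior K)" for K :: "real set"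
    have em: "emeasure lebesgue (interior K) \<le> ennreal e" if "K \<in> D" for K
      using me that D(6) interior_subset[of K] by (intro order_trans[OF emeasure_mono[of "interior K" "\<Union>D" lebesgue] me]) (auto simp: fmeasurableD)
    have eml: "emeasure lebesgue (interior K) = ennreal (len K)" if "K \<in> D" for K
      unfolding len_def using em[OF that] by (intro emeasure_eq_ennreal_measure) (auto simp: top_unique)
    have lk: "\<exists>c. K = {c..c + len K} \<and> 0 < len K \<and> len K < 1/2" if K: "K \<in> D" for K
    proof -
      obtain c d where cd: "K = {c..d}" using D(2)[OF K] by auto
      then have "c < d" using D(4)[OF K] by auto
      moreover from this have "len K = d - c" using cd by (simp add: len_def)
      moreover have "ennreal (len K) \<le> ennreal e" using em[OF K] eml[OF K] by simp
      then have "len K \<le> e" using e by simp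
      ultimately show ?thesis using cd e by (intro exI[of _ c]) auto
    qed
    \<comment> \<open>Growth is known only at points of \<open>E\<close>, so intervals without such
      a point are discarded and the others receive one as a centre.\<close>
    define D' where "D' = {K \<in> D. \<exists>t\<in>K. t \<in> ?T}"
    define t where "t K = (SOME t. t \<in> K \<and> t \<in> ?T)" for K
    have t: "t K \<in> K" "cis (t K) \<in> E" if "K \<in> D'" for K
    proof -
      have "\<exists>s. s \<in> K \<and> s \<in> ?T" using that by (auto simp: D'_def)
      from someI_ex[OF this] show "t K \<in> K" "cis (t K) \<in> E" by (auto simp: t_def)
    qed
    \<comment> \<open>Points on the arc are within \<open>len K\<close> of the centre; doubling the
      radius puts them in the open ball, and len K < 1/2 keeps the radius below 1.\<close>
    define V where "V K = ball (cis (t K)) (2 * len K) \<inter> unit_circle" for K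
    have Vs: "V K \<in> sets \<mu>" for K
      unfolding V_def sets_mu by (subst sets_restrict_space_iff) auto
    have VC: "emeasure \<mu> (V K) \<le> ennreal (2 * C) * emeasure lebesgue (interior K)" if "K \<in> D'" for K
    proof -
      have K: "K \<in> D" using that by (simp add: D'_def)
      have "measure \<mu> (V K) \<le> C * (2 * len K)"
        unfolding V_def using lk[OF K] t[OF that] by (intro C) auto
      then show ?thesis unfolding eml[OF K]
        using C0 lk[OF K] by (auto simp: emeasure_eq_measure mult_ac simp flip: ennreal_mult intro!: ennreal_leI)
    qed
    have cD': "countable D'" using D(1) by (auto simp: D'_def intro: countable_subset)
    have cover: "E \<subseteq> (\<Union>K\<in>D'. V K)"
    proof
      fix z assume z: "z \<in> E"
      then have cz: "cmod z = 1" using sets.sets_into_space[OF E(1)] by auto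
      obtain s where s: "0 \<le> s" "s < 2 * pi" "z = cis s"
        using complex_unimodular_polar[OF cz] by (auto simp: complex_eq_iff)
      then have sT: "s \<in> ?T" using z by auto
      then obtain K where K: "K \<in> D" "s \<in> K" using D(5) by auto
      then have KD: "K \<in> D'" using sT by (auto simp: D'_def)
      obtain c where c: "K = {c..c + len K}" "0 < len K" using lk[OF K(1)] by blast
      have "t K \<in> {c..c + len K}" "s \<in> {c..c + len K}" using t(1)[OF KD] K(2) c(1) by auto
      then have "\<bar>t K - s\<bar> \<le> len K" by auto
      then have "cmod (cis (t K) - cis s) \<le> len K" using norm_cis_diff_le[of "t K" s] by linarith
      then have "z \<in> V K" using c cz s by (simp add: V_def dist_norm)
      then show "z \<in> (\<Union>K\<in>D'. V K)" using KD by blast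
    qed
    have UV: "(\<Union>K\<in>D'. V K) \<in> sets \<mu>" using cD' Vs by (intro sets.countable_UN') auto
    have dj: "disjoint_family_on interior D'"
      using D(3) by (auto simp: disjoint_family_on_def pairwise_def D'_def)
    have "emeasure \<mu> E \<le> emeasure \<mu> (\<Union>K\<in>D'. V K)" using cover UV by (rule emeasure_mono)
    also have "\<dots> \<le> (\<integral>\<^sup>+K. emeasure \<mu> (V K) \<partial>count_space D')"
      using cD' Vs by (intro emeasure_UN_le_nn_integral) auto
    also have "\<dots> \<le> (\<integral>\<^sup>+K. ennreal (2 * C) * emeasure lebesgue (interior K) \<partial>count_space D')"
      by (intro nn_integral_mono) (use VC in auto)
    also have "\<dots> = ennreal (2 * C) * (\<integral>\<^sup>+K. emeasure lebesgue (interior K) \<partial>count_space D')"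
      by (rule nn_integral_cmult) simp
    also have "(\<integral>\<^sup>+K. emeasure lebesgue (interior K) \<partial>count_space D') = emeasure lebesgue (\<Union>K\<in>D'. interior K)"
      using cD' dj by (intro emeasure_UN_countable[symmetric]) auto
    also have "\<dots> \<le> emeasure lebesgue (\<Union>D)"
      using D(6) interior_subset by (intro emeasure_mono) (fastforce simp: D'_def fmeasurableD)+
    also have "\<dots> \<le> ennreal e" by (rule me)
    finally show ?thesis using C0 e by (simp add: mult_left_mono flip: ennreal_mult)
  qed
  note le = this
  have "emeasure \<mu> E \<le> 0 + ennreal e" if "0 < e" for e
  proof -
    define d where "d = min (1/4) (e / (2 * C + 1))"
    have "0 < d" "d < 1/2" using that C0 by (auto simp: d_def)
    then have "emeasure \<mu> E \<le> ennreal (2 * C * d)" by (rule le)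
    also have "2 * C * d \<le> 2 * C * (e / (2 * C + 1))" using C0 by (intro mult_left_mono) (auto simp: d_def)
    also have "\<dots> \<le> e" using C0 that by (simp add: field_simps)
    finally show ?thesis using that by (simp add: ennreal_leI)
  qed
  note le0 = this
  have "emeasure \<mu> E \<le> 0" by (rule ennreal_le_epsilon) (rule le0)
  then show ?thesis by simp
qed

text \<open>Splitting by the integer bound m makes the growth constant uniform on each piece; the
  pieces are closed, which supplies the measurability required by \<open>null_sets\<close>.\<close>

lemma (in circle_measure) null_sets_singular_part_bounded:
  "{z \<in> unit_circle. \<exists>B. \<forall>n. row_norm n \<alpha> z \<le> B} \<in> null_sets (singular_part arc_length \<mu>)"
proof -
  define E where "E m = {z \<in> unit_circle. \<forall>n. row_norm n \<alpha> z \<le> real m}" for m :: nat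
  have Em: "E m \<in> sets \<mu>" for m
  proof -
    have "E m = unit_circle \<inter> (\<Inter>n. {z. row_norm n \<alpha> z \<le> real m})" by (auto simp: E_def)
    also have "closed \<dots>"
      unfolding row_norm_def by (intro closed_Int closed_INT ballI closed_Collect_le continuous_intros) auto
    finally have "E m \<in> sets borel" by (rule borel_closed)
    then show ?thesis unfolding sets_mu by (subst sets_restrict_space_iff) (auto simp: E_def)
  qed
  have "{z \<in> unit_circle. \<exists>B. \<forall>n. row_norm n \<alpha> z \<le> B} = (\<Union>m. E m)"
    by (auto simp: E_def) (metis order_trans real_arch_simple)
  moreover have "E m \<in> null_sets (singular_part arc_length \<mu>)" for m
  proof (rule null_sets_singular_part[OF finite_measure_axioms _ Em])
    show "sets \<mu> = sets arc_length" by (simp add: sets_mu sets_arc_length)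
    fix N assume N: "N \<in> null_sets arc_length"
    then have Ns: "N \<in> sets \<mu>" using sets_mu sets_arc_length by auto
    have "E m \<inter> N \<in> null_sets arc_length"
      using N Em[of m] by (intro null_set_Int1) (auto simp: sets_mu sets_arc_length)
    then have "{t \<in> {0..<2 * pi}. cis t \<in> E m \<inter> N} \<in> null_sets lborel" by (rule null_sets_arc_length)
    then show "emeasure \<mu> (E m \<inter> N) = 0"
      by (rule emeasure_null_of_linear_growth[of _ "64 * (real m)\<^sup>2", rotated])
         (use Em Ns in \<open>auto simp: E_def intro!: measure_ball_le\<close>)
  qed
  ultimately show ?thesis by auto
qed

theorem theorem1p1:
  fixes \<gamma> :: real and \<mu> :: "complex measure"
  assumes "0 < \<gamma>" and "\<gamma> < 1"
    and "prob_space \<mu>" and "sets \<mu> = sets circle_borel" and "nontrivial \<mu>"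
    and "summable (\<lambda>n. real n powr \<gamma> * (cmod (verblunsky \<mu> n))\<^sup>2)"
  shows "(\<exists>S \<subseteq> unit_circle. hausdorff_dim S \<le> ennreal (1 - \<gamma>) \<and>
            (\<forall>z \<in> unit_circle - S. bdd_above (range (\<lambda>n. onorm (\<lambda>v. szego_matrix \<mu> n z *v v)))))
       \<and> (\<exists>A \<subseteq> unit_circle. hausdorff_dim A \<le> ennreal (1 - \<gamma>) \<and>
            supported_by (singular_part arc_length \<mu>) A)"
proof -
  interpret circle_measure \<mu>
    using assms(3,4,5) by (intro circle_measure.intro circle_measure_axioms.intro)
  interpret decaying_coefficients \<alpha> \<gamma>
    by unfold_locales (use \<alpha>_less_1 assms(1,2,6) in \<open>auto simp: \<alpha>_def\<close>)
  \<comment> \<open>One exceptional set serves both claims: off it the matrices are bounded, and its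
    complement in the circle is null for the singular part.\<close>
  let ?S = "{z \<in> unit_circle. \<not> (\<exists>B. \<forall>n. row_norm n \<alpha> z \<le> B)}"
  have bdd: "bdd_above (range (\<lambda>n. onorm (\<lambda>v. szego_matrix \<mu> n z *v v)))" if z: "z \<in> unit_circle - ?S" for z
  proof -
    from z obtain B where B: "\<And>n. row_norm n \<alpha> z \<le> B" by blast
    show ?thesis
    proof (rule bdd_aboveI2)
      fix n
      show "onorm (\<lambda>v. szego_matrix \<mu> n z *v v) \<le> 4 * B"
        using onorm_szego_matrix_le[of z n] B[of n] z by simp
    qed
  qed
  have "space (singular_part arc_length \<mu>) = unit_circle"
    using sets_eq_imp_space_eq[OF sets_singular_part[OF finite_measure_axioms]] sets_mu sets_arc_length by simp
  then have "space (singular_part arc_length \<mu>) - ?S = {z \<in> unit_circle. \<exists>B. \<forall>n. row_norm n \<alpha> z \<le> B}" by auto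
  then have "supported_by (singular_part arc_length \<mu>) ?S"
    unfolding supported_by_def using null_sets_singular_part_bounded by simp
  then show ?thesis using hausdorff_dim_unbounded bdd by (intro conjI exI[of _ ?S]) auto
qed

end
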